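(* Let $X_{\mathcal O}$ be the Ornithorynque origami. Then for any irrational $\alpha\in\mathbb{R}$ and any $p\in X_{\mathcal O}$ outside of the singular leaves of the linear flow $\phi_\alpha$ we have $$H(X_{\mathcal O},\alpha,p)=w(\alpha),$$ where $H(X_{\mathcal O},\alpha,p)$ is the hitting time and $w(\alpha)$ is the diophantine type of $\alpha$.
   Context: **Origamis.** Let $\mathcal Q$ be a finite set and $(h,v)$ a pair of permutations of $\mathcal Q$ generating a transitive subgroup of the symmetric group. The origami $X$ defined by $(h,v)$ is the surface obtained from the squares $Q_j=\{j\}\times[0,1]^2$, $j\in\mathcal Q$, by gluing (by translation), for every $j$, the right side of $Q_j$ to the left side of $Q_{h(j)}$ and the top side of $Q_j$ to the bottom side of $Q_{v(j)}$. The map $(j,x)\mapsto [x]$ induces a covering $\rho_X:X\to\mathbb T^2=\mathbb R^2/\mathbb Z^2$, ramified only over $[0]$. The points $p_1,\dots,p_m$ of $X$ where $\rho_X$ is ramified are the conical points; $X$ inherits a metric which is flat outside these points and has conical angle $2(k_j+1)\pi$ at $p_j$, where $k_j+1$ is the ramification index ($k_j\ge 1$). $\mathrm{Dist}(\cdot,\cdot)$ denotes the corresponding distance on $X$, which equals the euclidean distance on small enough discs in $X\setminus\{p_1,\dots,p_m\}$. **The Ornithorynque.** $X_{\mathcal O}$ is the origami with $\mathcal Q=\mathbb Z/3\mathbb Z\times\mathbb Z/2\mathbb Z\times\mathbb Z/2\mathbb Z$ and, for $i\in\mathbb Z/3\mathbb Z$, $h(i,0,0)=(i+1,1,0)$,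 $h(i,0,1)=(i-1,1,1)$, $h(i,1,0)=(i,0,0)$, $h(i,1,1)=(i,0,1)$; $v(i,0,0)=(i-1,0,1)$, $v(i,0,1)=(i,0,0)$, $v(i,1,0)=(i+1,1,1)$, $v(i,1,1)=(i,1,0)$. It has genus $4$ and three conical points, each with angle $6\pi$. **Linear flow.** For $\alpha\in\mathbb R\cup\{\infty\}$ let $\theta=\arctan\alpha\in(-\pi/2,\pi/2]$ and $e_\alpha=(\sin\theta,\cos\theta)$ (slopes are measured as $x/y$, so slope $0$ is vertical). The linear flow $\phi_\alpha$ on $X$ is the continuous flow determined by $\rho_X(\phi_\alpha(t,p))=\rho_X(p)+te_\alpha \bmod \mathbb Z^2$. There are $k_j+1$ trajectories starting at each conical point $p_j$ and $k_j+1$ trajectories ending at $p_j$ (trajectories stop when they hit a conical point); these are called the singular leaves. The flow is a regular $\mathbb R$-action outside singular leaves. **Diophantine type.** $w(\alpha)=\sup\{w>0: |\alpha-p/q|<q^{-(w+1)}\text{ for infinitely many }p/q\in\mathbb Q\}$, with $p,q$ coprime. **Hitting time.** For $p\in X$ and $r>0$, $$T(X,\alpha,p,r)=\sup_{\widetilde p\in X}\ \inf\{t>r:\mathrm{Dist}(\phi_\alpha(t,p),\widetilde p)<r\},$$ and $$H(X,\alpha,p)=\limsup_{r\to0^+}\frac{\log T(X,\alpha,p,r)}{-\log r}.$$ *)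

theory Defs
  imports "HOL-Analysis.Analysis"
begin

section \<open>Origamis as square-tiled surfaces\<close>

definition origami :: "('q::finite \<Rightarrow> 'q) \<Rightarrow> ('q \<Rightarrow> 'q) \<Rightarrow> bool" where
  "origami h v \<longleftrightarrow> bij h \<and> bij v \<and> (\<forall>j k. equivclp (\<lambda>a b. b = h a \<or> b = v a) j k)"

definition squares :: "('q \<times> real \<times> real) set" where
  "squares = UNIV \<times> {0..1} \<times> {0..1}"

inductive glue :: "('q \<Rightarrow> 'q) \<Rightarrow> ('q \<Rightarrow> 'q) \<Rightarrow> 'q \<times> real \<times> real \<Rightarrow> 'q \<times> real \<times> real \<Rightarrow> bool"
  for h v where
  right_left: "y \<in> {0..1} \<Longrightarrow> glue h v (j, 1, y) (h j, 0, y)"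
| top_bottom: "x \<in> {0..1} \<Longrightarrow> glue h v (j, x, 1) (v j, x, 0)"

definition glue_rel :: "('q \<Rightarrow> 'q) \<Rightarrow> ('q \<Rightarrow> 'q) \<Rightarrow> (('q \<times> real \<times> real) \<times> ('q \<times> real \<times> real)) set" where
  "glue_rel h v = {(a, b). a \<in> squares \<and> b \<in> squares \<and> equivclp (glue h v) a b}"

lemma equiv_glue_rel: "equiv squares (glue_rel h v)"
proof (rule equivI)
  show "glue_rel h v \<subseteq> squares \<times> squares" by (auto simp: glue_rel_def)
  show "refl_on squares (glue_rel h v)" by (rule refl_onI) (auto simp: glue_rel_def)
  show "sym (glue_rel h v)"
    by (rule symI) (simp add: glue_rel_def equivclp_sym)
  show "trans (glue_rel h v)"
  proof (rule transI)
    fix a b c assume "(a, b) \<in> glue_rel h v" "(b, c) \<in> glue_rel h v"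
    then show "(a, c) \<in> glue_rel h v"
      unfolding glue_rel_def using equivclp_trans[of "glue h v" a b c] by simp
  qed
qed

definition surface :: "('q \<Rightarrow> 'q) \<Rightarrow> ('q \<Rightarrow> 'q) \<Rightarrow> ('q \<times> real \<times> real) set set" where
  "surface h v = squares // glue_rel h v"

definition surface_pt :: "('q \<Rightarrow> 'q) \<Rightarrow> ('q \<Rightarrow> 'q) \<Rightarrow> 'q \<Rightarrow> real \<times> real \<Rightarrow> ('q \<times> real \<times> real) set" where
  "surface_pt h v j x = glue_rel h v `` {(j, x)}"

text \<open>A point of the torus is a coset of the integer lattice in the plane.\<close>

definition torus_pt :: "real \<times> real \<Rightarrow> (real \<times> real) set" where
  "torus_pt x = {y. fst y - fst x \<in> \<int> \<and> snd y - snd x \<in> \<int>}"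

text \<open>The covering of the torus: the union below is over equal cosets, since gluing moves
  coordinates by lattice vectors.\<close>

definition covering :: "('q \<times> real \<times> real) set \<Rightarrow> (real \<times> real) set" where
  "covering p = (\<Union>(j, x)\<in>p. torus_pt x)"

text \<open>\<open>broken_path h v p q l\<close>: there is a path of length \<open>l\<close> from \<open>p\<close> to \<open>q\<close> on the surface which
  is a finite concatenation of straight segments, each contained in one of the squares.
  The distance of the flat surface is the infimum of the lengths of such paths.\<close>

inductive broken_path ::
    "('q \<Rightarrow> 'q) \<Rightarrow> ('q \<Rightarrow> 'q) \<Rightarrow> ('q \<times> real \<times> real) set \<Rightarrow> ('q \<times> real \<times> real) set \<Rightarrow> real \<Rightarrow> bool"
  for h v p where
  start: "p \<in> surface h v \<Longrightarrow> broken_path h v p p 0"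
| segment: "broken_path h v p (surface_pt h v j x) l \<Longrightarrow>
    x \<in> {0..1} \<times> {0..1} \<Longrightarrow> y \<in> {0..1} \<times> {0..1} \<Longrightarrow>
    broken_path h v p (surface_pt h v j y) (l + dist x y)"

definition Dist ::
    "('q \<Rightarrow> 'q) \<Rightarrow> ('q \<Rightarrow> 'q) \<Rightarrow> ('q \<times> real \<times> real) set \<Rightarrow> ('q \<times> real \<times> real) set \<Rightarrow> real" where
  "Dist h v p q = Inf {l. broken_path h v p q l}"

text \<open>Conical points are the ramification points of the covering, i.e. the points none of whose
  neighbourhoods is mapped injectively. A corner of a square need not be conical.\<close>

definition conical :: "('q \<Rightarrow> 'q) \<Rightarrow> ('q \<Rightarrow> 'q) \<Rightarrow> ('q \<times> real \<times> real) set set" where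
  "conical h v = {p \<in> surface h v.
     \<forall>\<epsilon>>0. \<not> inj_on covering {q \<in> surface h v. Dist h v p q < \<epsilon>}}"

section \<open>The linear flow\<close>

text \<open>Slopes are measured as \<open>x/y\<close>, so slope \<open>0\<close> is vertical.\<close>

definition flow_dir :: "real \<Rightarrow> real \<times> real" where
  "flow_dir \<alpha> = (sin (arctan \<alpha>), cos (arctan \<alpha>))"

definition continuous_path ::
    "('q \<Rightarrow> 'q) \<Rightarrow> ('q \<Rightarrow> 'q) \<Rightarrow> real set \<Rightarrow> (real \<Rightarrow> ('q \<times> real \<times> real) set) \<Rightarrow> bool" where
  "continuous_path h v I \<gamma> \<longleftrightarrow> \<gamma> ` I \<subseteq> surface h v \<and>
     (\<forall>t\<in>I. \<forall>\<epsilon>>0. \<exists>\<delta>>0. \<forall>s\<in>I. \<bar>s - t\<bar> < \<delta> \<longrightarrow> Dist h v (\<gamma> t) (\<gamma> s) < \<epsilon>)"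

text \<open>\<open>trajectory h v \<alpha> T p q\<close>: a trajectory in direction \<open>\<alpha>\<close>, parametrised from time \<open>0\<close> to the
  time \<open>T\<close> of either sign, goes from \<open>p\<close> to \<open>q\<close>. Since trajectories stop at conical points, only
  the end points may be conical.\<close>

definition trajectory ::
    "('q \<Rightarrow> 'q) \<Rightarrow> ('q \<Rightarrow> 'q) \<Rightarrow> real \<Rightarrow> real \<Rightarrow>
      ('q \<times> real \<times> real) set \<Rightarrow> ('q \<times> real \<times> real) set \<Rightarrow> bool" where
  "trajectory h v \<alpha> T p q \<longleftrightarrow> (\<exists>\<gamma>.
     continuous_path h v (closed_segment 0 T) \<gamma> \<and> \<gamma> 0 = p \<and> \<gamma> T = q \<and>
     (\<forall>t\<in>closed_segment 0 T. covering (\<gamma> t) = (\<lambda>x. x + t *\<^sub>R flow_dir \<alpha>) ` covering p) \<and>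
     (\<forall>t\<in>open_segment 0 T. \<gamma> t \<notin> conical h v))"

text \<open>The value is meaningful when there is exactly one trajectory from \<open>p\<close> over the time
  interval, in particular for all times when \<open>p\<close> is outside of the singular leaves.\<close>

definition flow ::
    "('q \<Rightarrow> 'q) \<Rightarrow> ('q \<Rightarrow> 'q) \<Rightarrow> real \<Rightarrow> real \<Rightarrow> ('q \<times> real \<times> real) set \<Rightarrow> ('q \<times> real \<times> real) set" where
  "flow h v \<alpha> t p = (THE q. trajectory h v \<alpha> t p q)"

text \<open>The union of the trajectories starting (\<open>T \<ge> 0\<close>) or ending (\<open>T \<le> 0\<close>) at a conical point,
  which itself is included.\<close>

definition singular_leaves :: "('q \<Rightarrow> 'q) \<Rightarrow> ('q \<Rightarrow> 'q) \<Rightarrow> real \<Rightarrow> ('q \<times> real \<times> real) set set" where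
  "singular_leaves h v \<alpha> = {p. \<exists>c\<in>conical h v. \<exists>T. trajectory h v \<alpha> T c p}"

section \<open>Diophantine type and hitting time\<close>

definition diophantine_type :: "real \<Rightarrow> ereal" where
  "diophantine_type \<alpha> = Sup (ereal ` {w. w > 0 \<and>
     infinite {(p :: int, q :: int). q > 0 \<and> coprime p q \<and>
       \<bar>\<alpha> - of_int p / of_int q\<bar> < of_int q powr (- (w + 1))}})"

definition hitting_time ::
    "('q \<Rightarrow> 'q) \<Rightarrow> ('q \<Rightarrow> 'q) \<Rightarrow> real \<Rightarrow> ('q \<times> real \<times> real) set \<Rightarrow> real \<Rightarrow> ereal" where
  "hitting_time h v \<alpha> p r =
     (SUP q\<in>surface h v. Inf (ereal ` {t. t > r \<and> Dist h v (flow h v \<alpha> t p) q < r}))"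

definition ereal_log :: "ereal \<Rightarrow> ereal" where
  "ereal_log x = (if x = \<infinity> then \<infinity> else if x \<le> 0 then -\<infinity> else ereal (ln (real_of_ereal x)))"

definition hitting_exponent ::
    "('q \<Rightarrow> 'q) \<Rightarrow> ('q \<Rightarrow> 'q) \<Rightarrow> real \<Rightarrow> ('q \<times> real \<times> real) set \<Rightarrow> ereal" where
  "hitting_exponent h v \<alpha> p =
     Limsup (at_right 0) (\<lambda>r. ereal_log (hitting_time h v \<alpha> p r) / ereal (- ln r))"

section \<open>The Ornithorynque\<close>

text \<open>The numeral types \<open>2\<close> and \<open>3\<close> are the integers modulo 2 and 3.\<close>

type_synonym ornith_index = "3 \<times> 2 \<times> 2"

definition ornith_h :: "ornith_index \<Rightarrow> ornith_index" where
  "ornith_h = (\<lambda>(i, a, b).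
     if (a, b) = (0, 0) then (i + 1, 1, 0)
     else if (a, b) = (0, 1) then (i - 1, 1, 1)
     else if (a, b) = (1, 0) then (i, 0, 0)
     else (i, 0, 1))"

definition ornith_v :: "ornith_index \<Rightarrow> ornith_index" where
  "ornith_v = (\<lambda>(i, a, b).
     if (a, b) = (0, 0) then (i - 1, 0, 1)
     else if (a, b) = (0, 1) then (i, 0, 0)
     else if (a, b) = (1, 0) then (i + 1, 1, 1)
     else (i, 1, 0))"

lemma ornith_h_simps:
  "ornith_h (i, 0, 0) = (i + 1, 1, 0)"
  "ornith_h (i, 0, 1) = (i - 1, 1, 1)"
  "ornith_h (i, 1, 0) = (i, 0, 0)"
  "ornith_h (i, 1, 1) = (i, 0, 1)"
  by (simp_all add: ornith_h_def)

lemma ornith_v_simps: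
  "ornith_v (i, 0, 0) = (i - 1, 0, 1)"
  "ornith_v (i, 0, 1) = (i, 0, 0)"
  "ornith_v (i, 1, 0) = (i + 1, 1, 1)"
  "ornith_v (i, 1, 1) = (i, 1, 0)"
  by (simp_all add: ornith_v_def)

lemma two_cases: "(a::2) = 0 \<or> a = 1"
  using exhaust_2[of a] by auto

lemma ornith_index_cases:
  fixes x :: ornith_index
  obtains i where "x = (i, 0, 0)" | i where "x = (i, 0, 1)"
        | i where "x = (i, 1, 0)" | i where "x = (i, 1, 1)"
proof -
  obtain i a b where x: "x = (i, a, b)" by (rule prod_cases3)
  from two_cases[of a] two_cases[of b] show thesis
    by (elim disjE) (simp_all only: x that)
qed

lemma origami_ornith: "origami ornith_h ornith_v"
proof -
  have hs: "surj ornith_h"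
  proof (rule surjI)
    define g :: "ornith_index \<Rightarrow> ornith_index" where "g = (\<lambda>(i, a, b).
      if (a, b) = (1, 0) then (i - 1, 0, 0) else if (a, b) = (1, 1) then (i + 1, 0, 1)
      else if (a, b) = (0, 0) then (i, 1, 0) else (i, 1, 1))"
    show "ornith_h (g x) = x" for x
      by (rule ornith_index_cases[of x]) (simp_all add: g_def ornith_h_simps)
  qed
  have h: "bij ornith_h"
    by (rule bijI[OF finite_UNIV_surj_inj[OF finite hs] hs])
  have vs: "surj ornith_v"
  proof (rule surjI)
    define g :: "ornith_index \<Rightarrow> ornith_index" where "g = (\<lambda>(i, a, b).
      if (a, b) = (0, 1) then (i + 1, 0, 0) else if (a, b) = (0, 0) then (i, 0, 1)
      else if (a, b) = (1, 1) then (i - 1, 1, 0) else (i, 1, 1))"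
    show "ornith_v (g x) = x" for x
      by (rule ornith_index_cases[of x]) (simp_all add: g_def ornith_v_simps)
  qed
  have v: "bij ornith_v"
    by (rule bijI[OF finite_UNIV_surj_inj[OF finite vs] vs])
  let ?E = "equivclp (\<lambda>a b. b = ornith_h a \<or> b = ornith_v a)"
  have Eh: "?E x (ornith_h x)" and Ev: "?E x (ornith_v x)" for x
    by (rule r_into_equivclp, rule disjI1, rule refl)
      (rule r_into_equivclp, rule disjI2, rule refl)
  have A: "?E (i, 1, 0) (i, 0, 0)" for i
    using Eh[of "(i, 1, 0)"] unfolding ornith_h_simps .
  have B: "?E (i, 0, 1) (i, 0, 0)" for i
    using Ev[of "(i, 0, 1)"] unfolding ornith_v_simps .
  have C: "?E (i, 1, 1) (i, 0, 0)" for i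
    using Eh[of "(i, 1, 1)"] B[of i] unfolding ornith_h_simps by (rule equivclp_trans)
  have S: "?E (i, 0, 0) (i + 1, 0, 0)" for i
    using Eh[of "(i, 0, 0)"] A[of "i + 1"] unfolding ornith_h_simps by (rule equivclp_trans)
  have Z: "?E (i, 0, 0) (0, 0, 0)" for i
  proof -
    have plus: "(2::3) + 1 = 0" "(1::3) + 1 = 2" and three: "(3::3) = 0" by simp_all
    have 2: "?E (2, 0, 0) (0, 0, 0)" using S[of 2] unfolding plus .
    have "?E (1, 0, 0) (2, 0, 0)" using S[of 1] unfolding plus .
    then have 1: "?E (1, 0, 0) (0, 0, 0)" using 2 by (rule equivclp_trans)
    have "i = 1 \<or> i = 2 \<or> i = 0" using exhaust_3[of i] unfolding three .
    then show ?thesis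
      using 1 2 by (elim disjE) (simp_all only: equivclp_refl)
  qed
  have D: "?E x (0, 0, 0)" for x
    by (rule ornith_index_cases[of x])
      (simp_all only: Z equivclp_trans[OF A Z] equivclp_trans[OF B Z] equivclp_trans[OF C Z])
  have "?E x y" for x y
    using D[of x] equivclp_sym[OF D[of y]] by (rule equivclp_trans)
  with h v show ?thesis
    unfolding origami_def by (intro conjI allI)
qed

end

theory Submission
  imports Defs
begin

text \<open>The lower bound holds for every origami: when \<open>q \<alpha> - p\<close> is small, \<open>q x - p y\<close> modulo \<open>1\<close> is almost
  invariant under the flow. For the upper bound, the first return map to the horizontal sides is a
  skew product over the rotation by \<open>\<alpha>\<close>, which Rauzy induction renormalises to pairs of
  permutations \<open>(s1, s2)\<close> of the squares. All these pairs are renamings of \<open>(h, v)\<close>, since the Veech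
  group of the Ornithorynque is \<open>SL(2, \<int>)\<close>; hence the cycles of \<open>s2\<close> are always two cylinders, which
  \<open>s1\<close> exchanges. During a turn of the continued fraction with large partial quotient the orbit
  therefore sweeps both cylinders, that is the whole surface, one after the other. During a bounded
  number of turns with small partial quotients it reaches all squares because the permutations act
  transitively.\<close>

section \<open>The geometry of the surface and the flow\<close>

text \<open>For every \<open>w\<close> above the type, each r-ball has to be reached within
  O(r^(-w)) steps. A stage has widths a = |q1 \<alpha> - p1| and b = |q2 \<alpha> - p2|, and the
  area identity gives q2 \<le> 1/a. If a is at least a constant multiple of r, then q2 is O(1/r), so
  b is at least a constant times r^w, and 4/b steps are affordable. One crossing of the wide side
  takes about a q2 / b \<le> 1/b steps, so only boundedly many crossings may be spent. A cylinder
  missed by them would have to wait for later turns, which can be far longer. Two cylinders that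
  alternate at each crossing cause no such wait; transitivity alone settles only stretches of turns
  of bounded length. A second obstacle is that base point and fibre advance together: within a
  crossing, a given fibre of a 6-cycle recurs only at every sixth step of length b. Targets are
  therefore approached only up to a multiple of b, which is why a turn counts as long when 8 b \<le>
  a.\<close>

definition ipow :: "('q \<Rightarrow> 'q) \<Rightarrow> int \<Rightarrow> 'q \<Rightarrow> 'q" where
  "ipow f n = (if 0 \<le> n then f ^^ nat n else inv f ^^ nat (- n))"

lemma ipow_0 [simp]: "ipow f 0 j = j"
  by (simp add: ipow_def)

lemma ipow_succ:
  assumes "bij f"
  shows "ipow f (n + 1) j = f (ipow f n j)"
proof (cases "0 \<le> n")
  case True
  then show ?thesis by (simp add: ipow_def nat_add_distrib)
next
  case False
  then obtain m where m: "n = - int (Suc m)"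
    by (metis int_cases not_le of_nat_0_le_iff)
  have "f (inv f x) = x" for x
    using assms by (simp add: bij_is_surj surj_f_inv_f)
  moreover have "nat (- (n + 1)) = m" "nat (- n) = Suc m" by (simp_all add: m)
  moreover have "n + 1 = 0 \<longleftrightarrow> m = 0" by (simp add: m)
  ultimately show ?thesis using False by (cases "n + 1 = 0") (simp_all add: ipow_def)
qed

lemma ipow_pred:
  assumes "bij f"
  shows "ipow f (n - 1) j = inv f (ipow f n j)"
  using ipow_succ[OF assms, of "n - 1" j] assms by (simp add: bij_is_inj)

lemma ipow_add:
  assumes "bij f"
  shows "ipow f (m + n) j = ipow f m (ipow f n j)"
proof (induction m rule: int_induct[where k = 0])
  case base
  show ?case by simp
next
  case (step1 i)
  then show ?case
    using ipow_succ[OF assms, of "i + n" j] ipow_succ[OF assms, of i] by (simp add: ac_simps)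
next
  case (step2 i)
  then show ?case
    using ipow_pred[OF assms, of "i + n" j] ipow_pred[OF assms, of i] by (simp add: algebra_simps)
qed

lemma ipow_1 [simp]: "ipow f 1 j = f j"
  by (simp add: ipow_def)

lemma ipow_minus [simp]:
  assumes "bij f"
  shows "ipow f (- n) (ipow f n j) = j" "ipow f n (ipow f (- n) j) = j"
  using ipow_add[OF assms, of "- n" n j] ipow_add[OF assms, of n "- n" j] by simp_all

lemma bij_ipow:
  assumes "bij f"
  shows "bij (ipow f n)"
  by (rule o_bij[of "ipow f (- n)"]) (simp_all add: fun_eq_iff assms)

section \<open>Points, covering map and distance of a square-tiled surface\<close>

locale square_tiled =
  fixes h v :: "'q::finite \<Rightarrow> 'q"
  assumes orig: "origami h v"
begin

lemma bij_h: "bij h" and bij_v: "bij v"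
  using orig by (auto simp: origami_def)

abbreviation "pt \<equiv> surface_pt h v"

lemma pt_in_surface: "x \<in> {0..1} \<times> {0..1} \<Longrightarrow> pt j x \<in> surface h v"
  unfolding surface_pt_def surface_def by (rule quotientI) (auto simp: squares_def)

lemma surfaceE:
  assumes "q \<in> surface h v"
  obtains j x where "x \<in> {0..1} \<times> {0..1}" "q = pt j x"
proof -
  obtain a where "a \<in> squares" "q = glue_rel h v `` {a}"
    using assms unfolding surface_def by (rule quotientE)
  then show thesis
    using that[of "snd a" "fst a"] by (auto simp: squares_def surface_pt_def)
qed

lemma pt_right_left:
  assumes "y \<in> {0..1}"
  shows "pt j (1, y) = pt (h j) (0, y)"
  unfolding surface_pt_def
proof (rule equiv_class_eq[OF equiv_glue_rel])
  show "((j, 1, y), (h j, 0, y)) \<in> glue_rel h v"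
    using assms by (auto simp: glue_rel_def squares_def intro!: r_into_equivclp glue.right_left)
qed

lemma pt_top_bottom:
  assumes "x \<in> {0..1}"
  shows "pt j (x, 1) = pt (v j) (x, 0)"
  unfolding surface_pt_def
proof (rule equiv_class_eq[OF equiv_glue_rel])
  show "((j, x, 1), (v j, x, 0)) \<in> glue_rel h v"
    using assms by (auto simp: glue_rel_def squares_def intro!: r_into_equivclp glue.top_bottom)
qed

lemma glue_coords:
  assumes "equivclp (glue h v) a b"
  shows "fst (snd b) - fst (snd a) \<in> \<int> \<and> snd (snd b) - snd (snd a) \<in> \<int>"
  using assms
proof (induction rule: equivclp_induct)
  case base
  show ?case by simp
next
  case (step y z)
  have "fst (snd z) - fst (snd y) \<in> \<int> \<and> snd (snd z) - snd (snd y) \<in> \<int>"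
    using step(2) by (auto elim!: glue.cases)
  then have "(fst (snd z) - fst (snd y)) + (fst (snd y) - fst (snd a)) \<in> \<int>
      \<and> (snd (snd z) - snd (snd y)) + (snd (snd y) - snd (snd a)) \<in> \<int>"
    using step(3) by (intro conjI Ints_add) auto
  then show ?case by simp
qed

lemma torus_pt_eqI:
  assumes "fst y - fst x \<in> \<int>" "snd y - snd x \<in> \<int>"
  shows "torus_pt y = torus_pt x"
proof -
  have "a - fst y \<in> \<int> \<longleftrightarrow> a - fst x \<in> \<int>" "a - snd y \<in> \<int> \<longleftrightarrow> a - snd x \<in> \<int>" for a
    using Ints_add[OF _ assms(1), of "a - fst y"] Ints_diff[OF _ assms(1), of "a - fst x"]
      Ints_add[OF _ assms(2), of "a - snd y"] Ints_diff[OF _ assms(2), of "a - snd x"]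
    by auto
  then show ?thesis by (simp add: torus_pt_def)
qed

lemma covering_pt:
  assumes "x \<in> {0..1} \<times> {0..1}"
  shows "covering (pt j x) = torus_pt x"
proof -
  have "(j, x) \<in> pt j x"
    using assms by (auto simp: surface_pt_def glue_rel_def squares_def)
  moreover have "torus_pt z = torus_pt x" if "(k, z) \<in> pt j x" for k z
    using that glue_coords[of "(j, x)" "(k, z)"]
    by (intro torus_pt_eqI) (auto simp: surface_pt_def glue_rel_def)
  ultimately show ?thesis by (force simp: covering_def)
qed

lemma torus_pt_eqD:
  assumes "torus_pt x = torus_pt y"
  shows "fst x - fst y \<in> \<int>" "snd x - snd y \<in> \<int>"
proof -
  have "x \<in> torus_pt x" by (simp add: torus_pt_def)
  with assms show "fst x - fst y \<in> \<int>" "snd x - snd y \<in> \<int>" by (auto simp: torus_pt_def)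
qed

lemma torus_pt_translate: "(\<lambda>x. x + c) ` torus_pt y = torus_pt (y + c)"
proof -
  have "x \<in> (\<lambda>x. x + c) ` torus_pt y" if "x \<in> torus_pt (y + c)" for x
    using that by (intro image_eqI[of _ _ "x - c"]) (auto simp: torus_pt_def algebra_simps)
  then show ?thesis by (auto simp: torus_pt_def algebra_simps)
qed

lemma broken_path_trans:
  assumes "broken_path h v p q l" "broken_path h v q r m"
  shows "broken_path h v p r (l + m)"
  using assms(2,1)
proof (induction rule: broken_path.induct)
  case start
  then show ?case by simp
next
  case (segment j x m y)
  then show ?case using broken_path.segment[of h v p j x "l + m" y] by (simp add: add.assoc)
qed

lemma broken_path_single:
  assumes "x \<in> {0..1} \<times> {0..1}" "y \<in> {0..1} \<times> {0..1}"
  shows "broken_path h v (pt j x) (pt j y) (dist x y)"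
  using broken_path.segment[OF broken_path.start[OF pt_in_surface[OF assms(1)]] assms] by simp

lemma broken_path_sym:
  assumes "broken_path h v p q l"
  shows "broken_path h v q p l"
  using assms
proof (induction rule: broken_path.induct)
  case start
  then show ?case by (rule broken_path.start)
next
  case (segment j x l y)
  then show ?case
    using broken_path_trans[OF broken_path_single[of y x j] segment(4)]
    by (simp add: dist_commute add.commute)
qed

lemma broken_path_nonneg: "broken_path h v p q l \<Longrightarrow> 0 \<le> l"
  by (induction rule: broken_path.induct) auto

text \<open>\<open>Dist\<close> is an infimum over real lengths, so it means something only if some
  path exists. Bottom and left sides join the lower left corners of neighbouring squares, and the
  origami is connected.\<close>

lemma broken_path_exists:
  assumes "p \<in> surface h v" "q \<in> surface h v"
  shows "\<exists>l. broken_path h v p q l"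
proof -
  obtain i x j y where x: "x \<in> {0..1} \<times> {0..1}" "p = pt i x"
    and y: "y \<in> {0..1} \<times> {0..1}" "q = pt j y"
    using assms by (metis surfaceE)
  let ?c = "(0, 0) :: real \<times> real"
  have c: "?c \<in> {0..1} \<times> {0..1}" "(1, 0) \<in> {0..1::real} \<times> {0..1::real}"
    "(0, 1) \<in> {0..1::real} \<times> {0..1::real}"
    by auto
  have eq: "equivclp (\<lambda>a b. b = h a \<or> b = v a) i j"
    using orig by (simp add: origami_def)
  have nb: "\<exists>l. broken_path h v (pt a ?c) (pt b ?c) l" if "b = h a \<or> b = v a" for a b
    using that broken_path_single[OF c(1) c(2), of a] broken_path_single[OF c(1) c(3), of a]
    by (auto simp: pt_right_left pt_top_bottom)
  have "\<exists>l. broken_path h v (pt i ?c) (pt j ?c) l"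
    using eq
  proof (induction rule: equivclp_induct)
    case base
    show ?case using broken_path.start[OF pt_in_surface[OF c(1)]] by blast
  next
    case (step k l)
    then obtain m where "broken_path h v (pt i ?c) (pt k ?c) m" by blast
    moreover obtain m' where "broken_path h v (pt k ?c) (pt l ?c) m'"
      using step(2) nb[of k l] nb[of l k] broken_path_sym by blast
    ultimately show ?case using broken_path_trans by blast
  qed
  then obtain l where "broken_path h v (pt i ?c) (pt j ?c) l" by blast
  from broken_path_trans[OF broken_path_trans[OF broken_path_single[OF x(1) c(1)] this]
      broken_path_single[OF c(1) y(1)]]
  show ?thesis using x y by blast
qed

lemma Dist_le: "broken_path h v p q l \<Longrightarrow> Dist h v p q \<le> l"
  unfolding Dist_def
  by (rule cInf_lower) (auto intro!: bdd_belowI[of _ 0] dest: broken_path_nonneg)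

lemma Dist_lessD:
  assumes "p \<in> surface h v" "q \<in> surface h v" "Dist h v p q < r"
  obtains l where "broken_path h v p q l" "l < r"
  using cInf_lessD[of "{l. broken_path h v p q l}" r] broken_path_exists[OF assms(1,2)] assms(3)
  unfolding Dist_def by auto

lemma Dist_sym: "Dist h v p q = Dist h v q p"
proof -
  have "{l. broken_path h v p q l} = {l. broken_path h v q p l}"
    using broken_path_sym by blast
  then show ?thesis by (simp add: Dist_def)
qed

lemma Dist_self: "p \<in> surface h v \<Longrightarrow> Dist h v p p \<le> 0"
  by (intro Dist_le broken_path.start)

lemma Dist_triangle_less:
  assumes "p \<in> surface h v" "q \<in> surface h v" "r \<in> surface h v"
    and "Dist h v p q < a" "Dist h v q r < b"
  shows "Dist h v p r < a + b"
proof -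
  obtain l m where "broken_path h v p q l" "l < a" "broken_path h v q r m" "m < b"
    using assms by (metis Dist_lessD)
  then show ?thesis using Dist_le[OF broken_path_trans, of p q l r m] by linarith
qed

text \<open>The covering does not increase distances: each segment is translated by an integer
  vector so that it continues the part already unrolled in the plane.\<close>

lemma broken_path_torus:
  assumes "broken_path h v p q l"
  shows "\<exists>x y. covering p = torus_pt x \<and> covering q = torus_pt y \<and> dist x y \<le> l"
  using assms
proof (induction rule: broken_path.induct)
  case start
  then obtain j x where "x \<in> {0..1} \<times> {0..1}" "p = pt j x" by (rule surfaceE)
  then have "covering p = torus_pt x" by (simp add: covering_pt)
  then show ?case by (intro exI[of _ x]) simp
next
  case (segment j x l y)
  then obtain a b where ab: "covering p = torus_pt a" "torus_pt x = torus_pt b" "dist a b \<le> l"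
    by (auto simp: covering_pt)
  let ?c = "y + (b - x)"
  have "torus_pt y = torus_pt ?c"
    using torus_pt_eqD[OF ab(2)] by (intro torus_pt_eqI) (auto simp: algebra_simps)
  moreover have "dist a ?c \<le> l + dist x y"
  proof -
    have "dist b ?c = dist x y" by (simp add: dist_norm norm_minus_commute algebra_simps)
    then show ?thesis using dist_triangle[of a ?c b] ab(3) by linarith
  qed
  ultimately show ?case using ab(1) covering_pt[OF segment.hyps(3), of j] by metis
qed

lemma nonconical_ball:
  assumes "p \<in> surface h v" "p \<notin> conical h v"
  obtains \<epsilon> where "\<epsilon> > 0" "inj_on covering {q \<in> surface h v. Dist h v p q < \<epsilon>}"
  using assms by (auto simp: conical_def)

text \<open>Nonconical points form an open set: a ball of half the size around a nearby point still
  lies in the ball where the covering is injective.\<close>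

lemma nonconical_near:
  assumes "p \<in> surface h v" "p \<notin> conical h v"
  obtains \<epsilon> where "\<epsilon> > 0" "\<And>q. q \<in> surface h v \<Longrightarrow> Dist h v p q < \<epsilon> \<Longrightarrow> q \<notin> conical h v"
proof -
  obtain e where e: "e > 0" "inj_on covering {q \<in> surface h v. Dist h v p q < e}"
    using nonconical_ball[OF assms] .
  show thesis
  proof (rule that[of "e / 2"])
    fix q assume q: "q \<in> surface h v" "Dist h v p q < e / 2"
    have "{z \<in> surface h v. Dist h v q z < e / 2} \<subseteq> {z \<in> surface h v. Dist h v p z < e}"
      using Dist_triangle_less[OF assms(1) q(1) _ q(2), of _ "e / 2"] by auto
    then have "inj_on covering {z \<in> surface h v. Dist h v q z < e / 2}"
      using e(2) inj_on_subset by blast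
    then show "q \<notin> conical h v"
      using e(1) by (auto simp: conical_def intro!: exI[of _ "e / 2"])
  qed (use e in simp)
qed

text \<open>Lifts to the surface are unique: that the covering is injective near nonconical points is all
  that is needed about its local structure.\<close>

lemma continuous_path_unique:
  assumes T: "0 \<le> T"
    and g: "continuous_path h v {0..T} g" and g': "continuous_path h v {0..T} g'"
    and g0: "g 0 = g' 0" and cov: "\<And>t. t \<in> {0..T} \<Longrightarrow> covering (g t) = covering (g' t)"
    and nc: "\<And>t. t \<in> {0..T} \<Longrightarrow> g t \<notin> conical h v"
  shows "g T = g' T"
proof (rule ccontr)
  assume neq: "g T \<noteq> g' T"
  let ?A = "{t \<in> {0..T}. \<forall>s\<in>{0..t}. g s = g' s}"
  have surf: "g t \<in> surface h v" "g' t \<in> surface h v" if "t \<in> {0..T}" for t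
    using g g' that by (auto simp: continuous_path_def)
  define c where "c = Sup ?A"
  have A0: "0 \<in> ?A" using T g0 by simp
  have bdd: "bdd_above ?A" by (rule bdd_aboveI[of _ T]) simp
  have c: "c \<in> {0..T}"
    unfolding c_def using A0 bdd by (auto intro!: cSup_upper cSup_least)
  have below: "g s = g' s" if "s \<in> {0..<c}" for s
  proof -
    have "s < Sup ?A" using that by (simp add: c_def)
    from less_cSupD[OF _ this] A0 obtain t where "t \<in> ?A" "s < t" by blast
    then show ?thesis using that by auto
  qed
  obtain e where e: "e > 0" "inj_on covering {q \<in> surface h v. Dist h v (g c) q < e}"
    using nonconical_ball[OF surf(1)[OF c] nc[OF c]] .
  obtain d where d: "d > 0" "\<And>s. s \<in> {0..T} \<Longrightarrow> \<bar>s - c\<bar> < d \<Longrightarrow> Dist h v (g c) (g s) < e / 2"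
    using g c e(1) unfolding continuous_path_def by (meson half_gt_zero)
  obtain d' where d': "d' > 0" "\<And>s. s \<in> {0..T} \<Longrightarrow> \<bar>s - c\<bar> < d' \<Longrightarrow> Dist h v (g' c) (g' s) < e / 2"
    using g' c e(1) unfolding continuous_path_def by (meson half_gt_zero)
  have gc: "g c = g' c"
  proof (cases "c = 0")
    case True
    then show ?thesis using g0 by simp
  next
    case False
    \<comment> \<open>A time just before \<open>c\<close>, where the paths still agree; the common
      value is within \<open>e / 2\<close> of both \<open>g c\<close> and \<open>g' c\<close>, which
      have the same image under the covering.\<close>
    define s where "s = max (c / 2) (c - min d d' / 2)"
    have s: "s \<in> {0..<c}" "\<bar>s - c\<bar> < d" "\<bar>s - c\<bar> < d'"
      using False c d(1) d'(1) by (auto simp: s_def max_def min_def)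
    have sT: "s \<in> {0..T}" using s(1) c by auto
    have "Dist h v (g c) (g' c) < e / 2 + e / 2"
      using Dist_triangle_less[OF surf(1)[OF c] surf(1)[OF sT] surf(2)[OF c] d(2)[OF sT s(2)], of "e / 2"]
        d'(2)[OF sT s(3)] below[OF s(1)] Dist_sym by simp
    moreover have "Dist h v (g c) (g c) < e" using Dist_self[OF surf(1)[OF c]] e(1) by simp
    ultimately show ?thesis
      using inj_onD[OF e(2) cov[OF c]] surf c by simp
  qed
  define u where "u = min T (c + min d d' / 2)"
  have u: "u \<in> {0..T}" "c \<le> u" using c d(1) d'(1) by (auto simp: u_def)
  have near: "g s = g' s" if "s \<in> {c..u}" for s
  proof -
    have s: "s \<in> {0..T}" "\<bar>s - c\<bar> < d" "\<bar>s - c\<bar> < d'"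
      using that u c d(1) d'(1) by (auto simp: u_def min_def split: if_splits)
    have "Dist h v (g c) (g s) < e" using d(2)[OF s(1,2)] e(1) by linarith
    moreover have "Dist h v (g c) (g' s) < e" using d'(2)[OF s(1,3)] e(1) gc by simp
    ultimately show ?thesis using inj_onD[OF e(2) cov[OF s(1)]] surf[OF s(1)] by simp
  qed
  have "u \<in> ?A"
  proof -
    have "g s = g' s" if "s \<in> {0..u}" for s
      using below[of s] near[of s] that by (cases "s < c") auto
    then show ?thesis using u by simp
  qed
  then have "u \<le> c" unfolding c_def by (rule cSup_upper[OF _ bdd])
  then have "u = T" using u d(1) d'(1) by (auto simp: u_def min_def split: if_splits)
  moreover have "\<forall>s\<in>{0..u}. g s = g' s" using \<open>u \<in> ?A\<close> by blast
  ultimately show False using neq T by simp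
qed

text \<open>The horizontal strip of squares \<open>\<dots>, j, h j, h (h j), \<dots>\<close>, unrolled with \<open>j\<close> over \<open>[0, 1]\<close>.\<close>

definition strip :: "'q \<Rightarrow> real \<Rightarrow> real \<Rightarrow> ('q \<times> real \<times> real) set" where
  "strip j X y = pt (ipow h \<lfloor>X\<rfloor> j) (frac X, y)"

text \<open>At an integer abscissa the floor selects the square on the right; by the gluing, the
  description in the left square is valid as well, so closed squares can be used.\<close>

lemma strip_eq:
  assumes "X - of_int n \<in> {0..1}" "y \<in> {0..1}"
  shows "strip j X y = pt (ipow h n j) (X - of_int n, y)"
proof (cases "X - of_int n = 1")
  case True
  then have "X = of_int (n + 1)" by simp
  then have "strip j X y = pt (ipow h (n + 1) j) (0, y)" by (simp add: strip_def del: of_int_add)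
  then show ?thesis using True assms by (simp add: pt_right_left ipow_succ[OF bij_h])
next
  case False
  then have "\<lfloor>X\<rfloor> = n" using assms by (intro floor_unique) auto
  then show ?thesis by (simp add: strip_def frac_def)
qed

lemma strip_shift: "strip (ipow h n j) X y = strip j (X + of_int n) y"
  by (simp add: strip_def ipow_add[OF bij_h, symmetric] frac_def)

lemma frac_mem: "frac (X::real) \<in> {0..1}"
  using frac_lt_1[of X] by (simp add: less_imp_le)

lemma strip_in_surface: "y \<in> {0..1} \<Longrightarrow> strip j X y \<in> surface h v"
  unfolding strip_def using frac_mem by (intro pt_in_surface) auto

lemma covering_strip:
  assumes "y \<in> {0..1}"
  shows "covering (strip j X y) = torus_pt (X, y)"
proof -
  have "covering (strip j X y) = torus_pt (frac X, y)"
    unfolding strip_def using frac_mem assms by (intro covering_pt) auto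
  also have "\<dots> = torus_pt (X, y)" by (rule torus_pt_eqI) (auto simp: frac_def)
  finally show ?thesis .
qed

lemma strip_top: "strip j X 1 = strip (v (ipow h \<lfloor>X\<rfloor> j)) (frac X) 0"
  unfolding strip_def using frac_mem[of X] frac_lt_1[of X]
  by (simp add: pt_top_bottom floor_eq_iff frac_def)

lemma Dist_square:
  assumes "X - of_int n \<in> {0..1}" "X' - of_int n \<in> {0..1}" "y \<in> {0..1}" "y' \<in> {0..1}"
  shows "Dist h v (strip j X y) (strip j X' y') \<le> \<bar>X - X'\<bar> + \<bar>y - y'\<bar>"
proof -
  have "Dist h v (strip j X y) (strip j X' y') \<le> dist (X - of_int n, y) (X' - of_int n, y')"
    using assms unfolding strip_eq[OF assms(1,3)] strip_eq[OF assms(2,4)]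
    by (intro Dist_le broken_path_single) auto
  also have "\<dots> \<le> \<bar>X - X'\<bar> + \<bar>y - y'\<bar>"
    using sqrt_sum_squares_le_sum_abs[of "X - X'" "y - y'"] by (simp add: dist_Pair_Pair dist_real_def)
  finally show ?thesis .
qed

lemma Dist_triangle:
  assumes "p \<in> surface h v" "q \<in> surface h v" "r \<in> surface h v"
  shows "Dist h v p r \<le> Dist h v p q + Dist h v q r"
proof (rule field_le_epsilon)
  fix e :: real assume "e > 0"
  then show "Dist h v p r \<le> Dist h v p q + Dist h v q r + e"
    using Dist_triangle_less[OF assms, of "Dist h v p q + e / 2" "Dist h v q r + e / 2"] by simp
qed

text \<open>At most one vertical side lies strictly between the two abscissas, so breaking the path
  there once is enough.\<close>

lemma Dist_strip:
  assumes "\<bar>X - X'\<bar> \<le> 1" "y \<in> {0..1}" "y' \<in> {0..1}"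
  shows "Dist h v (strip j X y) (strip j X' y') \<le> \<bar>X - X'\<bar> + \<bar>y - y'\<bar>"
proof -
  have *: "Dist h v (strip j X y) (strip j X' y') \<le> \<bar>X - X'\<bar> + \<bar>y - y'\<bar>"
    if le: "X \<le> X'" "X' \<le> X + 1" and y: "y \<in> {0..1}" "y' \<in> {0..1}" for X X' y y'
  proof (cases "X' \<le> of_int \<lfloor>X\<rfloor> + 1")
    case True
    then show ?thesis using le y by (intro Dist_square[of _ "\<lfloor>X\<rfloor>"]) (auto; linarith)+
  next
    case False
    let ?n = "of_int (\<lfloor>X\<rfloor> + 1) :: real"
    have "Dist h v (strip j X y) (strip j ?n y) \<le> \<bar>X - ?n\<bar> + \<bar>y - y\<bar>"
      using le y by (intro Dist_square[of _ "\<lfloor>X\<rfloor>"]) (auto; linarith)+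
    moreover have "Dist h v (strip j ?n y) (strip j X' y') \<le> \<bar>?n - X'\<bar> + \<bar>y - y'\<bar>"
      using le y False by (intro Dist_square[of _ "\<lfloor>X\<rfloor> + 1"]) (auto; linarith)+
    moreover have "X \<le> ?n" "?n \<le> X'" using False by (auto; linarith)+
    ultimately show ?thesis
      using Dist_triangle[OF strip_in_surface[OF y(1), of j X] strip_in_surface[OF y(1), of j ?n]
          strip_in_surface[OF y(2), of j X']] le by linarith
  qed
  show ?thesis
    using *[of X X' y y'] *[of X' X y' y] assms Dist_sym[of "strip j X y" "strip j X' y'"]
    by (cases "X \<le> X'") (auto simp: abs_minus_commute)
qed

text \<open>A strip is named by its square over [0, 1). The line leaves it in the square at the
  floor of its abscissa, where \<open>v\<close> applies; the powers of \<open>h\<close> carry the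
  name there and back, so abscissas are never reduced modulo 1.\<close>

primrec strip_index :: "real \<Rightarrow> real \<Rightarrow> 'q \<Rightarrow> nat \<Rightarrow> 'q" where
  "strip_index \<alpha> \<xi> j 0 = j"
| "strip_index \<alpha> \<xi> j (Suc n) = ipow h (- \<lfloor>\<xi> + \<alpha> * (n + 1)\<rfloor>)
     (v (ipow h \<lfloor>\<xi> + \<alpha> * (n + 1)\<rfloor> (strip_index \<alpha> \<xi> j n)))"

text \<open>The flow line through \<open>(\<xi>, 0)\<close>, parametrised by height: at height \<open>Z\<close> it is in the strip
  whose square with abscissa \<open>0\<close> is \<open>strip_index \<alpha> \<xi> j \<lfloor>Z\<rfloor>\<close>.\<close>

definition flow_line :: "real \<Rightarrow> real \<Rightarrow> 'q \<Rightarrow> real \<Rightarrow> ('q \<times> real \<times> real) set" where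
  "flow_line \<alpha> \<xi> j Z = strip (strip_index \<alpha> \<xi> j (nat \<lfloor>Z\<rfloor>)) (\<xi> + \<alpha> * Z) (frac Z)"

text \<open>The recursion for \<open>strip_index\<close> is what makes the formula of one strip
  valid up to and including its top side.\<close>

lemma flow_line_eq:
  assumes "Z \<in> {real n..real n + 1}"
  shows "flow_line \<alpha> \<xi> j Z = strip (strip_index \<alpha> \<xi> j n) (\<xi> + \<alpha> * Z) (Z - n)"
proof (cases "Z = real n + 1")
  case True
  have fl: "\<lfloor>Z\<rfloor> = int n + 1" using True by simp
  have "nat \<lfloor>Z\<rfloor> = Suc n" unfolding fl by simp
  then have "flow_line \<alpha> \<xi> j Z = strip (strip_index \<alpha> \<xi> j (Suc n)) (\<xi> + \<alpha> * Z) 0"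
    using True by (simp add: flow_line_def frac_def del: strip_index.simps)
  also have "\<dots> = strip (strip_index \<alpha> \<xi> j n) (\<xi> + \<alpha> * Z) 1"
    using True strip_shift[of "- \<lfloor>\<xi> + \<alpha> * (n + 1)\<rfloor>"]
    by (simp add: strip_top frac_def algebra_simps)
  finally show ?thesis using True by simp
next
  case False
  then have "\<lfloor>Z\<rfloor> = int n" using assms by (intro floor_unique) auto
  then show ?thesis by (simp add: flow_line_def frac_def)
qed

lemma flow_line_nat:
  assumes "0 \<le> Z"
  shows "Z \<in> {real (nat \<lfloor>Z\<rfloor>)..real (nat \<lfloor>Z\<rfloor>) + 1}"
  using assms by (auto simp: of_nat_nat; linarith)

lemma flow_line_in_surface: "0 \<le> Z \<Longrightarrow> flow_line \<alpha> \<xi> j Z \<in> surface h v"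
  unfolding flow_line_def using frac_mem by (intro strip_in_surface) auto

lemma covering_flow_line:
  assumes "0 \<le> Z"
  shows "covering (flow_line \<alpha> \<xi> j Z) = torus_pt (\<xi> + \<alpha> * Z, Z)"
proof -
  have "covering (flow_line \<alpha> \<xi> j Z) = torus_pt (\<xi> + \<alpha> * Z, frac Z)"
    unfolding flow_line_def using frac_mem by (intro covering_strip) auto
  also have "\<dots> = torus_pt (\<xi> + \<alpha> * Z, Z)" by (rule torus_pt_eqI) (auto simp: frac_def)
  finally show ?thesis .
qed

text \<open>The smallness hypothesis lets the height grow by at most 1, so one break at a horizontal
  side suffices, and it keeps each horizontal move within the range of
  \<open>Dist_strip\<close>.\<close>

lemma flow_line_Lipschitz:
  assumes "0 \<le> Z" "Z \<le> Z'" "(\<bar>\<alpha>\<bar> + 1) * (Z' - Z) \<le> 1"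
  shows "Dist h v (flow_line \<alpha> \<xi> j Z) (flow_line \<alpha> \<xi> j Z') \<le> (\<bar>\<alpha>\<bar> + 1) * (Z' - Z)"
proof -
  have small: "\<bar>\<alpha>\<bar> * (Z' - Z) + (Z' - Z) \<le> 1" using assms(3) by (simp add: algebra_simps)
  have nn: "0 \<le> \<bar>\<alpha>\<bar> * (Z' - Z)" using assms by simp
  have one: "Dist h v (flow_line \<alpha> \<xi> j U) (flow_line \<alpha> \<xi> j U') \<le> (\<bar>\<alpha>\<bar> + 1) * (U' - U)"
    if "U \<in> {real n..real n + 1}" "U' \<in> {real n..real n + 1}" "Z \<le> U" "U \<le> U'" "U' \<le> Z'" for U U' n
  proof -
    have "\<bar>\<alpha>\<bar> * (U' - U) \<le> \<bar>\<alpha>\<bar> * (Z' - Z)" using that by (intro mult_left_mono) auto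
    moreover have ax: "\<bar>(\<xi> + \<alpha> * U) - (\<xi> + \<alpha> * U')\<bar> = \<bar>\<alpha>\<bar> * (U' - U)"
    proof -
      have "(\<xi> + \<alpha> * U) - (\<xi> + \<alpha> * U') = - (\<alpha> * (U' - U))" by (simp add: algebra_simps)
      then show ?thesis using that by (simp add: abs_mult)
    qed
    ultimately have "\<bar>(\<xi> + \<alpha> * U) - (\<xi> + \<alpha> * U')\<bar> \<le> 1" using small assms by linarith
    from Dist_strip[OF this, of "U - n" "U' - n" "strip_index \<alpha> \<xi> j n"] that ax
    show ?thesis unfolding flow_line_eq[OF that(1)] flow_line_eq[OF that(2)]
      by (simp add: algebra_simps)
  qed
  define n where "n = nat \<lfloor>Z\<rfloor>"
  have n: "Z \<in> {real n..real n + 1}" unfolding n_def by (rule flow_line_nat[OF assms(1)])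
  show ?thesis
  proof (cases "Z' \<le> real n + 1")
    case True
    then show ?thesis using one[OF n, of Z'] n assms by simp
  next
    case False
    have "Z' \<le> Z + 1" using small nn by linarith
    have 1: "Dist h v (flow_line \<alpha> \<xi> j Z) (flow_line \<alpha> \<xi> j (real (Suc n))) \<le> (\<bar>\<alpha>\<bar> + 1) * (Suc n - Z)"
      using one[OF n, of "Suc n"] n False by simp
    have 2: "Dist h v (flow_line \<alpha> \<xi> j (real (Suc n))) (flow_line \<alpha> \<xi> j Z') \<le> (\<bar>\<alpha>\<bar> + 1) * (Z' - Suc n)"
      using one[of "Suc n" "Suc n" Z'] n False \<open>Z' \<le> Z + 1\<close> by simp
    have "(\<bar>\<alpha>\<bar> + 1) * (Suc n - Z) + (\<bar>\<alpha>\<bar> + 1) * (Z' - Suc n) = (\<bar>\<alpha>\<bar> + 1) * (Z' - Z)"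
      by (simp add: algebra_simps)
    moreover have "Dist h v (flow_line \<alpha> \<xi> j Z) (flow_line \<alpha> \<xi> j Z')
        \<le> Dist h v (flow_line \<alpha> \<xi> j Z) (flow_line \<alpha> \<xi> j (real (Suc n)))
          + Dist h v (flow_line \<alpha> \<xi> j (real (Suc n))) (flow_line \<alpha> \<xi> j Z')"
      using assms by (intro Dist_triangle flow_line_in_surface) auto
    ultimately show ?thesis using 1 2 by linarith
  qed
qed

lemma flow_line_continuous:
  assumes "0 \<le> Z" "e > 0"
  shows "\<exists>d>0. \<forall>Z'\<ge>0. \<bar>Z' - Z\<bar> < d \<longrightarrow> Dist h v (flow_line \<alpha> \<xi> j Z) (flow_line \<alpha> \<xi> j Z') < e"
proof (intro exI conjI allI impI)
  let ?L = "\<bar>\<alpha>\<bar> + 1"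
  let ?d = "min 1 e / ?L"
  show "?d > 0" using assms by simp
  fix Z' :: real assume Z': "0 \<le> Z'" "\<bar>Z' - Z\<bar> < ?d"
  have *: "?L * \<bar>Z' - Z\<bar> < min 1 e" using Z'(2) by (simp add: pos_less_divide_eq mult.commute)
  show "Dist h v (flow_line \<alpha> \<xi> j Z) (flow_line \<alpha> \<xi> j Z') < e"
  proof (cases "Z \<le> Z'")
    case True
    then show ?thesis using flow_line_Lipschitz[of Z Z' \<alpha> \<xi> j] * assms by simp
  next
    case False
    then show ?thesis using flow_line_Lipschitz[of Z' Z \<alpha> \<xi> j] * Z' by (simp add: Dist_sym)
  qed
qed

lemma flow_dir_eq: "flow_dir \<alpha> = (\<alpha> * cos (arctan \<alpha>), cos (arctan \<alpha>))"
proof -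
  have "tan (arctan \<alpha>) = \<alpha>" by (rule tan_arctan)
  then have "sin (arctan \<alpha>) = \<alpha> * cos (arctan \<alpha>)" using cos_arctan_not_zero[of \<alpha>] by (simp add: tan_def field_simps)
  then show ?thesis by (simp add: flow_dir_def)
qed

lemma cos_arctan_bounds: "0 < cos (arctan \<alpha>)" "cos (arctan \<alpha>) \<le> 1"
  using arctan_bounded[of \<alpha>] cos_gt_zero_pi by auto

section \<open>The flow line as a trajectory of the linear flow\<close>

context
  fixes \<alpha> \<xi> y0 :: real and j :: 'q
  assumes y0: "0 \<le> y0"
begin

abbreviation "line t \<equiv> flow_line \<alpha> \<xi> j (y0 + t * cos (arctan \<alpha>))"

lemma line_height: "0 \<le> t \<Longrightarrow> 0 \<le> y0 + t * cos (arctan \<alpha>)"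
  using y0 cos_arctan_bounds[of \<alpha>] by simp

lemma covering_line:
  assumes "0 \<le> y0 + s * cos (arctan \<alpha>)" "0 \<le> y0 + t * cos (arctan \<alpha>)"
  shows "covering (line t) = (\<lambda>x. x + (t - s) *\<^sub>R flow_dir \<alpha>) ` covering (line s)"
  by (simp only: torus_pt_translate covering_flow_line assms flow_dir_eq)
    (simp add: algebra_simps)

lemma line_continuous:
  assumes "0 \<le> t" "e > 0"
  shows "\<exists>d>0. \<forall>s\<ge>0. \<bar>s - t\<bar> < d \<longrightarrow> Dist h v (line t) (line s) < e"
proof -
  let ?c = "cos (arctan \<alpha>)"
  obtain d where d: "d > 0" "\<And>Z'. 0 \<le> Z' \<Longrightarrow> \<bar>Z' - (y0 + t * ?c)\<bar> < d \<Longrightarrow>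
      Dist h v (line t) (flow_line \<alpha> \<xi> j Z') < e"
    using flow_line_continuous[OF line_height[OF assms(1)] assms(2), of \<alpha> \<xi> j] by blast
  have "Dist h v (line t) (line s) < e" if "0 \<le> s" "\<bar>s - t\<bar> < d" for s
  proof (rule d(2)[OF line_height[OF that(1)]])
    have "\<bar>y0 + s * ?c - (y0 + t * ?c)\<bar> = \<bar>s - t\<bar> * ?c"
      using cos_arctan_bounds(1)[of \<alpha>] by (simp add: left_diff_distrib[symmetric] abs_mult)
    also have "\<dots> \<le> \<bar>s - t\<bar> * 1" using cos_arctan_bounds(2)[of \<alpha>] by (intro mult_left_mono) auto
    finally show "\<bar>y0 + s * ?c - (y0 + t * ?c)\<bar> < d" using that by simp
  qed
  then show ?thesis using d(1) by blast
qed

lemma line_in_surface: "0 \<le> t \<Longrightarrow> line t \<in> surface h v"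
  using flow_line_in_surface[OF line_height] .

text \<open>The first conical point on the line would be the start of a trajectory back to the origin.\<close>

lemma line_nonconical:
  assumes "line 0 \<notin> singular_leaves h v \<alpha>" "0 \<le> t"
  shows "line t \<notin> conical h v"
proof
  assume con: "line t \<in> conical h v"
  let ?A = "{s. 0 \<le> s \<and> line s \<in> conical h v}"
  define c where "c = Inf ?A"
  have tA: "t \<in> ?A" using con assms(2) by simp
  have bdd: "bdd_below ?A" by (rule bdd_belowI[of _ 0]) simp
  have c0: "0 \<le> c" unfolding c_def using tA by (intro cInf_greatest) auto
  have before: "line s \<notin> conical h v" if "0 \<le> s" "s < c" for s
  proof
    assume "line s \<in> conical h v"
    then have "c \<le> s" unfolding c_def using that(1) bdd by (intro cInf_lower) auto
    then show False using that(2) by simp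
  qed
  \<comment> \<open>The infimum is attained because the nonconical points form an open set.\<close>
  have cc: "line c \<in> conical h v"
  proof (rule ccontr)
    assume nc: "line c \<notin> conical h v"
    obtain e where e: "e > 0" "\<And>q. q \<in> surface h v \<Longrightarrow> Dist h v (line c) q < e \<Longrightarrow> q \<notin> conical h v"
      using nonconical_near[OF line_in_surface[OF c0] nc] by blast
    obtain d where d: "d > 0" "\<forall>s\<ge>0. \<bar>s - c\<bar> < d \<longrightarrow> Dist h v (line c) (line s) < e"
      using line_continuous[OF c0 e(1)] by blast
    have "Inf ?A < c + d" using d(1) by (simp add: c_def)
    from cInf_lessD[OF _ this] tA obtain s where s: "s \<in> ?A" "s < c + d" by blast
    have "c \<le> s" unfolding c_def using s(1) bdd by (intro cInf_lower)
    then show False using s d e(2)[OF line_in_surface, of s] by auto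
  qed
  have "trajectory h v \<alpha> (- c) (line c) (line 0)"
    unfolding trajectory_def
  proof (intro exI[of _ "\<lambda>u. line (c + u)"] conjI ballI)
    have seg: "closed_segment 0 (- c) = {- c..0}" "open_segment 0 (- c) = {- c<..<0}"
      using c0 by (auto simp: closed_segment_eq_real_ivl open_segment_eq_real_ivl)
    show "continuous_path h v (closed_segment 0 (- c)) (\<lambda>u. line (c + u))"
      unfolding continuous_path_def seg
    proof (intro conjI ballI allI impI image_subsetI)
      fix u assume "u \<in> {- c..0}"
      then show "line (c + u) \<in> surface h v" by (intro line_in_surface) simp
    next
      fix u and e :: real assume u: "u \<in> {- c..0}" and e: "e > 0"
      then obtain d where "d > 0" "\<forall>s\<ge>0. \<bar>s - (c + u)\<bar> < d \<longrightarrow> Dist h v (line (c + u)) (line s) < e"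
        using line_continuous[of "c + u" e] by auto
      then show "\<exists>d>0. \<forall>s\<in>{- c..0}. \<bar>s - u\<bar> < d \<longrightarrow> Dist h v (line (c + u)) (line (c + s)) < e"
        by (intro exI[of _ d]) auto
    qed
    show "line (c + 0) = line c" "line (c + - c) = line 0" by simp_all
    fix u
    show "covering (line (c + u)) = (\<lambda>x. x + u *\<^sub>R flow_dir \<alpha>) ` covering (line c)"
      if "u \<in> closed_segment 0 (- c)"
      using covering_line[OF line_height[of c] line_height[of "c + u"]] that c0 seg by auto
    show "line (c + u) \<notin> conical h v" if "u \<in> open_segment 0 (- c)"
      using before[of "c + u"] that seg by auto
  qed
  then show False using assms(1) cc by (auto simp: singular_leaves_def)
qed

text \<open>\<open>flow\<close> is a definite description, so uniqueness has to be shown too: every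
  trajectory lifts the same path on the torus, and the line meets no conical point, hence the lift
  is unique.\<close>

lemma flow_eq:
  assumes "line 0 \<notin> singular_leaves h v \<alpha>" "0 \<le> t"
  shows "flow h v \<alpha> t (line 0) = line t"
  unfolding flow_def
proof (rule the_equality)
  have seg: "closed_segment 0 t = {0..t}" "open_segment 0 t = {0<..<t}"
    using assms(2) by (auto simp: closed_segment_eq_real_ivl open_segment_eq_real_ivl)
  have cont: "continuous_path h v {0..t} line"
    unfolding continuous_path_def
  proof (intro conjI ballI allI impI image_subsetI)
    fix u assume "u \<in> {0..t}"
    then show "line u \<in> surface h v" by (intro line_in_surface) simp
  next
    fix u and e :: real assume "u \<in> {0..t}" "e > 0"
    then show "\<exists>d>0. \<forall>s\<in>{0..t}. \<bar>s - u\<bar> < d \<longrightarrow> Dist h v (line u) (line s) < e"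
      using line_continuous[of u e] by (meson atLeastAtMost_iff)
  qed
  have cov: "covering (line u) = (\<lambda>x. x + u *\<^sub>R flow_dir \<alpha>) ` covering (line 0)" if "u \<in> {0..t}" for u
    using covering_line[OF line_height[of 0] line_height[of u]] that by simp
  show "trajectory h v \<alpha> t (line 0) (line t)"
    unfolding trajectory_def seg
    using cont cov line_nonconical[OF assms(1)] by (intro exI[of _ "\<lambda>u. line u"] conjI ballI) auto
  fix q assume "trajectory h v \<alpha> t (line 0) q"
  then obtain g where g: "continuous_path h v {0..t} g" "g 0 = line 0" "g t = q"
    "\<And>u. u \<in> {0..t} \<Longrightarrow> covering (g u) = (\<lambda>x. x + u *\<^sub>R flow_dir \<alpha>) ` covering (line 0)"
    unfolding trajectory_def seg by blast
  have "line t = g t"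
  proof (rule continuous_path_unique[OF assms(2) cont g(1)])
    show "line 0 = g 0" using g(2) by simp
    show "covering (line u) = covering (g u)" if "u \<in> {0..t}" for u
      using cov[OF that] g(4)[OF that] by simp
    show "line u \<notin> conical h v" if "u \<in> {0..t}" for u
      using line_nonconical[OF assms(1)] that by simp
  qed
  then show "q = line t" using g(3) by simp
qed

end

section \<open>Rauzy induction for the first return map\<close>

text \<open>A point at height \<open>1\<close> of the strip of \<open>j\<close> is described by its abscissa in its own square.\<close>

definition normal :: "real \<Rightarrow> 'q \<Rightarrow> real \<times> 'q" where
  "normal X j = (frac X, ipow h \<lfloor>X\<rfloor> j)"

text \<open>The first return map of the flow to the horizontal sides, in coordinates of the square
  below the side.\<close>

definition first_return :: "real \<Rightarrow> real \<times> 'q \<Rightarrow> real \<times> 'q" where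
  "first_return \<alpha> z = normal (fst z + \<alpha>) (v (snd z))"

lemma normal_ipow: "normal X (ipow h n j) = normal (X + of_int n) j"
  by (simp add: normal_def ipow_add[OF bij_h, symmetric] frac_def)

lemma normal_eqE:
  assumes "normal X j = normal X' j'"
  obtains m where "X' = X + of_int m" "j = ipow h m j'"
proof -
  define m where "m = \<lfloor>X'\<rfloor> - \<lfloor>X\<rfloor>"
  have X: "X' = X + of_int m" using assms by (simp add: normal_def frac_def m_def)
  have "ipow h \<lfloor>X\<rfloor> j = ipow h \<lfloor>X\<rfloor> (ipow h m j')"
    using assms by (simp add: normal_def m_def ipow_add[OF bij_h, symmetric])
  then have "j = ipow h m j'" by (metis ipow_minus(1)[OF bij_h])
  with X show thesis by (rule that)
qed

lemma strip_cong:
  assumes "normal X j = normal X' j'"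
  shows "strip j (X - d) y = strip j' (X' - d) y"
  using assms by (rule normal_eqE) (simp add: strip_shift algebra_simps)

text \<open>Iterate \<open>n\<close> records the crossing of height \<open>n + 1\<close>; the
  renaming by powers of \<open>h\<close> in \<open>strip_index\<close> is absorbed by
  \<open>normal\<close>.\<close>

lemma first_return_flow_line:
  "(first_return \<alpha> ^^ n) (normal (\<xi> + \<alpha>) j) = normal (\<xi> + \<alpha> * (n + 1)) (strip_index \<alpha> \<xi> j n)"
proof (induction n)
  case 0
  show ?case by simp
next
  case (Suc n)
  let ?X = "\<xi> + \<alpha> * (n + 1)"
  have "(first_return \<alpha> ^^ Suc n) (normal (\<xi> + \<alpha>) j) = first_return \<alpha> (normal ?X (strip_index \<alpha> \<xi> j n))"
    using Suc by simp
  also have "\<dots> = normal (frac ?X + \<alpha>) (v (ipow h \<lfloor>?X\<rfloor> (strip_index \<alpha> \<xi> j n)))"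
    unfolding first_return_def normal_def[of ?X] fst_conv snd_conv ..
  also have "\<dots> = normal (?X + \<alpha>) (ipow h (- \<lfloor>?X\<rfloor>) (v (ipow h \<lfloor>?X\<rfloor> (strip_index \<alpha> \<xi> j n))))"
    by (simp add: normal_ipow frac_def algebra_simps)
  finally show ?case by (simp add: algebra_simps)
qed

lemma surface_flow_line:
  assumes "p \<in> surface h v"
  obtains \<xi> j y0 where "y0 \<in> {0..1}" "p = flow_line \<alpha> \<xi> j y0"
proof -
  obtain j x where x: "x \<in> {0..1} \<times> {0..1}" "p = pt j x" using assms by (rule surfaceE)
  show thesis
  proof (rule that[of "snd x" "fst x - \<alpha> * snd x" j])
    show "snd x \<in> {0..1}" using x by auto
    have "flow_line \<alpha> (fst x - \<alpha> * snd x) j (snd x) = strip j (fst x) (snd x)"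
      using flow_line_eq[of "snd x" 0] x by auto
    also have "\<dots> = pt j x" using strip_eq[of "fst x" 0 "snd x" j] x by auto
    finally show "p = flow_line \<alpha> (fst x - \<alpha> * snd x) j (snd x)" using x by simp
  qed
qed

text \<open>Orbit and target are compared at the top of the target's square, to which the target is
  carried along its own flow line; hence the abscissa \<open>x + \<alpha> * (1 - y)\<close>. Both
  are then moved back by the same vector. \<open>n \<ge> 1\<close> keeps the flow time nonnegative,
  since \<open>y0 \<le> 1\<close>.\<close>

lemma Dist_flow_less:
  assumes "y0 \<in> {0..1}" "p = flow_line \<alpha> \<xi> j y0" "p \<notin> singular_leaves h v \<alpha>"
    and "x \<in> {0..1}" "y \<in> {0..1}" "n \<ge> 1"
    and "(first_return \<alpha> ^^ n) (normal (\<xi> + \<alpha>) j) = normal X i"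
    and "normal (x + \<alpha> * (1 - y)) k = normal X' i"
    and "\<bar>X - X'\<bar> < r" "r \<le> 1"
  shows "Dist h v (flow h v \<alpha> ((n + y - y0) / cos (arctan \<alpha>)) p) (pt k (x, y)) < r"
proof -
  let ?c = "cos (arctan \<alpha>)"
  let ?t = "(n + y - y0) / ?c"
  have c: "?c > 0" by (rule cos_arctan_bounds)
  have "flow h v \<alpha> ?t p = flow_line \<alpha> \<xi> j (y0 + ?t * ?c)"
    using flow_eq[of y0 \<alpha> \<xi> j ?t] assms(1,3,5,6) c unfolding assms(2) by simp
  also have "y0 + ?t * ?c = n + y" using c by simp
  also have "flow_line \<alpha> \<xi> j (n + y) = strip (strip_index \<alpha> \<xi> j n) (\<xi> + \<alpha> * (n + y)) y"
    using flow_line_eq[of "n + y" n] assms(5) by simp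
  also have "\<dots> = strip i (X - \<alpha> * (1 - y)) y"
    using strip_cong[OF assms(7)[unfolded first_return_flow_line], of "\<alpha> * (1 - y)" y]
    by (simp add: algebra_simps)
  finally have 1: "flow h v \<alpha> ?t p = strip i (X - \<alpha> * (1 - y)) y" .
  have "pt k (x, y) = strip k x y" using strip_eq[of x 0 y k] assms(4,5) by simp
  also have "\<dots> = strip i (X' - \<alpha> * (1 - y)) y"
    using strip_cong[OF assms(8), of "\<alpha> * (1 - y)" y] by simp
  finally have 2: "pt k (x, y) = strip i (X' - \<alpha> * (1 - y)) y" .
  show ?thesis unfolding 1 2
    using Dist_strip[of "X - \<alpha> * (1 - y)" "X' - \<alpha> * (1 - y)" y y i] assms by simp
qed

section \<open>Towers over the two sides and steps of Rauzy induction\<close>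

definition translates :: "real \<Rightarrow> real set \<Rightarrow> nat \<Rightarrow> real \<Rightarrow> ('q \<Rightarrow> 'q) \<Rightarrow> bool" where
  "translates \<alpha> A n c w \<longleftrightarrow>
     (\<forall>x\<in>A. \<forall>j. (first_return \<alpha> ^^ n) (normal x j) = normal (x + c) (w j))"

text \<open>The last clause keeps discontinuities of the return map out of all floors, so that
  nearby points of the base stay nearby while they climb.\<close>

definition tower :: "real \<Rightarrow> real set \<Rightarrow> nat \<Rightarrow> real \<Rightarrow> ('q \<Rightarrow> 'q) \<Rightarrow> bool" where
  "tower \<alpha> A q d \<sigma> \<longleftrightarrow> 1 \<le> q \<and> bij \<sigma> \<and> translates \<alpha> A q d \<sigma> \<and>
     (\<forall>n\<in>{1..q}. \<exists>c w. translates \<alpha> A n c w)"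

definition in_tower :: "real \<Rightarrow> real set \<Rightarrow> nat \<Rightarrow> real \<times> 'q \<Rightarrow> bool" where
  "in_tower \<alpha> A q z \<longleftrightarrow> (\<exists>x\<in>A. \<exists>j. \<exists>n\<in>{1..q}. z = (first_return \<alpha> ^^ n) (normal x j))"

text \<open>The two sides meet at 0. Wide and thin exchange roles after each turn, so both
  orientations have to be covered; with a Boolean the exchange is a negation.\<close>

definition side :: "bool \<Rightarrow> real \<Rightarrow> real set" where
  "side s l = (if s then {0..<l} else {-l..<0})"

definition orient :: "bool \<Rightarrow> real" where
  "orient s = (if s then 1 else -1)"

lemma orient_Not [simp]: "orient (\<not> s) = - orient s"
  by (simp add: orient_def)

text \<open>One stage of Rauzy induction: the side of length \<open>a\<close> returns to the union of the two sides
  after \<open>q2\<close> steps, moved by \<open>b\<close> towards the other side, while the fibre is permuted by \<open>s2\<close>;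
  symmetrically for the side of length \<open>b\<close>.\<close>

definition stage ::
    "real \<Rightarrow> bool \<Rightarrow> real \<Rightarrow> real \<Rightarrow> nat \<Rightarrow> nat \<Rightarrow> ('q \<Rightarrow> 'q) \<Rightarrow> ('q \<Rightarrow> 'q) \<Rightarrow> bool" where
  "stage \<alpha> s a b q1 q2 s1 s2 \<longleftrightarrow> 0 < a \<and> 0 < b \<and> a * q2 + b * q1 = 1 \<and>
     tower \<alpha> (side s a) q2 (- orient s * b) s2 \<and>
     tower \<alpha> (side (\<not> s) b) q1 (orient s * a) s1 \<and>
     (\<forall>X j. in_tower \<alpha> (side s a) q2 (normal X j) \<or> in_tower \<alpha> (side (\<not> s) b) q1 (normal X j))"

lemma stage_swap:
  assumes "stage \<alpha> s a b q1 q2 s1 s2"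
  shows "stage \<alpha> (\<not> s) b a q2 q1 s2 s1"
  using assms by (auto simp: stage_def add.commute)

lemma translates_subset: "translates \<alpha> A n c w \<Longrightarrow> B \<subseteq> A \<Longrightarrow> translates \<alpha> B n c w"
  by (auto simp: translates_def)

lemma tower_subset: "tower \<alpha> A q d \<sigma> \<Longrightarrow> B \<subseteq> A \<Longrightarrow> tower \<alpha> B q d \<sigma>"
  unfolding tower_def using translates_subset by meson

lemma translates_compose:
  assumes "translates \<alpha> A m c w" "translates \<alpha> B n d u" "\<And>x. x \<in> A \<Longrightarrow> x + c \<in> B"
  shows "translates \<alpha> A (m + n) (c + d) (u \<circ> w)"
  unfolding translates_def
proof (intro ballI allI)
  fix x j assume x: "x \<in> A"
  have "(first_return \<alpha> ^^ (m + n)) (normal x j) = (first_return \<alpha> ^^ n) ((first_return \<alpha> ^^ m) (normal x j))"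
    by (simp add: funpow_add add.commute[of m])
  also have "\<dots> = normal (x + (c + d)) ((u \<circ> w) j)"
    using assms x by (simp add: translates_def add.assoc)
  finally show "(first_return \<alpha> ^^ (m + n)) (normal x j) = normal (x + (c + d)) ((u \<circ> w) j)" .
qed

lemma tower_compose:
  assumes "tower \<alpha> A q d \<sigma>" "tower \<alpha> B r e \<tau>" "\<And>x. x \<in> A \<Longrightarrow> x + d \<in> B"
  shows "tower \<alpha> A (q + r) (d + e) (\<tau> \<circ> \<sigma>)"
  unfolding tower_def
proof (intro conjI ballI)
  show "1 \<le> q + r" "bij (\<tau> \<circ> \<sigma>)" using assms by (auto simp: tower_def bij_comp)
  have t: "translates \<alpha> A q d \<sigma>" using assms(1) by (simp add: tower_def)
  show "translates \<alpha> A (q + r) (d + e) (\<tau> \<circ> \<sigma>)"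
    using assms by (intro translates_compose[where B = B]) (auto simp: tower_def)
  fix n assume n: "n \<in> {1..q + r}"
  show "\<exists>c w. translates \<alpha> A n c w"
  proof (cases "n \<le> q")
    case True
    then show ?thesis using assms(1) n by (auto simp: tower_def)
  next
    case False
    then have "n - q \<in> {1..r}" using n by auto
    then obtain c w where "translates \<alpha> B (n - q) c w" using assms(2) unfolding tower_def by blast
    from translates_compose[OF t this assms(3)] False show ?thesis by auto
  qed
qed

text \<open>The thin side returns exactly onto the outer end of the wide side. When this end is cut
  off, the part of the wide tower above it is stacked on the thin tower, and the rest of the wide
  tower is unchanged.\<close>

lemma stage_step:
  assumes st: "stage \<alpha> s a b q1 q2 s1 s2" and ba: "b < a"
  shows "stage \<alpha> s (a - b) b (q1 + q2) q2 (s2 \<circ> s1) s2"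
proof -
  have t2: "tower \<alpha> (side s a) q2 (- orient s * b) s2"
    and t1: "tower \<alpha> (side (\<not> s) b) q1 (orient s * a) s1"
    and pos: "0 < b" and area: "a * q2 + b * q1 = 1"
    and cov: "\<And>X j. in_tower \<alpha> (side s a) q2 (normal X j) \<or> in_tower \<alpha> (side (\<not> s) b) q1 (normal X j)"
    using st by (auto simp: stage_def)
  have sub: "side s (a - b) \<subseteq> side s a" using pos by (auto simp: side_def)
  have jump: "x + orient s * a \<in> side s a" if "x \<in> side (\<not> s) b" for x
    using that ba by (auto simp: side_def orient_def split: if_splits)
  have "tower \<alpha> (side (\<not> s) b) (q1 + q2) (orient s * a + - orient s * b) (s2 \<circ> s1)"
    using t1 t2 jump by (rule tower_compose)
  then have T1: "tower \<alpha> (side (\<not> s) b) (q1 + q2) (orient s * (a - b)) (s2 \<circ> s1)"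
    by (simp add: algebra_simps)
  have "in_tower \<alpha> (side s (a - b)) q2 (normal X j) \<or> in_tower \<alpha> (side (\<not> s) b) (q1 + q2) (normal X j)" for X j
  proof -
    from cov[of X j] show ?thesis
    proof
      assume "in_tower \<alpha> (side (\<not> s) b) q1 (normal X j)"
      then show ?thesis by (fastforce simp: in_tower_def)
    next
      assume "in_tower \<alpha> (side s a) q2 (normal X j)"
      then obtain x i n where x: "x \<in> side s a" "n \<in> {1..q2}"
        "normal X j = (first_return \<alpha> ^^ n) (normal x i)"
        unfolding in_tower_def by blast
      show ?thesis
      proof (cases "x \<in> side s (a - b)")
        case True
        then show ?thesis using x unfolding in_tower_def by blast
      next
        case False
        \<comment> \<open>The point lies over the end that was cut off; it is reached from the thin
          side, in the preimage of the fibre \<open>i\<close> under \<open>s1\<close>.\<close>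
        let ?y = "x - orient s * a"
        have y: "?y \<in> side (\<not> s) b"
          using False x(1) by (auto simp: side_def orient_def split: if_splits)
        have "bij s1" using t1 by (simp add: tower_def)
        then have "s1 (inv s1 i) = i" by (simp add: bij_is_surj surj_f_inv_f)
        then have "(first_return \<alpha> ^^ q1) (normal ?y (inv s1 i)) = normal x i"
          using t1 y by (simp add: tower_def translates_def)
        then have "normal X j = (first_return \<alpha> ^^ (n + q1)) (normal ?y (inv s1 i))"
          using x(3) by (simp add: funpow_add)
        moreover have "n + q1 \<in> {1..q1 + q2}" using x(2) by auto
        ultimately show ?thesis using y unfolding in_tower_def by blast
      qed
    qed
  qed
  moreover have "(a - b) * q2 + b * (q1 + q2) = 1" using area by (simp add: algebra_simps)
  ultimately show ?thesis
    using T1 tower_subset[OF t2 sub] pos ba by (simp add: stage_def)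
qed

lemma stage_steps:
  assumes "stage \<alpha> s a b q1 q2 s1 s2" "m * b < a"
  shows "stage \<alpha> s (a - m * b) b (q1 + m * q2) q2 (s2 ^^ m \<circ> s1) s2"
  using assms(2)
proof (induction m)
  case 0
  show ?case using assms(1) by simp
next
  case (Suc m)
  have "0 < b" using assms(1) by (simp add: stage_def)
  with Suc.prems have lt: "m * b < a" "b < a - m * b" by (auto simp: algebra_simps)
  have "stage \<alpha> s (a - m * b - b) b (q1 + m * q2 + q2) q2 (s2 \<circ> (s2 ^^ m \<circ> s1)) s2"
    using Suc.IH[OF lt(1)] lt(2) by (rule stage_step)
  then show ?case by (simp add: algebra_simps comp_def)
qed

text \<open>Rotation by \<alpha> exchanges [-(1 - frac \<alpha>), 0) and [0, frac \<alpha>) up to an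
  integer translation, which the fibre records as a power of \<open>h\<close>. A negative abscissa
  belongs to the square on the left, hence the extra factor \<open>ipow h (- 1)\<close>.\<close>

lemma stage_init:
  assumes "\<alpha> \<notin> \<int>"
  defines "n \<equiv> \<lfloor>\<alpha>\<rfloor> + 1"
  shows "stage \<alpha> True (frac \<alpha>) (1 - frac \<alpha>) 1 1 (ipow h n \<circ> v \<circ> ipow h (- 1)) (ipow h n \<circ> v)"
proof -
  let ?a = "frac \<alpha>"
  have a: "0 < ?a" "?a < 1" using assms(1) by (simp_all add: frac_gt_0_iff frac_lt_1)
  have \<alpha>: "\<alpha> = ?a + of_int n - 1" by (simp add: n_def frac_def)
  have 2: "translates \<alpha> (side True ?a) 1 (- (1 - ?a)) (ipow h n \<circ> v)"
    unfolding translates_def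
  proof (intro ballI allI)
    fix x j assume x: "x \<in> side True ?a"
    then have "\<lfloor>x\<rfloor> = 0" using a by (intro floor_unique) (auto simp: side_def)
    then have "normal x j = (x, j)" by (simp add: normal_def frac_def)
    then have "(first_return \<alpha> ^^ 1) (normal x j) = normal (x + \<alpha>) (v j)"
      by (simp add: first_return_def)
    also have "x + \<alpha> = x + - (1 - ?a) + of_int n" using \<alpha> by linarith
    finally show "(first_return \<alpha> ^^ 1) (normal x j) = normal (x + - (1 - ?a)) ((ipow h n \<circ> v) j)"
      unfolding comp_apply normal_ipow .
  qed
  have 1: "translates \<alpha> (side False (1 - ?a)) 1 ?a (ipow h n \<circ> v \<circ> ipow h (- 1))"
    unfolding translates_def
  proof (intro ballI allI)
    fix x j assume x: "x \<in> side False (1 - ?a)"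
    then have "- (1 - ?a) \<le> x" "x < 0" by (auto simp: side_def)
    then have "\<lfloor>x\<rfloor> = -1" using a(1) by linarith
    then have "normal x j = (x + 1, ipow h (- 1) j)" by (simp add: normal_def frac_def)
    then have "(first_return \<alpha> ^^ 1) (normal x j) = normal (x + 1 + \<alpha>) (v (ipow h (- 1) j))"
      by (simp add: first_return_def)
    also have "x + 1 + \<alpha> = x + ?a + of_int n" using \<alpha> by linarith
    finally show "(first_return \<alpha> ^^ 1) (normal x j) = normal (x + ?a) ((ipow h n \<circ> v \<circ> ipow h (- 1)) j)"
      unfolding comp_apply normal_ipow .
  qed
  have bij: "bij (ipow h n \<circ> v)" "bij (ipow h n \<circ> v \<circ> ipow h (- 1))"
    by (intro bij_comp bij_v bij_ipow bij_h)+
  have cov: "in_tower \<alpha> (side True ?a) 1 (normal X j) \<or> in_tower \<alpha> (side False (1 - ?a)) 1 (normal X j)" for X j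
  proof -
    \<comment> \<open>\<open>N\<close> reduces X - \<alpha> into the union of the two sides, and
      \<open>i\<close> below inverts the action on the fibre.\<close>
    define N where "N = \<lfloor>X - \<alpha> + (1 - ?a)\<rfloor>"
    define x where "x = X - \<alpha> - of_int N"
    define M where "M = N + \<lfloor>x\<rfloor>"
    define i where "i = ipow h (- \<lfloor>x\<rfloor>) (inv v (ipow h M j))"
    have "v (ipow h \<lfloor>x\<rfloor> i) = ipow h M j"
      using bij_v by (simp add: i_def bij_h bij_is_surj surj_f_inv_f)
    then have "first_return \<alpha> (normal x i) = normal (frac x + \<alpha>) (ipow h M j)"
      by (simp add: first_return_def normal_def[of x])
    also have "\<dots> = normal X j" by (simp add: normal_ipow frac_def x_def M_def)
    finally have "normal X j = (first_return \<alpha> ^^ 1) (normal x i)" by simp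
    moreover have "x \<in> side True ?a \<or> x \<in> side False (1 - ?a)"
    proof -
      have "of_int N \<le> X - \<alpha> + (1 - ?a)" "X - \<alpha> + (1 - ?a) < of_int N + 1"
        unfolding N_def by linarith+
      then show ?thesis by (auto simp: side_def x_def)
    qed
    ultimately show ?thesis unfolding in_tower_def by (metis atLeastAtMost_singleton singletonI)
  qed
  have "tower \<alpha> (side True ?a) 1 (- (1 - ?a)) (ipow h n \<circ> v)"
    using 2 bij by (auto simp: tower_def)
  moreover have "tower \<alpha> (side False (1 - ?a)) 1 ?a (ipow h n \<circ> v \<circ> ipow h (- 1))"
    using 1 bij by (auto simp: tower_def)
  ultimately show ?thesis using cov a by (simp add: stage_def orient_def)
qed

section \<open>Stages and the continued fraction\<close>

lemma fst_first_return: "fst ((first_return \<alpha> ^^ n) (normal X j)) = frac (X + n * \<alpha>)"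
proof (induction n)
  case 0
  show ?case by (simp add: normal_def)
next
  case (Suc n)
  have "fst (first_return \<alpha> z) = frac (fst z + \<alpha>)" for z
    by (simp add: first_return_def normal_def)
  then have "fst ((first_return \<alpha> ^^ Suc n) (normal X j)) = frac (frac (X + n * \<alpha>) + \<alpha>)"
    using Suc by simp
  also have "\<dots> = frac (X + n * \<alpha> + \<alpha>)"
    by (simp add: frac_def algebra_simps)
  also have "X + n * \<alpha> + \<alpha> = X + Suc n * \<alpha>" by (simp add: algebra_simps)
  finally show ?case .
qed

lemma frac_eqD: "frac (x::real) = frac y \<Longrightarrow> x - y \<in> \<int>"
  by (metis Ints_diff Ints_of_int add_diff_cancel_left diff_add_cancel diff_diff_eq2 frac_def)

lemma tower_drift:
  assumes "tower \<alpha> A q d \<sigma>" "x \<in> A"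
  obtains p where "real q * \<alpha> - of_int p = d"
proof -
  have "(first_return \<alpha> ^^ q) (normal x undefined) = normal (x + d) (\<sigma> undefined)"
    using assms by (simp add: tower_def translates_def)
  then have "frac (x + q * \<alpha>) = frac (x + d)"
    using fst_first_return[where n = q and \<alpha> = \<alpha> and X = x and j = undefined] by (simp add: normal_def)
  then have "q * \<alpha> - d \<in> \<int>" using frac_eqD by fastforce
  then obtain p where "q * \<alpha> - d = of_int p" by (auto elim: Ints_cases)
  then show thesis by (intro that[of p]) simp
qed

text \<open>The base moves by a rotation, so both widths are distances from multiples of \<alpha> to
  integers. The area identity then says that the determinant of the two fractions is 1 or
  -1.\<close>

lemma stage_drift:
  assumes "stage \<alpha> s a b q1 q2 s1 s2"
  obtains p1 p2 where "orient s * a = q1 * \<alpha> - of_int p1" "- orient s * b = q2 * \<alpha> - of_int p2"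
    "p2 * int q1 - p1 * int q2 = (if s then 1 else - 1)"
proof -
  have pos: "0 < a" "0 < b" and area: "a * q2 + b * q1 = 1" using assms by (auto simp: stage_def)
  have "\<exists>x. x \<in> side s a" "\<exists>x. x \<in> side (\<not> s) b"
    using pos by (auto simp: side_def intro: exI[of _ 0] exI[of _ "- a"] exI[of _ "- b"])
  then obtain p1 p2 where p: "q1 * \<alpha> - of_int p1 = orient s * a" "q2 * \<alpha> - of_int p2 = - orient s * b"
    using assms unfolding stage_def by (metis tower_drift)
  have "of_int (p2 * int q1 - p1 * int q2) = (q1 * \<alpha> - of_int p1) * q2 - (q2 * \<alpha> - of_int p2) * q1"
    by (simp add: algebra_simps)
  also have "\<dots> = orient s * (a * q2 + b * q1)" unfolding p by (simp add: algebra_simps)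
  finally have "real_of_int (p2 * int q1 - p1 * int q2) = of_int (if s then 1 else - 1)"
    using area by (simp add: orient_def)
  then have "p2 * int q1 - p1 * int q2 = (if s then 1 else - 1)" by (simp only: of_int_eq_iff)
  with p show thesis by (intro that[of p1 p2]) auto
qed

text \<open>Best approximation: \<open>(k, m)\<close> is an integral combination of \<open>(q1, p1)\<close> and \<open>(q2, p2)\<close>.\<close>

lemma stage_best_approximation:
  assumes "stage \<alpha> s a b q1 q2 s1 s2" "0 < k" "k < q2"
  shows "a \<le> \<bar>real k * \<alpha> - of_int m\<bar>"
proof -
  obtain p1 p2 where p: "orient s * a = q1 * \<alpha> - of_int p1" "- orient s * b = q2 * \<alpha> - of_int p2"
    "p2 * int q1 - p1 * int q2 = (if s then 1 else - 1)"
    using stage_drift[OF assms(1)] .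
  have pos: "0 < a" "0 < b" "1 \<le> q1" "1 \<le> q2" using assms by (auto simp: stage_def tower_def)
  define e :: int where "e = (if s then 1 else - 1)"
  have ee: "e * e = 1" by (simp add: e_def)
  have oe: "orient s = of_int e" by (simp add: orient_def e_def)
  have det: "p2 * int q1 - p1 * int q2 = e" using p(3) by (simp add: e_def)
  define c1 where "c1 = e * (p2 * int k - m * int q2)"
  define c2 where "c2 = e * (m * int q1 - p1 * int k)"
  have "c1 * int q1 + c2 * int q2 = e * (p2 * int q1 - p1 * int q2) * int k"
    by (simp add: c1_def c2_def algebra_simps)
  then have k: "c1 * int q1 + c2 * int q2 = int k" using det ee by simp
  have "c1 * p1 + c2 * p2 = e * (p2 * int q1 - p1 * int q2) * m"
    by (simp add: c1_def c2_def algebra_simps)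
  then have m: "c1 * p1 + c2 * p2 = m" using det ee by simp
  have "real k * \<alpha> - of_int m = of_int (c1 * int q1 + c2 * int q2) * \<alpha> - of_int (c1 * p1 + c2 * p2)"
    unfolding k m by simp
  also have "\<dots> = of_int c1 * (q1 * \<alpha> - of_int p1) + of_int c2 * (q2 * \<alpha> - of_int p2)"
    by (simp add: algebra_simps)
  also have "\<dots> = orient s * (of_int c1 * a - of_int c2 * b)"
    unfolding p(1,2)[symmetric] by (simp add: algebra_simps)
  finally have val: "\<bar>real k * \<alpha> - of_int m\<bar> = \<bar>of_int c1 * a - of_int c2 * b\<bar>"
    by (simp add: abs_mult orient_def)
  have "c1 \<noteq> 0"
  proof
    assume "c1 = 0"
    then have e: "c2 * int q2 = int k" using k by simp
    then have "0 < c2 * int q2" using assms(2) by simp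
    then have "1 \<le> c2" by (simp add: zero_less_mult_iff)
    then have "1 * int q2 \<le> c2 * int q2" by (intro mult_right_mono) auto
    then show False using e assms(3) by simp
  qed
  \<comment> \<open>As \<open>0 < k < q2\<close>, the coefficients \<open>c1\<close> and
    \<open>c2\<close> cannot both be positive or both be negative, so the two terms of
    \<open>c1 a - c2 b\<close> reinforce each other.\<close>
  then consider "c1 \<ge> 1" | "c1 \<le> -1" by linarith
  then show ?thesis
  proof cases
    case 1
    have "c2 \<le> 0"
    proof (rule ccontr)
      assume "\<not> c2 \<le> 0"
      then have "0 * int q1 \<le> c1 * int q1" "1 * int q2 \<le> c2 * int q2"
        using 1 by (intro mult_right_mono; simp)+
      then show False using k assms(3) by simp
    qed
    then have "of_int c2 * b \<le> 0" using pos by (simp add: mult_nonpos_nonneg)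
    moreover have "1 * a \<le> of_int c1 * a" using 1 pos by (intro mult_right_mono) auto
    ultimately show ?thesis unfolding val by linarith
  next
    case 2
    have "0 \<le> c2"
    proof (rule ccontr)
      assume "\<not> 0 \<le> c2"
      then have "c1 * int q1 \<le> 0 * int q1" "c2 * int q2 \<le> 0 * int q2"
        using 2 by (intro mult_right_mono; simp)+
      then show False using k assms(2) by simp
    qed
    then have "0 \<le> of_int c2 * b" using pos by simp
    moreover have "of_int c1 * a \<le> (-1) * a" using 2 pos by (intro mult_right_mono) auto
    ultimately show ?thesis unfolding val by linarith
  qed
qed

section \<open>Orbits during one long turn\<close>

definition close :: "real \<Rightarrow> real \<times> 'q \<Rightarrow> real \<times> 'q \<Rightarrow> bool" where
  "close r z z' \<longleftrightarrow> (\<exists>x y i. z = normal x i \<and> z' = normal y i \<and> \<bar>x - y\<bar> < r)"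

lemma normal_add_cong:
  assumes "normal X j = normal X' j'"
  shows "normal (X + d) j = normal (X' + d) j'"
  using assms by (rule normal_eqE) (simp add: normal_ipow algebra_simps)

lemma close_shift:
  assumes "close r z (normal (Y - b) k)" "0 \<le> b"
  shows "close (r + b) z (normal Y k)"
proof -
  obtain x y i where *: "z = normal x i" "normal (Y - b) k = normal y i" "\<bar>x - y\<bar> < r"
    using assms(1) unfolding close_def by blast
  have "normal Y k = normal (y + b) i" using normal_add_cong[OF *(2), of b] by simp
  then show ?thesis using * assms(2) unfolding close_def by (intro exI[of _ x] exI[of _ "y + b"] exI[of _ i]) auto
qed

lemma close_mono: "close r z z' \<Longrightarrow> r \<le> r' \<Longrightarrow> close r' z z'"
  unfolding close_def by force

lemma tower_close:
  assumes "tower \<alpha> A q d \<sigma>" "n \<in> {1..q}" "x \<in> A" "y \<in> A" "\<bar>x - y\<bar> < r"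
  shows "close r ((first_return \<alpha> ^^ n) (normal x i)) ((first_return \<alpha> ^^ n) (normal y i))"
proof -
  obtain c w where "translates \<alpha> A n c w" using assms(1,2) unfolding tower_def by blast
  then show ?thesis using assms(3-5) unfolding close_def translates_def
    by (intro exI[of _ "x + c"] exI[of _ "y + c"] exI[of _ "w i"]) auto
qed

text \<open>A point in the thin tower is moved into the wide one by a shift of size \<open>b\<close>, so only targets in
  the wide tower have to be considered.\<close>

lemma stage_shift_cover:
  assumes st: "stage \<alpha> s a b q1 q2 s1 s2" and ab: "2 * b \<le> a" and q: "q1 \<le> q2"
  shows "in_tower \<alpha> (side s a) q2 (normal Y k) \<or> in_tower \<alpha> (side s a) q2 (normal (Y - b) k)"
proof (rule ccontr)
  assume "\<not> ?thesis"
  then have "in_tower \<alpha> (side (\<not> s) b) q1 (normal Y k)" "in_tower \<alpha> (side (\<not> s) b) q1 (normal (Y - b) k)"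
    using st unfolding stage_def by blast+
  then obtain x j n x' j' n' where x: "x \<in> side (\<not> s) b" "n \<in> {1..q1}" "normal Y k = (first_return \<alpha> ^^ n) (normal x j)"
    and x': "x' \<in> side (\<not> s) b" "n' \<in> {1..q1}" "normal (Y - b) k = (first_return \<alpha> ^^ n') (normal x' j')"
    unfolding in_tower_def by blast
  have "frac Y = frac (x + n * \<alpha>)" "frac (Y - b) = frac (x' + n' * \<alpha>)"
    using arg_cong[OF x(3), of fst] arg_cong[OF x'(3), of fst]
    unfolding fst_first_return by (simp_all add: normal_def)
  then have "(Y - (x + n * \<alpha>)) - (Y - b - (x' + n' * \<alpha>)) \<in> \<int>"
    by (intro Ints_diff[OF frac_eqD frac_eqD])
  then obtain M where M: "(Y - (x + n * \<alpha>)) - (Y - b - (x' + n' * \<alpha>)) = of_int M"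
    by (auto elim: Ints_cases)
  \<comment> \<open>With both points in the thin tower, (n' - n) \<alpha> is at distance at most
    \<open>e < 2 * b \<le> a\<close> from an integer while |n' - n| < q2, against best
    approximation; for n = n' the number \<open>e\<close> itself would be an integer in (0,
    1).\<close>
  define e where "e = b + x' - x"
  have e: "0 < e" "e < 2 * b" using x(1) x'(1) by (auto simp: side_def e_def split: if_splits)
  have M: "(real n' - real n) * \<alpha> + e = of_int M" using M by (simp add: e_def algebra_simps)
  have a: "0 < a" "0 < b" "1 \<le> q2" "a * q2 + b * q1 = 1" using st by (auto simp: stage_def tower_def)
  have "a * 1 \<le> a * q2" using a by (intro mult_left_mono) auto
  moreover have "0 \<le> b * q1" using a by simp
  ultimately have a1: "a \<le> 1" using a(4) by linarith
  consider "n = n'" | "n < n'" | "n' < n" by linarith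
  then show False
  proof cases
    case 1
    then have "0 < real_of_int M" "real_of_int M < 1" using M e a1 ab by auto
    then show False by simp
  next
    case 2
    then have "0 < n' - n" "n' - n < q2" using x(2) x'(2) q by auto
    from stage_best_approximation[OF st this, of M] 2 M e ab show False
      by (simp add: of_nat_diff algebra_simps)
  next
    case 3
    then have "0 < n - n'" "n - n' < q2" using x(2) x'(2) q by auto
    from stage_best_approximation[OF st this, of "- M"] 3 M e ab show False
      by (simp add: of_nat_diff algebra_simps)
  qed
qed

text \<open>The orbit climbs the rest of its tower, whose top is sent back to the union of the two
  sides.\<close>

lemma stage_enter:
  assumes st: "stage \<alpha> s a b q1 q2 s1 s2" and q: "q1 \<le> q2"
  obtains n x i where "n \<le> q2" "(first_return \<alpha> ^^ n) (normal X j) = normal x i"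
    "x \<in> side s a \<or> x \<in> side (\<not> s) b"
proof -
  let ?F = "first_return \<alpha>"
  have *: "\<exists>n\<le>q. \<exists>x\<in>A. \<exists>i. (?F ^^ n) (normal X j) = normal (x + d) (\<sigma> i)"
    if tow: "tower \<alpha> A q d \<sigma>" and inn: "in_tower \<alpha> A q (normal X j)" for A q d \<sigma>
  proof -
    obtain x i n where x: "x \<in> A" "n \<in> {1..q}" "normal X j = (?F ^^ n) (normal x i)"
      using inn unfolding in_tower_def by blast
    have "(?F ^^ (q - n)) (normal X j) = (?F ^^ (q - n + n)) (normal x i)"
      unfolding x(3) by (simp only: funpow_add comp_apply)
    also have "q - n + n = q" using x(2) by simp
    also have "(?F ^^ q) (normal x i) = normal (x + d) (\<sigma> i)"
      using tow x(1) by (simp add: tower_def translates_def)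
    finally show ?thesis using x(1) by (intro exI[of _ "q - n"]) auto
  qed
  have t2: "tower \<alpha> (side s a) q2 (- orient s * b) s2"
    and t1: "tower \<alpha> (side (\<not> s) b) q1 (orient s * a) s1"
    and pos: "0 < a" "0 < b"
    and cov: "in_tower \<alpha> (side s a) q2 (normal X j) \<or> in_tower \<alpha> (side (\<not> s) b) q1 (normal X j)"
    using st by (auto simp: stage_def)
  from cov show thesis
  proof
    assume "in_tower \<alpha> (side s a) q2 (normal X j)"
    from *[OF t2 this] obtain n x i where "n \<le> q2" "x \<in> side s a"
      "(?F ^^ n) (normal X j) = normal (x + - orient s * b) (s2 i)" by blast
    then show thesis using pos
      by (intro that[of n "x + - orient s * b" "s2 i"]) (auto simp: side_def orient_def split: if_splits)
  next
    assume "in_tower \<alpha> (side (\<not> s) b) q1 (normal X j)"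
    from *[OF t1 this] obtain n x i where "n \<le> q1" "x \<in> side (\<not> s) b"
      "(?F ^^ n) (normal X j) = normal (x + orient s * a) (s1 i)" by blast
    then show thesis using pos q
      by (intro that[of n "x + orient s * a" "s1 i"]) (auto simp: side_def orient_def split: if_splits)
  qed
qed

lemma stage_iterate:
  assumes st: "stage \<alpha> s a b q1 q2 s1 s2" and "\<And>i. i < n \<Longrightarrow> x - orient s * (real i * b) \<in> side s a"
  shows "(first_return \<alpha> ^^ (n * q2)) (normal x j) = normal (x - orient s * (n * b)) ((s2 ^^ n) j)"
  using assms(2)
proof (induction n)
  case 0
  show ?case by simp
next
  case (Suc n)
  have "(first_return \<alpha> ^^ (Suc n * q2)) (normal x j)
      = (first_return \<alpha> ^^ q2) ((first_return \<alpha> ^^ (n * q2)) (normal x j))"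
    by (simp add: funpow_add)
  also have "\<dots> = (first_return \<alpha> ^^ q2) (normal (x - orient s * (n * b)) ((s2 ^^ n) j))"
    using Suc by simp
  also have "\<dots> = normal (x - orient s * (n * b) + - orient s * b) (s2 ((s2 ^^ n) j))"
    using st Suc.prems[of n] by (simp add: stage_def tower_def translates_def)
  finally show ?case by (simp add: algebra_simps)
qed

text \<open>The steps are as long as the thin side, so the orbit cannot jump over it.\<close>

lemma side_transit:
  assumes "0 < b" "x \<in> side s a"
  obtains n :: nat where "1 \<le> n" "(real n - 1) * b \<le> a"
    "\<And>i. i < n \<Longrightarrow> x - orient s * (real i * b) \<in> side s a"
    "x - orient s * (real n * b) \<in> side (\<not> s) b"
proof -
  obtain N where N: "a / b < real N" using reals_Archimedean2 by blast
  then have N: "a < N * b" using assms(1) by (simp add: pos_divide_less_eq)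
  let ?P = "\<lambda>n. x - orient s * (real n * b) \<notin> side s a"
  have P: "?P N" using N assms by (auto simp: side_def orient_def split: if_splits)
  define n where "n = (LEAST n. ?P n)"
  have n: "?P n" unfolding n_def by (rule LeastI[of ?P, OF P])
  have less: "x - orient s * (i * b) \<in> side s a" if "i < n" for i
    using not_less_Least[of i ?P] that unfolding n_def by blast
  have n1: "1 \<le> n" using n assms(2) by (cases n) auto
  have prev: "x - orient s * ((real n - 1) * b) \<in> side s a"
    using less[of "n - 1"] n1 by (simp add: of_nat_diff)
  show thesis
  proof (rule that[OF n1 _ less])
    show "(real n - 1) * b \<le> a" using prev assms by (auto simp: side_def orient_def split: if_splits)
    have "x - orient s * (n * b) = x - orient s * ((real n - 1) * b) - orient s * b"
      by (simp add: algebra_simps)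
    then show "x - orient s * (n * b) \<in> side (\<not> s) b"
      using n prev assms(1) by (auto simp: side_def orient_def split: if_splits)
  qed
qed

lemma nat_in_residue_class:
  fixes t :: real
  assumes "real i \<le> t" "0 < k"
  obtains l where "t - k < real (i + k * l)" "real (i + k * l) \<le> t"
proof -
  define l where "l = nat \<lfloor>(t - i) / k\<rfloor>"
  have "0 \<le> (t - i) / k" using assms by simp
  then have l: "real l \<le> (t - i) / k" "(t - i) / k < real l + 1" unfolding l_def by linarith+
  have k: "0 < real k" using assms by simp
  show thesis
  proof (rule that[of l])
    show "real (i + k * l) \<le> t" using l(1) k by (simp add: pos_le_divide_eq algebra_simps)
    show "t - k < real (i + k * l)" using l(2) k by (simp add: pos_divide_less_eq algebra_simps)
  qed
qed

lemma funpow_cycle: "(\<And>j. (f ^^ k) j = j) \<Longrightarrow> (f ^^ (i + k * l)) j = (f ^^ i) j"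
  by (induction l) (simp_all add: funpow_add add.assoc[symmetric] add.commute[of k])

text \<open>\<open>s2\<close> has period six, so the number of steps may be taken from the residue
  class of \<open>i0\<close>, which gives the required fibre; some member of the class is within six
  of the number that would bring the base to \<open>y\<close>. \<open>8 * b \<le> a\<close> leaves
  room for five steps even if \<open>y\<close> is close to the starting end.\<close>

lemma transit_approach:
  assumes st: "stage \<alpha> s a b q1 q2 s1 s2" and ab: "8 * b \<le> a"
    and cyc: "\<And>j. (s2 ^^ 6) j = j" and i0: "i0 < 6"
    and x: "x - orient s * a \<in> side (\<not> s) b" and y: "y \<in> side s a"
  obtains n x' where "real n * b \<le> a" "x' \<in> side s a" "\<bar>x' - y\<bar> < 7 * b"
    "(first_return \<alpha> ^^ (n * q2)) (normal x j) = normal x' ((s2 ^^ i0) j)"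
proof -
  have b: "0 < b" using st by (simp add: stage_def)
  have oo: "orient s * orient s = 1" by (simp add: orient_def)
  \<comment> \<open>The distance still to travel; it may be slightly negative, since
    \<open>y\<close> can lie behind \<open>x\<close> in the outer end.\<close>
  define d where "d = orient s * (x - y)"
  have d: "- b < d" "d \<le> a" using x y by (auto simp: d_def side_def orient_def split: if_splits)
  have inside: "x - orient s * (real i * b) \<in> side s a" if "real i * b \<le> max d (5 * b)" for i
  proof -
    define t where "t = real i * b"
    have "0 \<le> t" "t \<le> d \<or> t \<le> 5 * b" using b that by (auto simp: t_def max_def split: if_splits)
    then show ?thesis using x y ab b unfolding t_def[symmetric]
      by (auto simp: d_def side_def orient_def split: if_splits)
  qed
  note conclude = that
  have main: thesis if n: "real n * b \<le> max d (5 * b)" "\<bar>d - n * b\<bar> < 7 * b" "(s2 ^^ n) j = (s2 ^^ i0) j" for n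
  proof (rule conclude)
    show "real n * b \<le> a" using n(1) d(2) ab b by linarith
    show "x - orient s * (real n * b) \<in> side s a" using inside[OF n(1)] .
    have "x - orient s * (real n * b) - y = orient s * (d - n * b)"
      using oo by (simp add: d_def algebra_simps orient_def)
    then show "\<bar>x - orient s * (real n * b) - y\<bar> < 7 * b" using n(2) by (simp add: abs_mult orient_def)
    have "x - orient s * (real i * b) \<in> side s a" if "i < n" for i
    proof (rule inside)
      have "real i * b \<le> real n * b" using that b by (intro mult_right_mono) auto
      then show "real i * b \<le> max d (5 * b)" using n(1) by linarith
    qed
    from stage_iterate[OF st this, of n j] n(3)
    show "(first_return \<alpha> ^^ (n * q2)) (normal x j) = normal (x - orient s * (real n * b)) ((s2 ^^ i0) j)"
      by simp
  qed
  have i0b: "real i0 * b \<le> 5 * b" using i0 b by (intro mult_right_mono) auto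
  have i0b': "0 \<le> real i0 * b" using b by simp
  show thesis
  proof (cases "d < 6 * b")
    case True
    show thesis
    proof (rule main[of i0])
      show "real i0 * b \<le> max d (5 * b)" using i0b by linarith
      show "\<bar>d - real i0 * b\<bar> < 7 * b" using i0b i0b' d True by linarith
    qed simp
  next
    case False
    then have "6 \<le> d / b" using b by (simp add: pos_le_divide_eq)
    then have "real i0 \<le> d / b" using i0 by linarith
    then obtain l where l: "d / b - 6 < real (i0 + 6 * l)" "real (i0 + 6 * l) \<le> d / b"
      using nat_in_residue_class[of i0 "d / b" 6] by auto
    have l1: "real (i0 + 6 * l) * b \<le> d" using l(2) b by (simp only: pos_le_divide_eq)
    have "d / b < real (i0 + 6 * l) + 6" using l(1) by linarith
    then have "d < (real (i0 + 6 * l) + 6) * b" using b by (simp only: pos_divide_less_eq)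
    then have l2: "d < real (i0 + 6 * l) * b + 6 * b" by (simp only: distrib_right)
    show thesis
    proof (rule main[of "i0 + 6 * l"])
      show "real (i0 + 6 * l) * b \<le> max d (5 * b)" using l1 by linarith
      show "\<bar>d - real (i0 + 6 * l) * b\<bar> < 7 * b" using l1 l2 b by linarith
      show "(s2 ^^ (i0 + 6 * l)) j = (s2 ^^ i0) j" using cyc by (rule funpow_cycle)
    qed
  qed
qed

text \<open>During a long turn the orbit sweeps the two cylinders, which are the cycles of \<open>s2\<close>, one
  after the other.\<close>

lemma long_turn:
  assumes st: "stage \<alpha> s a b q1 q2 s1 s2" and ab: "8 * b \<le> a" and q: "q1 \<le> q2"
    and cyc: "\<And>j. (s2 ^^ 6) j = j"
    and swap: "\<And>j k. (\<exists>i<6. k = (s2 ^^ i) j) \<or> (\<exists>i<6. k = (s2 ^^ i) (s1 j))"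
  obtains n where "N \<le> n" "(real n - N) * b \<le> 4"
    "close (8 * b) ((first_return \<alpha> ^^ n) (normal X j)) (normal Y k)"
proof -
  let ?F = "first_return \<alpha>"
  have pos: "0 < a" "0 < b" "1 \<le> q2" and area: "a * q2 + b * q1 = 1"
    using st by (auto simp: stage_def tower_def)
  have t2: "tower \<alpha> (side s a) q2 (- orient s * b) s2"
    and t1: "tower \<alpha> (side (\<not> s) b) q1 (orient s * a) s1"
    using st by (auto simp: stage_def)
  have comp: "(?F ^^ (m + n)) z = (?F ^^ m) ((?F ^^ n) z)" for m n z by (simp add: funpow_add)
  \<comment> \<open>The orbit crosses what is left of the wide side and climbs the thin tower once.
    It is then at the outer end, in a fibre of the form \<open>s1 ((s2 ^^ r) i)\<close>.\<close>
  have exit: "\<exists>n y. real n * b \<le> a + b \<and> y - orient s * a \<in> side (\<not> s) b \<and>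
      (\<exists>r. (?F ^^ (n * q2 + q1)) (normal x i) = normal y (s1 ((s2 ^^ r) i)))"
    if "x \<in> side s a \<or> x \<in> side (\<not> s) b" for x i
    using that
  proof
    assume "x \<in> side s a"
    then obtain n :: nat where n: "(real n - 1) * b \<le> a" "\<And>i. i < n \<Longrightarrow> x - orient s * (real i * b) \<in> side s a"
      "x - orient s * (n * b) \<in> side (\<not> s) b"
      using side_transit[OF pos(2)] by metis
    have "(?F ^^ (n * q2 + q1)) (normal x i) = (?F ^^ q1) ((?F ^^ (n * q2)) (normal x i))"
      by (simp only: comp add.commute[of "n * q2"])
    also have "\<dots> = normal (x - orient s * (n * b) + orient s * a) (s1 ((s2 ^^ n) i))"
      using stage_iterate[OF st n(2), of n i] t1 n(3) by (simp add: tower_def translates_def)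
    finally show ?thesis using n(1,3)
      by (intro exI[of _ n] exI[of _ "x - orient s * (n * b) + orient s * a"]) (auto simp: algebra_simps)
  next
    assume "x \<in> side (\<not> s) b"
    then have "(?F ^^ (0 * q2 + q1)) (normal x i) = normal (x + orient s * a) (s1 ((s2 ^^ 0) i))"
      using t1 by (simp add: tower_def translates_def)
    then show ?thesis using pos \<open>x \<in> side (\<not> s) b\<close>
      by (intro exI[of _ "0::nat"] exI[of _ "x + orient s * a"]) (auto intro: exI[of _ "0::nat"])
  qed
  obtain Y' where Y': "Y' = Y \<or> Y' = Y - b" "in_tower \<alpha> (side s a) q2 (normal Y' k)"
    using stage_shift_cover[OF st _ q, of Y k] ab pos by auto
  obtain y c l where y: "y \<in> side s a" "l \<in> {1..q2}" "normal Y' k = (?F ^^ l) (normal y c)"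
    using Y'(2) unfolding in_tower_def by blast
  obtain n0 x0 c0 where z0: "n0 \<le> q2" "(?F ^^ n0) ((?F ^^ N) (normal X j)) = normal x0 c0"
    "x0 \<in> side s a \<or> x0 \<in> side (\<not> s) b"
  proof -
    have "\<exists>X' j'. (?F ^^ N) (normal X j) = normal X' j'"
      by (induction N) (auto simp: first_return_def)
    then show thesis using stage_enter[OF st q] that by metis
  qed
  \<comment> \<open>This first exit only brings the orbit to the outer end. From there two crossings
    are available, separated by \<open>s1\<close>, one in each cylinder.\<close>
  obtain n1 x1 c1 where z1: "real n1 * b \<le> a + b" "x1 - orient s * a \<in> side (\<not> s) b"
    "(?F ^^ (n1 * q2 + q1)) (normal x0 c0) = normal x1 c1"
    using exit[OF z0(3), of c0] by blast
  have x1: "x1 \<in> side s a" using z1(2) ab pos by (auto simp: side_def orient_def split: if_splits)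
  obtain n2 x2 r where z2: "real n2 * b \<le> a + b" "x2 - orient s * a \<in> side (\<not> s) b"
    "(?F ^^ (n2 * q2 + q1)) (normal x1 c1) = normal x2 (s1 ((s2 ^^ r) c1))"
    using exit[of x1 c1] x1 by blast
  let ?T1 = "n1 * q2 + q1 + (n0 + N)"
  have Z1: "(?F ^^ ?T1) (normal X j) = normal x1 c1"
    using z0(2) z1(3) by (simp only: comp)
  let ?T2 = "n2 * q2 + q1 + ?T1"
  have Z2: "(?F ^^ ?T2) (normal X j) = normal x2 (s1 ((s2 ^^ r) c1))"
    using Z1 z2(3) by (simp only: comp)
  have target: "\<exists>i<6. c = (s2 ^^ i) c1 \<or> c = (s2 ^^ i) (s1 ((s2 ^^ r) c1))"
  proof -
    from swap[of c "(s2 ^^ r) c1"] show ?thesis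
    proof
      assume "\<exists>i<6. c = (s2 ^^ i) ((s2 ^^ r) c1)"
      then obtain i where "c = (s2 ^^ (i + r)) c1" by (auto simp: funpow_add)
      also have "(s2 ^^ (i + r)) c1 = (s2 ^^ ((i + r) mod 6 + 6 * ((i + r) div 6))) c1" by simp
      also have "\<dots> = (s2 ^^ ((i + r) mod 6)) c1" by (rule funpow_cycle[OF cyc])
      finally show ?thesis by (intro exI[of _ "(i + r) mod 6"]) simp
    qed blast
  qed
  have "\<exists>T n x'. T \<le> ?T2 \<and> N \<le> T \<and> real n * b \<le> a \<and> x' \<in> side s a \<and> \<bar>x' - y\<bar> < 7 * b \<and>
      (?F ^^ (n * q2 + T)) (normal X j) = normal x' c"
  proof -
    from target obtain i where i: "i < 6" "c = (s2 ^^ i) c1 \<or> c = (s2 ^^ i) (s1 ((s2 ^^ r) c1))" by blast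
    from i(2) show ?thesis
    proof
      assume c: "c = (s2 ^^ i) c1"
      obtain n x' where n: "real n * b \<le> a" "x' \<in> side s a" "\<bar>x' - y\<bar> < 7 * b"
        "(?F ^^ (n * q2)) (normal x1 c1) = normal x' c"
        using transit_approach[OF st ab cyc i(1) z1(2) y(1)] unfolding c .
      have "(?F ^^ (n * q2 + ?T1)) (normal X j) = normal x' c"
        unfolding comp[of "n * q2"] Z1 by (rule n(4))
      moreover have "?T1 \<le> ?T2" "N \<le> ?T1" by simp_all
      ultimately show ?thesis using n(1-3) by blast
    next
      assume c: "c = (s2 ^^ i) (s1 ((s2 ^^ r) c1))"
      obtain n x' where n: "real n * b \<le> a" "x' \<in> side s a" "\<bar>x' - y\<bar> < 7 * b"
        "(?F ^^ (n * q2)) (normal x2 (s1 ((s2 ^^ r) c1))) = normal x' c"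
        using transit_approach[OF st ab cyc i(1) z2(2) y(1)] unfolding c .
      have "(?F ^^ (n * q2 + ?T2)) (normal X j) = normal x' c"
        unfolding comp[of "n * q2"] Z2 by (rule n(4))
      moreover have "?T2 \<le> ?T2" "N \<le> ?T2" by simp_all
      ultimately show ?thesis using n(1-3) by blast
    qed
  qed
  then obtain T n x' where T: "T \<le> ?T2" "N \<le> T" "real n * b \<le> a" "x' \<in> side s a" "\<bar>x' - y\<bar> < 7 * b"
      "(?F ^^ (n * q2 + T)) (normal X j) = normal x' c" by blast
  let ?n = "l + (n * q2 + T)"
  have "close (7 * b) ((?F ^^ ?n) (normal X j)) (normal Y' k)"
    unfolding comp[of l] T(6) y(3) using T y t2 by (intro tower_close) auto
  then have cl: "close (8 * b) ((?F ^^ ?n) (normal X j)) (normal Y k)"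
  proof -
    assume cl: "close (7 * b) ((?F ^^ ?n) (normal X j)) (normal Y' k)"
    have b: "7 * b \<le> 8 * b" "7 * b + b \<le> 8 * b" "0 \<le> b" using pos by auto
    from Y'(1) show ?thesis
    proof
      assume "Y' = Y"
      then show ?thesis using close_mono[OF cl b(1)] by simp
    next
      assume "Y' = Y - b"
      then have "close (7 * b) ((?F ^^ ?n) (normal X j)) (normal (Y - b) k)" using cl by simp
      from close_mono[OF close_shift[OF this b(3)] b(2)] show ?thesis .
    qed
  qed
  \<comment> \<open>The three crossings take at most \<open>(3 * a + 2 * b) / b\<close> multiples of
    \<open>q2\<close>, and the four remaining stretches at most one each;
    \<open>3 * a + 6 * b \<le> 4 * a\<close>.\<close>
  have "(real ?n - N) * b \<le> 4"
  proof -
    have "real ?n - N \<le> (real n + real n1 + real n2 + 4) * q2"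
    proof -
      have "?n \<le> (n + n1 + n2 + 4) * q2 + N"
        using T(1) z0(1) q y(2) by (auto simp: algebra_simps)
      then have "real ?n \<le> real ((n + n1 + n2 + 4) * q2 + N)" by (simp only: of_nat_le_iff)
      then show ?thesis by simp
    qed
    then have "(real ?n - N) * b \<le> (real n + real n1 + real n2 + 4) * q2 * b"
      using pos by (intro mult_right_mono) auto
    also have "\<dots> = (real n * b + real n1 * b + real n2 * b + 4 * b) * q2" by (simp add: algebra_simps)
    also have "\<dots> \<le> (4 * a) * q2"
      using T(3) z1(1) z2(1) ab pos by (intro mult_right_mono) auto
    also have "\<dots> \<le> 4"
    proof -
      have "0 \<le> b * q1" using pos by simp
      then show ?thesis using area by simp
    qed
    finally show ?thesis .
  qed
  then show thesis using cl T(2) by (intro that[of ?n]) auto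
qed

end

section \<open>Short turns\<close>

text \<open>The sets of cells met on one passage through a tower satisfy the recursion below. The potential
  \<open>\<Sum>j. card (g k j)\<close> is nondecreasing and bounded, and when it is constant for three steps, \<open>g k\<close> is
  invariant under the whole group.\<close>

locale cell_recursion =
  fixes \<sigma> \<tau> :: "nat \<Rightarrow> 'q::finite \<Rightarrow> 'q" and m :: "nat \<Rightarrow> nat" and f g :: "nat \<Rightarrow> 'q \<Rightarrow> 'c::finite set"
  assumes bij: "bij (\<sigma> k)" "bij (\<tau> k)"
    and m: "1 \<le> m k"
    and \<sigma>_Suc: "\<sigma> (Suc k) = \<tau> k" and \<tau>_Suc: "\<tau> (Suc k) = \<tau> k ^^ m k \<circ> \<sigma> k"
    and f_Suc: "f (Suc k) j = g k j"
    and g_Suc: "g (Suc k) j = f k j \<union> (\<Union>i<m k. g k ((\<tau> k ^^ i) (\<sigma> k j)))"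
    and transitive: "(\<And>j. u (\<sigma> k j) = u j) \<Longrightarrow> (\<And>j. u (\<tau> k j) = u j) \<Longrightarrow> u i = (u j :: 'c set)"
begin

definition potential :: "nat \<Rightarrow> nat" where
  "potential k = (\<Sum>j\<in>UNIV. card (g k j))"

lemma g_Suc_superset: "i < m k \<Longrightarrow> g k ((\<tau> k ^^ i) (\<sigma> k j)) \<subseteq> g (Suc k) j"
  unfolding g_Suc by blast

lemma g_Suc_superset_0: "g k (\<sigma> k j) \<subseteq> g (Suc k) j"
  using g_Suc_superset[of 0 k j] m[of k] by simp

lemma sum_permuted:
  fixes p :: "'q \<Rightarrow> 'q"
  shows "bij p \<Longrightarrow> (\<Sum>j\<in>UNIV. card (g k (p j))) = potential k"
  unfolding potential_def by (rule sum.reindex_bij_betw)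

lemma potential_mono: "potential k \<le> potential (Suc k)"
proof -
  have "(\<Sum>j\<in>UNIV. card (g k (\<sigma> k j))) \<le> potential (Suc k)"
    unfolding potential_def by (intro sum_mono card_mono g_Suc_superset_0) auto
  then show ?thesis by (simp add: sum_permuted bij)
qed

lemma eq_of_potential:
  fixes p :: "'q \<Rightarrow> 'q"
  assumes "bij p" "\<And>j. g k (p j) \<subseteq> A j" "(\<Sum>j\<in>UNIV. card (A j)) \<le> potential k"
  shows "g k (p j) = A j"
proof -
  have "card (g k (p i)) \<le> card (A i)" for i using assms(2) by (intro card_mono) auto
  moreover have "(\<Sum>i\<in>UNIV. card (A i)) = (\<Sum>i\<in>UNIV. card (g k (p i)))"
    using assms(3) sum_mono[of UNIV "\<lambda>i. card (g k (p i))" "\<lambda>i. card (A i)"] calculation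
    by (simp add: sum_permuted[OF assms(1)])
  ultimately have "card (g k (p j)) = card (A j)"
    using sum_mono_inv[of "\<lambda>i. card (g k (p i))" UNIV "\<lambda>i. card (A i)" j] by simp
  then show ?thesis using assms(2) by (intro card_subset_eq) auto
qed

text \<open>A constant potential turns the inclusions from \<open>g_Suc\<close> into equalities:
  \<open>g (Suc k)\<close> is \<open>g k\<close> composed with \<open>\<sigma> k\<close>. The next
  two steps, through the part inherited from \<open>f\<close>, give invariance under
  \<open>\<sigma> k \<circ> \<tau> k\<close> and under \<open>\<tau> k ^^ m k\<close>. If
  \<open>m k > 1\<close>, the member \<open>i = 1\<close> of the union gives invariance under
  \<open>\<tau> k\<close> itself.\<close>

lemma stationary_constant:
  assumes "potential (Suc k) = potential k" "potential (Suc (Suc k)) = potential k"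
    "potential (Suc (Suc (Suc k))) = potential k"
  shows "g k i = g k j"
proof -
  have g1: "g (Suc k) j = g k (\<sigma> k j)" for j
    by (rule eq_of_potential[symmetric, OF bij(1) g_Suc_superset_0]) (simp add: assms flip: potential_def)
  have g2: "g (Suc (Suc k)) j = g k (\<sigma> k (\<tau> k j))" for j
  proof -
    have "g (Suc (Suc k)) j = g (Suc k) (\<tau> k j)"
      by (rule eq_of_potential[symmetric, OF bij(2)])
        (use g_Suc_superset_0[of "Suc k"] in \<open>simp_all add: \<sigma>_Suc assms flip: potential_def\<close>)
    then show ?thesis by (simp add: g1)
  qed
  have inv: "g k (\<sigma> k (\<tau> k j)) = g k j" for j
  proof (rule eq_of_potential[of id, unfolded id_def, symmetric, OF bij_id[unfolded id_def]])
    show "g k j \<subseteq> g k (\<sigma> k (\<tau> k j))" for j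
      unfolding g2[symmetric] g_Suc f_Suc by blast
    show "(\<Sum>j\<in>UNIV. card (g k (\<sigma> k (\<tau> k j)))) \<le> potential k"
      unfolding g2[symmetric] by (simp add: assms flip: potential_def)
  qed
  have g3: "g (Suc (Suc (Suc k))) j = g k (\<tau> (Suc k) j)" for j
  proof -
    have "g (Suc (Suc (Suc k))) j = g (Suc (Suc k)) (\<tau> (Suc k) j)"
      by (rule eq_of_potential[symmetric, OF bij(2)])
        (use g_Suc_superset_0[of "Suc (Suc k)"] in \<open>simp_all add: \<sigma>_Suc assms flip: potential_def\<close>)
    then show ?thesis by (simp add: g2 inv)
  qed
  have "g k (\<sigma> k j) = g k (\<tau> (Suc k) j)" for j
  proof (rule eq_of_potential[OF bij(1)])
    show "g k (\<sigma> k j) \<subseteq> g k (\<tau> (Suc k) j)" for j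
      unfolding g3[symmetric] g1[symmetric] by (subst g_Suc) (auto simp: f_Suc)
    show "(\<Sum>j\<in>UNIV. card (g k (\<tau> (Suc k) j))) \<le> potential k"
      unfolding g3[symmetric] by (simp add: assms flip: potential_def)
  qed
  then have pow: "g k ((\<tau> k ^^ m k) j) = g k j" for j
    using bij(1)[of k] by (metis \<tau>_Suc bij_pointE comp_apply)
  have \<tau>_inv: "g k (\<tau> k j) = g k j" for j
  proof (cases "m k = 1")
    case True
    then show ?thesis using pow by simp
  next
    case False
    then have m2: "1 < m k" using m[of k] by simp
    have "g k ((\<tau> k \<circ> \<sigma> k) j) = g (Suc k) j" for j
      by (rule eq_of_potential[OF bij_comp[OF bij(1) bij(2)]])
        (use g_Suc_superset[OF m2] in \<open>simp_all add: assms flip: potential_def\<close>)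
    then show ?thesis using bij(1)[of k] by (metis g1 bij_pointE comp_apply)
  qed
  have "g k (\<sigma> k j) = g k j" for j
    using inv[of "inv (\<tau> k) j"] \<tau>_inv[of "inv (\<tau> k) j"] bij(2)[of k]
    by (simp add: bij_is_surj surj_f_inv_f)
  then show ?thesis using \<tau>_inv by (rule transitive[of "g k" k i j])
qed

lemma eventually_full:
  assumes "\<And>c. (\<exists>j. c \<in> g 1 j)"
  shows "\<exists>k \<le> 1 + 3 * (CARD('q) * CARD('c) + 1). \<forall>j. g k j = UNIV"
proof -
  let ?B = "CARD('q) * CARD('c)"
  have mono: "potential k \<le> potential l" if "k \<le> l" for k l
    using that potential_mono by (rule lift_Suc_mono_le[rotated])
  have bound: "potential k \<le> ?B" for k
  proof -
    have "card (g k j) \<le> CARD('c)" for j by (rule card_mono) auto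
    then show ?thesis
      using sum_bounded_above[of UNIV "\<lambda>j. card (g k j)" "CARD('c)"] by (simp add: potential_def)
  qed
  \<comment> \<open>Sampling every third step makes one repetition a run of four equal values, by
    monotonicity. The samples start at 1, where the hypothesis puts every cell into some
    \<open>g 1 j\<close>.\<close>
  define P where "P n = potential (1 + 3 * n)" for n
  have "\<exists>n\<le>?B. P (Suc n) = P n"
  proof (rule ccontr)
    assume no: "\<not> ?thesis"
    have "n \<le> P n" if "n \<le> ?B + 1" for n
      using that
    proof (induction n)
      case (Suc n)
      then have "n \<le> ?B" by simp
      then have "P (Suc n) \<noteq> P n" using no by blast
      moreover have "P n \<le> P (Suc n)" unfolding P_def by (rule mono) simp
      ultimately show ?case using Suc by linarith
    qed simp
    from this[of "?B + 1"] have "?B + 1 \<le> P (?B + 1)" by simp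
    moreover have "P (?B + 1) \<le> ?B" unfolding P_def by (rule bound)
    ultimately show False by linarith
  qed
  then obtain n where n: "n \<le> ?B" "P (Suc n) = P n" by (elim exE conjE)
  define k where "k = 1 + 3 * n"
  have "1 + 3 * Suc n = Suc (Suc (Suc k))" by (simp add: k_def)
  then have 3: "potential (Suc (Suc (Suc k))) = potential k" using n(2) unfolding P_def k_def by metis
  have 1: "potential (Suc k) = potential k" and 2: "potential (Suc (Suc k)) = potential k"
    using 3 potential_mono[of k] potential_mono[of "Suc k"] potential_mono[of "Suc (Suc k)"]
    by linarith+
  have all: "\<exists>j. c \<in> g (Suc l) j" for c l
  proof (induction l)
    case 0
    show ?case using assms by simp
  next
    case (Suc l)
    then obtain j where "c \<in> g (Suc l) j" by blast
    moreover obtain i where "j = \<sigma> (Suc l) i" using bij(1)[of "Suc l"] by (rule bij_pointE)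
    ultimately show ?case using g_Suc_superset_0[of "Suc l" i] by blast
  qed
  have "c \<in> g k j" for c j
  proof -
    have "k = Suc (3 * n)" by (simp add: k_def)
    then obtain i where "c \<in> g k i" using all[of c "3 * n"] by auto
    then show ?thesis unfolding stationary_constant[OF 1 2 3, of i j] .
  qed
  then have "\<forall>j. g k j = UNIV" by blast
  moreover have "k \<le> 1 + 3 * (?B + 1)"
    unfolding k_def using n(1) by (meson add_le_mono le_refl mult_le_mono trans_le_add1)
  ultimately show ?thesis by (intro exI conjI)
qed

end

section \<open>Cells visited during a passage through a tower\<close>

context square_tiled
begin

text \<open>The time of the visit may depend on the point, but the cell visited depends only on the
  fibre \<open>j\<close>; this permits a recursion on finite sets.\<close>

definition visits ::
    "real \<Rightarrow> (bool \<Rightarrow> real set) \<Rightarrow> real set \<Rightarrow> nat \<Rightarrow> 'q \<Rightarrow> bool \<times> 'q \<Rightarrow> bool" where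
  "visits \<alpha> D A q j c \<longleftrightarrow>
     (\<forall>x\<in>A. \<exists>t<q. \<exists>x'\<in>D (fst c). (first_return \<alpha> ^^ t) (normal x j) = normal x' (snd c))"

lemma visits_mono:
  assumes "visits \<alpha> D A q j c" "q \<le> r"
  shows "visits \<alpha> D A r j c"
  unfolding visits_def
proof
  fix x assume "x \<in> A"
  then obtain t where "t < q" "\<exists>x'\<in>D (fst c). (first_return \<alpha> ^^ t) (normal x j) = normal x' (snd c)"
    using assms(1) unfolding visits_def by blast
  then show "\<exists>t<r. \<exists>x'\<in>D (fst c). (first_return \<alpha> ^^ t) (normal x j) = normal x' (snd c)"
    using assms(2) by (intro exI[of _ t]) simp
qed

lemma visits_compose:
  assumes "tower \<alpha> A q d \<sigma>" "visits \<alpha> D B r (\<sigma> j) c" "\<And>x. x \<in> A \<Longrightarrow> x + d \<in> B"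
  shows "visits \<alpha> D A (q + r) j c"
  unfolding visits_def
proof
  fix x assume x: "x \<in> A"
  then obtain t x' where t: "t < r" "x' \<in> D (fst c)"
    "(first_return \<alpha> ^^ t) (normal (x + d) (\<sigma> j)) = normal x' (snd c)"
    using assms(2,3) unfolding visits_def by blast
  have "(first_return \<alpha> ^^ (t + q)) (normal x j) = normal x' (snd c)"
    using assms(1) x t(3) by (simp add: funpow_add tower_def translates_def)
  then show "\<exists>t<q + r. \<exists>x'\<in>D (fst c). (first_return \<alpha> ^^ t) (normal x j) = normal x' (snd c)"
    using t by (intro exI[of _ "t + q"]) auto
qed

text \<open>After \<open>m\<close> steps, the old thin tower in fibre \<open>j\<close> stands over
  the thin side, followed by \<open>m\<close> copies of the wide tower entered in the fibres
  \<open>(s2 ^^ i) (s1 j)\<close>.\<close>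

lemma stage_steps_visits:
  assumes st: "stage \<alpha> s a b q1 q2 s1 s2" and mb: "m * b < a"
    and f: "\<And>j c. c \<in> f j \<Longrightarrow> visits \<alpha> D (side (\<not> s) b) q1 j c"
    and g: "\<And>j c. c \<in> g j \<Longrightarrow> visits \<alpha> D (side s a) q2 j c"
    and c: "c \<in> f j \<union> (\<Union>i<m. g ((s2 ^^ i) (s1 j)))"
  shows "visits \<alpha> D (side (\<not> s) b) (q1 + m * q2) j c"
  using mb c
proof (induction m)
  case 0
  then show ?case using f by simp
next
  case (Suc m)
  have b: "0 < b" using st by (simp add: stage_def)
  with Suc.prems have lt: "m * b < a" by (simp add: algebra_simps)
  show ?case
  proof (cases "c \<in> f j \<union> (\<Union>i<m. g ((s2 ^^ i) (s1 j)))")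
    case True
    show ?thesis using Suc.IH[OF lt True] by (rule visits_mono) simp
  next
    case False
    then have "c \<in> g ((s2 ^^ m) (s1 j))" using Suc.prems(2) by (auto simp: less_Suc_eq)
    then have 2: "visits \<alpha> D (side s a) q2 ((s2 ^^ m \<circ> s1) j) c" using g by simp
    have 1: "tower \<alpha> (side (\<not> s) b) (q1 + m * q2) (orient s * (a - m * b)) (s2 ^^ m \<circ> s1)"
      using stage_steps[OF st lt] by (simp add: stage_def)
    have mb: "b \<le> a - m * b" "0 \<le> m * b" using Suc.prems(1) b by (auto simp: algebra_simps)
    have "x + orient s * (a - m * b) \<in> side s a" if "x \<in> side (\<not> s) b" for x
    proof -
      define t where "t = m * b"
      show ?thesis using that mb b unfolding t_def[symmetric]
        by (auto simp: side_def orient_def split: if_splits)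
    qed
    from visits_compose[OF 1 2 this] show ?thesis by (simp add: algebra_simps)
  qed
qed

text \<open>The orbit enters the wide side, waits for the base below the target in the primed stage,
  in the right fibre, and climbs there. Each of the four stretches takes at most \<open>q2\<close>
  steps, and that base has length at most \<open>a'\<close>.\<close>

lemma stage_full_cover:
  assumes st: "stage \<alpha> s a b q1 q2 s1 s2" and ba: "b < a" and q: "q1 \<le> q2"
    and st': "stage \<alpha> s' a' b' q1' q2' s1' s2'" and ba': "b' < a'" and q': "q1' \<le> q2'" "q2' \<le> q2"
    and vis: "\<And>j c. visits \<alpha> (\<lambda>\<rho>. if \<rho> then side s' a' else side (\<not> s') b') (side s a) q2 j c"
  obtains n where "N \<le> n" "n \<le> N + 4 * q2" "close a' ((first_return \<alpha> ^^ n) (normal X j)) (normal Y k)"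
proof -
  let ?F = "first_return \<alpha>"
  let ?D = "\<lambda>\<rho>. if \<rho> then side s' a' else side (\<not> s') b'"
  let ?q = "\<lambda>\<rho>. if \<rho> then q2' else q1'"
  have comp: "(?F ^^ (m + n)) z = (?F ^^ m) ((?F ^^ n) z)" for m n z by (simp add: funpow_add)
  have t1: "tower \<alpha> (side (\<not> s) b) q1 (orient s * a) s1" and b: "0 < b"
    using st by (auto simp: stage_def)
  have pos': "0 < a'" "0 < b'" using st' by (auto simp: stage_def)
  obtain n0 x0 c0 where z0: "n0 \<le> q2" "(?F ^^ n0) ((?F ^^ N) (normal X j)) = normal x0 c0"
    "x0 \<in> side s a \<or> x0 \<in> side (\<not> s) b"
  proof -
    have "\<exists>X' j'. (?F ^^ N) (normal X j) = normal X' j'"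
      by (induction N) (auto simp: first_return_def)
    then show thesis using stage_enter[OF st q] that by metis
  qed
  have "\<exists>n1\<le>q1. \<exists>x1\<in>side s a. \<exists>c1. (?F ^^ n1) (normal x0 c0) = normal x1 c1"
    using z0(3)
  proof
    assume "x0 \<in> side s a"
    then show ?thesis by (intro exI[of _ 0]) auto
  next
    assume x0: "x0 \<in> side (\<not> s) b"
    then have "(?F ^^ q1) (normal x0 c0) = normal (x0 + orient s * a) (s1 c0)"
      using t1 by (simp add: tower_def translates_def)
    moreover have "x0 + orient s * a \<in> side s a"
      using x0 ba by (auto simp: side_def orient_def split: if_splits)
    ultimately show ?thesis by blast
  qed
  then obtain n1 x1 c1 where z1: "n1 \<le> q1" "x1 \<in> side s a" "(?F ^^ n1) (normal x0 c0) = normal x1 c1"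
    by blast
  have "\<exists>\<rho>. in_tower \<alpha> (?D \<rho>) (?q \<rho>) (normal Y k)"
  proof -
    have "in_tower \<alpha> (side s' a') q2' (normal Y k) \<or> in_tower \<alpha> (side (\<not> s') b') q1' (normal Y k)"
      using st' by (simp add: stage_def)
    then show ?thesis by (metis (full_types))
  qed
  then obtain \<rho> where \<rho>: "in_tower \<alpha> (?D \<rho>) (?q \<rho>) (normal Y k)" by blast
  then obtain y c l where y: "y \<in> ?D \<rho>" "l \<in> {1..?q \<rho>}" "normal Y k = (?F ^^ l) (normal y c)"
    unfolding in_tower_def by blast
  obtain t x' where t: "t < q2" "x' \<in> ?D \<rho>" "(?F ^^ t) (normal x1 c1) = normal x' c"
    using vis[of c1 "(\<rho>, c)"] z1(2) unfolding visits_def fst_conv snd_conv by blast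
  have "\<exists>d \<sigma>. tower \<alpha> (?D \<rho>) (?q \<rho>) d \<sigma>"
    using st' unfolding stage_def by (cases \<rho>) auto
  then obtain d \<sigma> where tow: "tower \<alpha> (?D \<rho>) (?q \<rho>) d \<sigma>" by blast
  have "\<bar>x' - y\<bar> < a'"
    using t(2) y(1) ba' pos' by (cases \<rho>) (auto simp: side_def split: if_splits)
  from tower_close[OF tow y(2) t(2) y(1) this]
  have cl: "close a' ((?F ^^ l) (normal x' c)) (normal Y k)" unfolding y(3) .
  have "(?F ^^ (l + (t + (n1 + (n0 + N))))) (normal X j) = (?F ^^ l) (normal x' c)"
    by (simp only: comp z0(2) z1(3) t(3))
  moreover have "l + (t + (n1 + (n0 + N))) \<le> N + 4 * q2"
    using y(2) t(1) z1(1) z0(1) q q' by (cases \<rho>) auto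
  ultimately show thesis using cl by (intro that[of "l + (t + (n1 + (n0 + N)))"]) auto
qed

text \<open>\<open>m\<close> is the partial quotient, the number of Rauzy steps before the roles
  change. \<open>a = m * b\<close> would make \<alpha> rational, so the new thin side is not
  empty.\<close>

lemma stage_turn:
  assumes irr: "\<alpha> \<notin> \<rat>" and st: "stage \<alpha> s a b q1 q2 s1 s2" and ba: "b < a" and q: "q1 \<le> q2"
  defines "m \<equiv> nat \<lfloor>a / b\<rfloor>"
  shows "1 \<le> m" "stage \<alpha> (\<not> s) b (a - m * b) q2 (q1 + m * q2) s2 (s2 ^^ m \<circ> s1)"
    "a - m * b < b" "q2 < q1 + m * q2" "m * b < a"
proof -
  have pos: "0 < b" "1 \<le> q1" "1 \<le> q2" using st by (auto simp: stage_def tower_def)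
  have "1 < a / b" using ba pos by simp
  then have m: "1 \<le> m" "m \<le> a / b" "a / b < m + 1" unfolding m_def by linarith+
  then have le: "m * b \<le> a" "a < (m + 1) * b" using pos by (simp_all add: pos_le_divide_eq pos_divide_less_eq)
  have "a \<noteq> m * b"
  proof
    assume eq: "a = m * b"
    obtain p1 p2 where p: "orient s * a = q1 * \<alpha> - of_int p1" "- orient s * b = q2 * \<alpha> - of_int p2"
      using stage_drift[OF st] by metis
    have "(q1 * \<alpha> - of_int p1) + m * (q2 * \<alpha> - of_int p2) = 0"
      unfolding p[symmetric] eq by simp
    then have "(real q1 + m * q2) * \<alpha> = of_int (p1 + m * p2)" by (simp add: algebra_simps)
    moreover have "0 < real q1 + m * q2" using pos by (simp add: add_pos_nonneg)
    ultimately have "\<alpha> = of_int (p1 + m * p2) / of_nat (q1 + m * q2)" by (simp add: field_simps)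
    then have "\<alpha> \<in> \<rat>" by simp
    then show False using irr by simp
  qed
  with le show lt: "m * b < a" by simp
  show "1 \<le> m" by (rule m)
  show "a - m * b < b" using le by (simp add: algebra_simps)
  show "stage \<alpha> (\<not> s) b (a - m * b) q2 (q1 + m * q2) s2 (s2 ^^ m \<circ> s1)"
    by (rule stage_swap[OF stage_steps[OF st lt]])
  have "1 * q2 \<le> m * q2" using m(1) by (intro mult_right_mono) auto
  then show "q2 < q1 + m * q2" using pos by linarith
qed

end

text \<open>One index stands for a whole turn of the continued fraction, with partial quotient
  \<open>m k\<close>. What is special to the surface is kept in \<open>cycles\<close> and
  \<open>transitive\<close>.\<close>

locale stage_sequence = square_tiled h v for h v :: "'q::finite \<Rightarrow> 'q" +
  fixes \<alpha> :: real and s :: "nat \<Rightarrow> bool" and a b :: "nat \<Rightarrow> real" and q1 q2 m :: "nat \<Rightarrow> nat"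
    and s1 s2 :: "nat \<Rightarrow> 'q \<Rightarrow> 'q"
  assumes st: "stage \<alpha> (s k) (a k) (b k) (q1 k) (q2 k) (s1 k) (s2 k)"
    and ba: "b k < a k" and q12: "q1 k \<le> q2 k" and m1: "1 \<le> m k" and mba: "m k * b k < a k"
    and q2_less: "q2 k < q2 (Suc k)"
    and s_Suc: "s (Suc k) = (\<not> s k)" and a_Suc: "a (Suc k) = b k"
    and q1_Suc: "q1 (Suc k) = q2 k" and q2_Suc: "q2 (Suc k) = q1 k + m k * q2 k"
    and s1_Suc: "s1 (Suc k) = s2 k" and s2_Suc: "s2 (Suc k) = s2 k ^^ m k \<circ> s1 k"
    and cycles: "(s2 k ^^ 6) j = j"
      "(\<exists>i<6. j' = (s2 k ^^ i) j) \<or> (\<exists>i<6. j' = (s2 k ^^ i) (s1 k j))"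
    and transitive: "(\<And>j. u (s1 k j) = u j) \<Longrightarrow> (\<And>j. u (s2 k j) = u j) \<Longrightarrow> u i = (u j :: (bool \<times> 'q) set)"
begin

lemma pos: "0 < a k" "0 < b k" "1 \<le> q2 k"
  using st[of k] by (simp_all add: stage_def tower_def)

lemma aq2: "a k * q2 k \<le> 1"
proof -
  have "0 \<le> b k * q1 k" using pos(2)[of k] by simp
  moreover have "a k * q2 k + b k * q1 k = 1" using st[of k] by (simp add: stage_def)
  ultimately show ?thesis by linarith
qed

lemma q2_mono: "k \<le> l \<Longrightarrow> q2 k \<le> q2 l"
  by (rule lift_Suc_mono_le[of q2]) (rule less_imp_le[OF q2_less])

lemma q2_ge: "k < q2 k"
proof (induction k)
  case 0
  show ?case using pos(3)[of 0] by simp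
next
  case (Suc k)
  then show ?case using q2_less[of k] by simp
qed

lemma b_antimono: "k \<le> l \<Longrightarrow> b l \<le> b k"
proof (rule lift_Suc_antimono_le[of b])
  show "b (Suc n) \<le> b n" for n using ba[of "Suc n"] a_Suc[of n] by simp
qed

lemma a_less: "a k < 1 / (k + 1)"
proof -
  have "1 \<le> q1 k" using st[of k] by (simp add: stage_def tower_def)
  then have "0 < b k * q1 k" using pos(2)[of k] by simp
  moreover have "a k * q2 k + b k * q1 k = 1" using st[of k] by (simp add: stage_def)
  moreover have "a k * (real k + 1) \<le> a k * q2 k"
    using pos(1)[of k] q2_ge[of k] by (intro mult_left_mono) linarith+
  ultimately have "a k * (real k + 1) < 1" by linarith
  moreover have "0 < real k + 1" by simp
  ultimately show ?thesis by (simp only: pos_less_divide_eq)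
qed

text \<open>At the start each side sees only itself. The pair follows the thin and the wide side;
  the old wide side becomes the next thin one, as in \<open>cell_recursion\<close>.\<close>

primrec cells :: "nat \<Rightarrow> nat \<Rightarrow> ('q \<Rightarrow> (bool \<times> 'q) set) \<times> ('q \<Rightarrow> (bool \<times> 'q) set)" where
  "cells n 0 = ((\<lambda>j. {(False, j)}), (\<lambda>j. {(True, j)}))"
| "cells n (Suc k) = (snd (cells n k), (\<lambda>j. fst (cells n k) j \<union>
     (\<Union>i<m (n + k). snd (cells n k) ((s2 (n + k) ^^ i) (s1 (n + k) j)))))"

abbreviation "doors n \<rho> \<equiv> if \<rho> then side (s n) (a n) else side (\<not> s n) (b n)"

lemma cells_visits:
  "(\<forall>j c. c \<in> fst (cells n k) j \<longrightarrow>
      visits \<alpha> (doors n) (side (\<not> s (n + k)) (b (n + k))) (q1 (n + k)) j c) \<and>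
    (\<forall>j c. c \<in> snd (cells n k) j \<longrightarrow> visits \<alpha> (doors n) (side (s (n + k)) (a (n + k))) (q2 (n + k)) j c)"
proof (induction k)
  case 0
  have "1 \<le> q1 n" "1 \<le> q2 n" using st[of n] by (auto simp: stage_def tower_def)
  then show ?case by (auto simp: visits_def intro!: exI[of _ 0])
next
  case (Suc k)
  let ?k = "n + k"
  have new: "visits \<alpha> (doors n) (side (\<not> s ?k) (b ?k)) (q1 ?k + m ?k * q2 ?k) j c"
    if "c \<in> snd (cells n (Suc k)) j" for j c
  proof (rule stage_steps_visits[OF st mba])
    show "c \<in> fst (cells n k) j \<union> (\<Union>i<m ?k. snd (cells n k) ((s2 ?k ^^ i) (s1 ?k j)))"
      using that by simp
  qed (use Suc in blast)+
  have "b (Suc ?k) \<le> a ?k" using ba[of "Suc ?k"] ba[of ?k] a_Suc[of ?k] by linarith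
  then have sub: "side (s ?k) (b (Suc ?k)) \<subseteq> side (s ?k) (a ?k)" by (auto simp: side_def)
  have old: "visits \<alpha> (doors n) (side (s ?k) (b (Suc ?k))) (q2 ?k) j c"
    if "c \<in> fst (cells n (Suc k)) j" for j c
  proof -
    have "visits \<alpha> (doors n) (side (s ?k) (a ?k)) (q2 ?k) j c"
      using Suc that unfolding cells.simps fst_conv by blast
    then show ?thesis using sub unfolding visits_def by blast
  qed
  show ?case
    unfolding add_Suc_right s_Suc a_Suc q1_Suc q2_Suc not_not using new old by blast
qed

definition short_turns :: nat where
  "short_turns = 1 + 3 * (CARD('q) * CARD(bool \<times> 'q) + 1)"

lemma cells_full: "\<exists>k\<le>short_turns. \<forall>j. snd (cells n k) j = UNIV"
proof -
  interpret cell_recursion "\<lambda>k. s1 (n + k)" "\<lambda>k. s2 (n + k)" "\<lambda>k. m (n + k)"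
    "\<lambda>k. fst (cells n k)" "\<lambda>k. snd (cells n k)"
  proof
    fix k
    show "bij (s1 (n + k))" "bij (s2 (n + k))" using st[of "n + k"] by (auto simp: stage_def tower_def)
    show "u i = u j" if "\<And>j. u (s1 (n + k) j) = u j" "\<And>j. u (s2 (n + k) j) = u j"
      for u :: "'q \<Rightarrow> (bool \<times> 'q) set" and i j
      using that by (rule transitive)
    show "1 \<le> m (n + k)" by (rule m1)
  qed (simp_all add: s1_Suc s2_Suc)
  have "\<exists>j. c \<in> snd (cells n 1) j" for c
  proof -
    obtain \<rho> i where c: "c = (\<rho>, i)" by (cases c)
    show ?thesis
    proof (cases \<rho>)
      case True
      have "bij (s1 n)" using st[of n] by (simp add: stage_def tower_def)
      then obtain j where "i = s1 n j" by (rule bij_pointE)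
      then show ?thesis using m1[of n] True c by (auto intro!: exI[of _ j] bexI[of _ 0])
    next
      case False
      then show ?thesis using c by auto
    qed
  qed
  from eventually_full[OF this] show ?thesis unfolding short_turns_def .
qed

text \<open>Either a long turn follows soon, or the group generated by the permutations of many short
  turns has already carried the orbit to every fibre.\<close>

lemma hitting_steps:
  assumes r: "0 < r" "r < 8 * b 0"
  obtains k where "r \<le> 8 ^ (short_turns + 2) * a k"
    "\<And>N X j Y i. \<exists>n\<ge>N. (real n - N) * b k \<le> 4 \<and>
      close r ((first_return \<alpha> ^^ n) (normal X j)) (normal Y i)"
proof -
  obtain n' :: nat where "8 / r < n'" using reals_Archimedean2 by blast
  then have "8 < n' * r" using r(1) by (simp only: pos_divide_less_eq)
  moreover have "a n' * (real n' + 1) < 1" using a_less[of n'] by (simp add: pos_less_divide_eq)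
  moreover have "a n' * real n' \<le> a n' * (real n' + 1)" using pos(1)[of n'] by (intro mult_left_mono) auto
  ultimately have "8 * a n' * n' < r * n'" by (simp add: mult.commute)
  then have n': "8 * b n' \<le> r" using ba[of n'] by (simp add: mult_less_cancel_right)
  \<comment> \<open>The first stage that resolves the scale \<open>r\<close>; minimality will give
    \<open>r < 8 * b (n - 1) = 8 * a n\<close>.\<close>
  define n where "n = (LEAST n. 8 * b n \<le> r)"
  have n: "8 * b n \<le> r" unfolding n_def by (rule LeastI[of "\<lambda>n. 8 * b n \<le> r", OF n'])
  have n_less: "r < 8 * b k" if "k < n" for k
    using not_less_Least[of k "\<lambda>n. 8 * b n \<le> r"] that unfolding n_def by simp
  have "n \<noteq> 0"
  proof
    assume "n = 0"
    then show False using n r(2) by simp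
  qed
  then obtain n0 where "n = Suc n0" by (cases n) auto
  then have an: "r < 8 * a n" using n_less[of n0] a_Suc[of n0] by simp
  \<comment> \<open>A short turn divides the wide length by less than 8, so after boundedly many of
    them it is still comparable to \<open>r\<close>.\<close>
  have drop: "a n \<le> 8 ^ i * a (n + i)" if "\<And>l. n \<le> l \<Longrightarrow> l < n + i \<Longrightarrow> a l < 8 * b l" for i
    using that
  proof (induction i)
    case 0
    show ?case by simp
  next
    case (Suc i)
    have "a n \<le> 8 ^ i * a (n + i)" using Suc by auto
    also have "\<dots> \<le> 8 ^ i * (8 * b (n + i))"
      using Suc.prems[of "n + i"] by (intro mult_left_mono) auto
    finally show ?case by (simp add: a_Suc algebra_simps)
  qed
  have drop': "r \<le> 8 ^ (short_turns + 2) * a (n + i)"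
    if short: "\<And>l. n \<le> l \<Longrightarrow> l < n + i \<Longrightarrow> a l < 8 * b l" and i: "i \<le> short_turns + 1" for i
  proof -
    have "a n \<le> 8 ^ i * a (n + i)" by (rule drop) (rule short)
    then have "r \<le> 8 ^ (i + 1) * a (n + i)" using an by (simp add: mult.assoc)
    also have "\<dots> \<le> 8 ^ (short_turns + 2) * a (n + i)"
    proof (rule mult_right_mono)
      show "(8::real) ^ (i + 1) \<le> 8 ^ (short_turns + 2)" using i by (intro power_increasing) linarith+
      show "0 \<le> a (n + i)" using pos(1)[of "n + i"] by simp
    qed
    finally show ?thesis .
  qed
  show thesis
  proof (cases "\<exists>i\<le>short_turns + 1. 8 * b (n + i) \<le> a (n + i)")
    case True
    define i where "i = (LEAST i. 8 * b (n + i) \<le> a (n + i))"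
    obtain i' where i': "i' \<le> short_turns + 1" "8 * b (n + i') \<le> a (n + i')" using True by blast
    have i: "8 * b (n + i) \<le> a (n + i)"
      unfolding i_def by (rule LeastI[of "\<lambda>i. 8 * b (n + i) \<le> a (n + i)", OF i'(2)])
    have "i \<le> i'" unfolding i_def by (rule Least_le[of "\<lambda>i. 8 * b (n + i) \<le> a (n + i)", OF i'(2)])
    then have i_le: "i \<le> short_turns + 1" using i'(1) by simp
    have ri: "r \<le> 8 ^ (short_turns + 2) * a (n + i)"
    proof (rule drop'[OF _ i_le])
      fix l assume l: "n \<le> l" "l < n + i"
      then have "l - n < i" by simp
      then have "\<not> 8 * b (n + (l - n)) \<le> a (n + (l - n))"
        using not_less_Least[of "l - n" "\<lambda>i. 8 * b (n + i) \<le> a (n + i)"] unfolding i_def by blast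
      then show "a l < 8 * b l" using l(1) by simp
    qed
    have "b (n + i) \<le> b n" by (rule b_antimono) simp
    then have br: "8 * b (n + i) \<le> r" using n by linarith
    show thesis
    proof (rule that[OF ri])
      fix N X j Y c
      obtain l where "N \<le> l" "(real l - N) * b (n + i) \<le> 4"
        "close (8 * b (n + i)) ((first_return \<alpha> ^^ l) (normal X j)) (normal Y c)"
        using long_turn[OF st i q12 cycles] .
      then show "\<exists>l\<ge>N. (real l - N) * b (n + i) \<le> 4 \<and> close r ((first_return \<alpha> ^^ l) (normal X j)) (normal Y c)"
        using br close_mono by blast
    qed
  next
    case False
    \<comment> \<open>Cells are counted from stage \<open>n + 1\<close>, whose wide side has length
      \<open>a (n + 1) = b n \<le> r\<close>; a visit to the right cell followed by a climb thus
      ends within \<open>r\<close> of the target.\<close>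
    obtain k where k: "k \<le> short_turns" "\<forall>j. snd (cells (n + 1) k) j = UNIV"
      using cells_full[of "n + 1"] by blast
    let ?K = "n + 1 + k"
    have "r \<le> 8 ^ (short_turns + 2) * a (n + (1 + k))"
    proof (rule drop'[of "1 + k"])
      fix l assume l: "n \<le> l" "l < n + (1 + k)"
      then have "l - n \<le> short_turns + 1" using k(1) by linarith
      then have "\<not> 8 * b (n + (l - n)) \<le> a (n + (l - n))" using False by blast
      then show "a l < 8 * b l" using l(1) by simp
    next
      show "1 + k \<le> short_turns + 1" using k(1) by linarith
    qed
    then have aK: "r \<le> 8 ^ (short_turns + 2) * a ?K" by (simp only: add.assoc)
    show thesis
    proof (rule that[OF aK])
      fix N X j Y c
      have vis: "visits \<alpha> (doors (n + 1)) (side (s ?K) (a ?K)) (q2 ?K) j c" for j c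
        using cells_visits[of "n + 1" k] k(2) by blast
      obtain l where l: "N \<le> l" "l \<le> N + 4 * q2 ?K"
        "close (a (n + 1)) ((first_return \<alpha> ^^ l) (normal X j)) (normal Y c)"
        using stage_full_cover[OF st ba q12 st ba q12 q2_mono vis, of N X j Y c] by auto
      have "a (n + 1) \<le> r" using n a_Suc[of n] pos(2)[of n] by simp
      then have "close r ((first_return \<alpha> ^^ l) (normal X j)) (normal Y c)" using l(3) close_mono by blast
      moreover have "(real l - N) * b ?K \<le> 4"
      proof -
        have "real l \<le> real (N + 4 * q2 ?K)" using l(2) by (simp only: of_nat_le_iff)
        then have "(real l - N) * b ?K \<le> (4 * q2 ?K) * b ?K" using pos(2)[of ?K] by (intro mult_right_mono) auto
        also have "\<dots> \<le> (4 * q2 ?K) * a ?K" using ba[of ?K] by (intro mult_left_mono) auto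
        also have "\<dots> = 4 * (a ?K * q2 ?K)" by (simp only: mult_ac)
        also have "\<dots> \<le> 4" using aq2[of ?K] by linarith
        finally show ?thesis .
      qed
      ultimately show "\<exists>l\<ge>N. (real l - N) * b ?K \<le> 4 \<and> close r ((first_return \<alpha> ^^ l) (normal X j)) (normal Y c)"
        using l(1) by blast
    qed
  qed
qed

end

section \<open>The Ornithorynque\<close>

definition ornith_pair :: "('a \<Rightarrow> 'a) \<Rightarrow> ('a \<Rightarrow> 'a) \<Rightarrow> bool" where
  "ornith_pair s1 s2 \<longleftrightarrow> (\<exists>\<phi> :: ornith_index \<Rightarrow> 'a. bij \<phi> \<and>
     (\<forall>j. s1 (\<phi> j) = \<phi> (ornith_h j)) \<and> (\<forall>j. s2 (\<phi> j) = \<phi> (ornith_v j)))"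

lemma ornith_pair_hv: "ornith_pair ornith_h ornith_v"
  unfolding ornith_pair_def by (intro exI[of _ id]) auto

lemma ornith_pair_renaming:
  assumes "ornith_pair s1 s2" "bij \<theta>" "\<And>j. t1 (\<theta> j) = \<theta> (s1 j)" "\<And>j. t2 (\<theta> j) = \<theta> (s2 j)"
  shows "ornith_pair t1 t2"
proof -
  obtain \<phi> where \<phi>: "bij \<phi>" "\<And>j. s1 (\<phi> j) = \<phi> (ornith_h j)" "\<And>j. s2 (\<phi> j) = \<phi> (ornith_v j)"
    using assms(1) unfolding ornith_pair_def by blast
  show ?thesis unfolding ornith_pair_def
    by (intro exI[of _ "\<theta> \<circ> \<phi>"]) (simp add: \<phi> assms bij_comp)
qed

text \<open>The renaming is the reflection of the surface in the diagonal.\<close>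

lemma ornith_pair_swap:
  assumes "ornith_pair s1 s2"
  shows "ornith_pair s2 s1"
proof -
  define \<theta> :: "ornith_index \<Rightarrow> ornith_index" where "\<theta> = (\<lambda>(i, a, b). (- i, b, a))"
  have inv: "\<theta> (\<theta> j) = j" for j by (cases j) (simp add: \<theta>_def)
  have bij: "bij \<theta>" by (rule o_bij[of \<theta>]) (simp_all add: fun_eq_iff inv)
  have h: "ornith_h (\<theta> j) = \<theta> (ornith_v j)" for j
    by (rule ornith_index_cases[of j]) (simp_all add: \<theta>_def ornith_h_simps ornith_v_simps)
  have v: "ornith_v (\<theta> j) = \<theta> (ornith_h j)" for j
    using h[of "\<theta> j"] by (metis inv)
  obtain \<phi> where \<phi>: "bij \<phi>" "\<And>j. s1 (\<phi> j) = \<phi> (ornith_h j)" "\<And>j. s2 (\<phi> j) = \<phi> (ornith_v j)"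
    using assms unfolding ornith_pair_def by blast
  show ?thesis unfolding ornith_pair_def
    by (intro exI[of _ "\<phi> \<circ> \<theta>"]) (simp add: \<phi> h v bij bij_comp)
qed

text \<open>The renaming comes from the affine map which is a Dehn twist on the vertical cylinders.\<close>

lemma ornith_pair_twist:
  assumes "ornith_pair s1 s2"
  shows "ornith_pair (s2 \<circ> s1) s2"
proof -
  define \<theta> :: "ornith_index \<Rightarrow> ornith_index" where
    "\<theta> = (\<lambda>(i, a, b). if a = 0 then ornith_v (i, a, b) else (i, a, b))"
  have \<theta>: "\<theta> (i, 0, 0) = (i - 1, 0, 1)" "\<theta> (i, 0, 1) = (i, 0, 0)" "\<theta> (i, 1, b) = (i, 1, b)" for i b
    by (simp_all add: \<theta>_def ornith_v_simps)
  have "surj \<theta>"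
  proof (rule surjI)
    define g :: "ornith_index \<Rightarrow> ornith_index" where "g = (\<lambda>(i, a, b).
      if a = 1 then (i, a, b) else if b = 0 then (i, 0, 1) else (i + 1, 0, 0))"
    show "\<theta> (g x) = x" for x
      by (rule ornith_index_cases[of x]) (simp_all add: g_def \<theta>)
  qed
  then have bij: "bij \<theta>" by (intro bijI finite_UNIV_surj_inj) auto
  have h: "ornith_v (ornith_h (\<theta> j)) = \<theta> (ornith_h j)" for j
    by (rule ornith_index_cases[of j]) (simp_all add: \<theta> ornith_h_simps ornith_v_simps)
  have v: "ornith_v (\<theta> j) = \<theta> (ornith_v j)" for j
    by (rule ornith_index_cases[of j]) (simp_all add: \<theta> ornith_v_simps)
  obtain \<phi> where \<phi>: "bij \<phi>" "\<And>j. s1 (\<phi> j) = \<phi> (ornith_h j)" "\<And>j. s2 (\<phi> j) = \<phi> (ornith_v j)"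
    using assms unfolding ornith_pair_def by blast
  show ?thesis unfolding ornith_pair_def
    by (intro exI[of _ "\<phi> \<circ> \<theta>"]) (simp add: \<phi> h v bij bij_comp)
qed

lemma ornith_pair_twists:
  assumes "ornith_pair s1 s2"
  shows "ornith_pair (s2 ^^ n \<circ> s1) s2"
proof (induction n)
  case 0
  show ?case using assms by simp
next
  case (Suc n)
  from ornith_pair_twist[OF this] show ?case by (simp add: comp_def)
qed

lemma three_cases: "(i::3) = 0 \<or> i = 1 \<or> i = 2"
proof -
  have "(3::3) = 0" by simp
  then show ?thesis using exhaust_3[of i] by metis
qed

lemma ornith_v_pow_2:
  "(ornith_v ^^ 2) (i, 0, b) = (i - 1, 0, b)" "(ornith_v ^^ 2) (i, 1, b) = (i + 1, 1, b)"
  using two_cases[of b] by (auto simp: numeral_2_eq_2 ornith_v_simps)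

text \<open>\<open>ornith_v\<close> keeps the second coordinate and flips the third, and its square
  moves the first by 1 or -1, which generates the integers modulo 3.\<close>

lemma ornith_v_orbit:
  "\<exists>n<6. (k, a, c) = (ornith_v ^^ n) (i, a, b)"
proof -
  have half: "\<exists>n<3. (k', a, c') = ((ornith_v ^^ 2) ^^ n) (i', a, c')" for k' i' c'
  proof -
    define d where "d = (if a = 0 then i' - k' else k' - i')"
    have p: "((ornith_v ^^ 2) ^^ n) (i', a, c') = (if a = 0 then i' - of_nat n else i' + of_nat n, a, c')" for n
      using two_cases[of a] by (induction n) (auto simp: ornith_v_pow_2 algebra_simps)
    have "\<exists>n<3. (of_nat n :: 3) = d"
      using three_cases[of d] by (elim disjE) (rule exI[of _ 0] exI[of _ 1] exI[of _ 2], simp)+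
    then obtain n where "n < 3" "(of_nat n :: 3) = d" by blast
    then show ?thesis unfolding p by (intro exI[of _ n]) (auto simp: d_def)
  qed
  show ?thesis
  proof (cases "b = c")
    case True
    obtain n where "n < 3" "(k, a, c) = ((ornith_v ^^ 2) ^^ n) (i, a, c)" using half by blast
    then show ?thesis using True
      by (intro exI[of _ "2 * n"]) (simp add: funpow_mult mult.commute)
  next
    case False
    obtain i' where i': "ornith_v (i, a, b) = (i', a, c)"
      using False two_cases[of a] two_cases[of b] two_cases[of c] by (auto simp: ornith_v_simps)
    obtain n where n: "n < 3" "(k, a, c) = ((ornith_v ^^ 2) ^^ n) (i', a, c)" using half by blast
    have "(ornith_v ^^ (2 * n + 1)) (i, a, b) = ((ornith_v ^^ 2) ^^ n) (ornith_v (i, a, b))"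
      by (simp add: funpow_mult mult.commute funpow_swap1)
    then show ?thesis using n unfolding i' by (intro exI[of _ "2 * n + 1"]) auto
  qed
qed

lemma ornith_v_pow_6: "(ornith_v ^^ 6) j = j"
proof -
  have 6: "(6::nat) = Suc (Suc (Suc (Suc (Suc (Suc 0)))))" by simp
  show ?thesis
    by (rule ornith_index_cases[of j]) (simp_all add: 6 ornith_v_simps del: numeral_eq_Suc)
qed

text \<open>\<open>ornith_h\<close> flips the second coordinate, which names the two cycles of
  \<open>ornith_v\<close>.\<close>

lemma ornith_cylinders:
  "(\<exists>n<6. k = (ornith_v ^^ n) j) \<or> (\<exists>n<6. k = (ornith_v ^^ n) (ornith_h j))"
proof -
  obtain i a b where j: "j = (i, a, b)" by (rule prod_cases3)
  obtain i' a' b' where k: "k = (i', a', b')" by (rule prod_cases3)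
  show ?thesis
  proof (cases "a = a'")
    case True
    then show ?thesis using ornith_v_orbit[of i' a' b' i b] j k by auto
  next
    case False
    obtain l b'' where "ornith_h j = (l, a', b'')"
      using False two_cases[of a] two_cases[of b] two_cases[of a'] j by (auto simp: ornith_h_simps)
    then show ?thesis using ornith_v_orbit[of i' a' b' l b''] k by auto
  qed
qed

lemma ornith_pair_cycles:
  assumes "ornith_pair s1 s2"
  shows "(s2 ^^ 6) j = j"
    and "(\<exists>n<6. k = (s2 ^^ n) j) \<or> (\<exists>n<6. k = (s2 ^^ n) (s1 j))"
    and "(\<And>j. u (s1 j) = u j) \<Longrightarrow> (\<And>j. u (s2 j) = u j) \<Longrightarrow> u j = u k"
proof -
  obtain \<phi> where \<phi>: "bij \<phi>" "\<And>j. s1 (\<phi> j) = \<phi> (ornith_h j)" "\<And>j. s2 (\<phi> j) = \<phi> (ornith_v j)"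
    using assms unfolding ornith_pair_def by blast
  have pow: "(s2 ^^ n) (\<phi> j) = \<phi> ((ornith_v ^^ n) j)" for n j
    by (induction n) (simp_all add: \<phi>)
  obtain j' k' where j': "j = \<phi> j'" "k = \<phi> k'" using \<phi>(1) by (metis bij_pointE)
  show "(s2 ^^ 6) j = j" unfolding j' pow ornith_v_pow_6 ..
  show swap: "(\<exists>n<6. k = (s2 ^^ n) j) \<or> (\<exists>n<6. k = (s2 ^^ n) (s1 j))"
    unfolding j' pow \<phi>(2) using ornith_cylinders[of k' j'] by metis
  assume u: "\<And>j. u (s1 j) = u j" "\<And>j. u (s2 j) = u j"
  have "u ((s2 ^^ n) i) = u i" for n i by (induction n) (simp_all add: u)
  then show "u j = u k" using swap u by metis
qed

text \<open>The sixth power of \<open>ornith_h\<close> is the identity, so integer powers are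
  nonnegative powers and the inverse is the fifth power. Twists and swaps then produce the pair up
  to conjugation by \<open>ornith_h\<close>.\<close>

lemma ornith_pair_initial:
  "ornith_pair (ipow ornith_h n \<circ> ornith_v \<circ> ipow ornith_h (- 1)) (ipow ornith_h n \<circ> ornith_v)"
proof -
  let ?h = "ornith_h" and ?v = "ornith_v"
  have bij: "bij ?h" using origami_ornith by (simp add: origami_def)
  have h6: "(?h ^^ 6) j = j" for j
    using ornith_pair_cycles(1)[OF ornith_pair_swap[OF ornith_pair_hv]] .
  have nat_pow: "ipow ?h (int n) j = (?h ^^ n) j" for n j by (simp add: ipow_def)
  have mod6: "ipow ?h n j = (?h ^^ nat (n mod 6)) j" for n j
  proof -
    have per: "ipow ?h (i * 6) j = j" for i j
    proof (induction i rule: int_induct[where k = 0])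
      case (step1 i)
      then show ?case using ipow_add[OF bij, of 6 "i * 6" j] nat_pow[of 6] h6 by (simp add: algebra_simps)
    next
      case (step2 i)
      then show ?case using ipow_add[OF bij, of 6 "(i - 1) * 6" j] nat_pow[of 6] h6 by (simp add: algebra_simps)
    qed simp
    have "ipow ?h n j = ipow ?h (int (nat (n mod 6)) + n div 6 * 6) j" by simp
    also have "\<dots> = (?h ^^ nat (n mod 6)) j" unfolding ipow_add[OF bij] per nat_pow ..
    finally show ?thesis .
  qed
  define w where "w = ipow ?h n \<circ> ?v"
  have "w = ?h ^^ nat (n mod 6) \<circ> ?v" by (simp add: w_def fun_eq_iff mod6)
  then have "ornith_pair w ?h"
    using ornith_pair_twists[OF ornith_pair_swap[OF ornith_pair_hv]] by simp
  then have "ornith_pair (?h ^^ 5 \<circ> w) ?h" by (rule ornith_pair_twists)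
  moreover have "?h ^^ 5 \<circ> w = ipow ?h (- 1) \<circ> w" by (simp add: fun_eq_iff mod6)
  ultimately have "ornith_pair (ipow ?h (- 1) \<circ> w \<circ> ?h) (ipow ?h (- 1) \<circ> w)"
    using ornith_pair_twist[OF ornith_pair_swap] by metis
  then have "ornith_pair w (w \<circ> ipow ?h (- 1))"
  proof (rule ornith_pair_renaming[OF _ bij])
    have hh: "?h (ipow ?h (- 1) x) = x" "ipow ?h (- 1) (?h x) = x" for x
      using ipow_minus[OF bij, of 1 x] by simp_all
    show "w (?h j) = ?h ((ipow ?h (- 1) \<circ> w \<circ> ?h) j)" for j by (simp add: hh)
    show "(w \<circ> ipow ?h (- 1)) (?h j) = ?h ((ipow ?h (- 1) \<circ> w) j)" for j by (simp add: hh)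
  qed
  then show ?thesis using ornith_pair_swap by (simp add: w_def)
qed

section \<open>Diophantine type and hitting exponent\<close>

lemma ereal_log_le: "x \<le> ereal y \<Longrightarrow> 0 < y \<Longrightarrow> ereal_log x \<le> ereal (ln y)"
  by (cases x) (auto simp: ereal_log_def)

lemma ereal_log_ge: "ereal y \<le> x \<Longrightarrow> 0 < y \<Longrightarrow> ereal (ln y) \<le> ereal_log x"
  by (cases x) (auto simp: ereal_log_def)

definition approximations :: "real \<Rightarrow> real \<Rightarrow> (int \<times> int) set" where
  "approximations \<alpha> w = {(p, q). q > 0 \<and> coprime p q \<and>
     \<bar>\<alpha> - of_int p / of_int q\<bar> < of_int q powr (- (w + 1))}"

lemma diophantine_type_eq:
  "diophantine_type \<alpha> = Sup (ereal ` {w. w > 0 \<and> infinite (approximations \<alpha> w)})"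
  unfolding diophantine_type_def approximations_def ..

lemma approximations_bounds:
  assumes "(p, q) \<in> approximations \<alpha> w" "0 < w"
  shows "\<bar>q * \<alpha> - p\<bar> < q powr (- w)" "\<bar>real_of_int p\<bar> \<le> q * (\<bar>\<alpha>\<bar> + 1)" "1 \<le> q"
proof -
  have q: "1 \<le> q" and lt: "\<bar>\<alpha> - p / q\<bar> < q powr (- (w + 1))"
    using assms(1) by (auto simp: approximations_def)
  then have q': "0 < real_of_int q" "1 \<le> real_of_int q" by simp_all
  show "1 \<le> q" by (rule q)
  have e: "q * \<alpha> - p = q * (\<alpha> - p / q)" using q' by (simp add: field_simps)
  have "\<bar>q * \<alpha> - p\<bar> = q * \<bar>\<alpha> - p / q\<bar>" unfolding e using q' by (simp add: abs_mult)
  also have "\<dots> < q * q powr (- (w + 1))" using lt q' by simp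
  also have "\<dots> = q powr 1 * q powr (- (w + 1))" using q' by simp
  also have "\<dots> = q powr (- w)" by (simp only: powr_add[symmetric]) simp
  finally show 1: "\<bar>q * \<alpha> - p\<bar> < q powr (- w)" .
  have "q powr (- w) \<le> q powr 0" using q' assms(2) by (intro powr_mono) auto
  then have "\<bar>q * \<alpha> - p\<bar> \<le> q" using 1 q' by simp
  moreover have "\<bar>q * \<alpha>\<bar> = q * \<bar>\<alpha>\<bar>" using q' by (simp add: abs_mult)
  ultimately show "\<bar>real_of_int p\<bar> \<le> q * (\<bar>\<alpha>\<bar> + 1)" by (simp add: algebra_simps)
qed

text \<open>Bounded denominators leave only finitely many fractions, because |p| \<le> q (|\<alpha>|
  + 1).\<close>

lemma approximations_large:
  assumes "infinite (approximations \<alpha> w)" "0 < w"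
  obtains p q where "(p, q) \<in> approximations \<alpha> w" "B < real_of_int q"
proof (rule ccontr)
  assume no: "\<not> thesis"
  note large = that
  let ?N = "\<lceil>\<bar>B\<bar> * (\<bar>\<alpha>\<bar> + 1)\<rceil>"
  have "approximations \<alpha> w \<subseteq> {- ?N..?N} \<times> {0..\<lceil>\<bar>B\<bar>\<rceil>}"
  proof
    fix z assume z: "z \<in> approximations \<alpha> w"
    obtain p q where pq: "z = (p, q)" by (cases z)
    have q: "real_of_int q \<le> \<bar>B\<bar>" using no large z pq by force
    have b: "\<bar>real_of_int p\<bar> \<le> q * (\<bar>\<alpha>\<bar> + 1)" "1 \<le> q"
      using approximations_bounds[of p q \<alpha> w] z pq assms(2) by auto
    have "q * (\<bar>\<alpha>\<bar> + 1) \<le> \<bar>B\<bar> * (\<bar>\<alpha>\<bar> + 1)" using q by (intro mult_right_mono) auto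
    then have "\<bar>real_of_int p\<bar> \<le> \<bar>B\<bar> * (\<bar>\<alpha>\<bar> + 1)" using b by linarith
    then have "p \<le> ?N" "- ?N \<le> p" "q \<le> \<lceil>\<bar>B\<bar>\<rceil>" using q by linarith+
    then show "z \<in> {- ?N..?N} \<times> {0..\<lceil>\<bar>B\<bar>\<rceil>}" using b pq by simp
  qed
  then show False using assms(1) finite_subset by blast
qed

text \<open>The finitely many good approximations only lower the constant, and irrationality keeps
  it positive.\<close>

lemma approximations_finite_bound:
  assumes "\<alpha> \<notin> \<rat>" "finite (approximations \<alpha> w)"
  obtains c where "0 < c" "\<And>p q. 0 < q \<Longrightarrow> coprime p q \<Longrightarrow> c * q powr (- w) \<le> \<bar>q * \<alpha> - of_int p\<bar>"
proof -
  let ?f = "\<lambda>(p :: int, q :: int). \<bar>of_int q * \<alpha> - of_int p\<bar> * of_int q powr w"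
  \<comment> \<open>The element 1 is the constant that serves all other fractions.\<close>
  let ?S = "insert 1 (?f ` approximations \<alpha> w)"
  have pos: "0 < \<bar>q * \<alpha> - of_int p\<bar>" if "0 < q" for p q :: int
  proof -
    have "q * \<alpha> \<noteq> p"
    proof
      assume "q * \<alpha> = p"
      then have "\<alpha> = p / q" using that by (simp add: field_simps)
      then show False using assms(1) by simp
    qed
    then show ?thesis by simp
  qed
  have fin: "finite ?S" using assms(2) by simp
  show thesis
  proof (rule that[of "Min ?S"])
    have S: "0 < x" if "x \<in> ?S" for x
      using that pos by (auto simp: approximations_def intro!: mult_pos_pos)
    show "0 < Min ?S" by (rule S[OF Min_in[OF fin]]) simp
    fix p q :: int assume q: "0 < q" "coprime p q"
    have pw: "q powr w * q powr (- w) = 1" using q(1) by (simp add: powr_add[symmetric])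
    show "Min ?S * q powr (- w) \<le> \<bar>q * \<alpha> - of_int p\<bar>"
    proof (cases "(p, q) \<in> approximations \<alpha> w")
      case True
      then have "Min ?S \<le> \<bar>q * \<alpha> - of_int p\<bar> * q powr w" using fin by (intro Min_le) force+
      then have "Min ?S * q powr (- w) \<le> \<bar>q * \<alpha> - of_int p\<bar> * q powr w * q powr (- w)"
        by (intro mult_right_mono) auto
      then show ?thesis using pw by (simp add: mult.assoc)
    next
      case False
      then have "q powr (- (w + 1)) \<le> \<bar>\<alpha> - p / q\<bar>" using q by (simp add: approximations_def)
      then have "q * q powr (- (w + 1)) \<le> q * \<bar>\<alpha> - p / q\<bar>" using q by (intro mult_left_mono) auto
      also have "q * \<bar>\<alpha> - p / q\<bar> = \<bar>q * (\<alpha> - p / q)\<bar>" using q by (simp add: abs_mult)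
      also have "q * (\<alpha> - p / q) = q * \<alpha> - p" using q by (simp add: field_simps)
      also have "q * q powr (- (w + 1)) = q powr 1 * q powr (- (w + 1))" using q by simp
      also have "\<dots> = q powr (- w)" by (simp only: powr_add[symmetric]) simp
      finally have "q powr (- w) \<le> \<bar>q * \<alpha> - of_int p\<bar>" .
      moreover have "Min ?S \<le> 1" using fin by (intro Min_le) auto
      then have "Min ?S * q powr (- w) \<le> 1 * q powr (- w)" by (intro mult_right_mono) auto
      ultimately show ?thesis by linarith
    qed
  qed
qed

section \<open>Lower bound for the hitting exponent\<close>

context square_tiled
begin

text \<open>The target is a point where \<open>q x - p y\<close> differs by \<open>1 / 2\<close> from its value at \<open>z\<close>.\<close>

lemma hitting_time_ge:
  assumes z: "z \<in> surface h v" "z \<notin> singular_leaves h v \<alpha>"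
    and w: "0 < w" and pq: "(p, q) \<in> approximations \<alpha> w"
    and r: "r = 1 / (8 * ((\<bar>\<alpha>\<bar> + 2) * q))"
  shows "ereal (q powr w / 4) \<le> hitting_time h v \<alpha> z r"
proof -
  let ?c = "cos (arctan \<alpha>)"
  have q1: "1 \<le> q" and pb: "\<bar>real_of_int p\<bar> \<le> q * (\<bar>\<alpha>\<bar> + 1)" and small: "\<bar>q * \<alpha> - p\<bar> < q powr (- w)"
    using approximations_bounds[OF pq w] by auto
  have q: "0 < real_of_int q" using q1 by simp
  have r0: "0 < r" unfolding r using q by simp
  obtain \<xi> j y0 where y0: "y0 \<in> {0..1}" and line: "z = flow_line \<alpha> \<xi> j y0"
    using surface_flow_line[OF z(1)] .
  \<comment> \<open>At this abscissa and height 0, \<open>q x - p y\<close> exceeds its value at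
    \<open>z\<close> by 1/2.\<close>
  define X where "X = \<xi> + (\<alpha> - p / q) * y0 + 1 / (2 * q)"
  define g where "g = pt j (frac X, 0)"
  have unit: "(frac X, 0::real) \<in> {0..1} \<times> {0..1}" using frac_mem[of X] by auto
  have g: "g \<in> surface h v" unfolding g_def by (rule pt_in_surface[OF unit])
  have "q powr w / 4 \<le> t" if t: "r < t" "Dist h v (flow h v \<alpha> t z) g < r" for t
  proof -
    define Z where "Z = y0 + t * ?c"
    have t0: "0 \<le> t" using t r0 by simp
    have Z0: "0 \<le> Z" using line_height[of y0 t] y0 t0 by (simp add: Z_def)
    have fl: "flow h v \<alpha> t z = flow_line \<alpha> \<xi> j Z"
      using flow_eq[of y0 \<alpha> \<xi> j t] y0 t0 z(2) by (simp add: line Z_def)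
    obtain l where l: "broken_path h v (flow_line \<alpha> \<xi> j Z) g l" "l < r"
      using Dist_lessD[OF flow_line_in_surface[OF Z0] g] t(2) unfolding fl by metis
    obtain u u' where u: "torus_pt (\<xi> + \<alpha> * Z, Z) = torus_pt u" "torus_pt (frac X, 0) = torus_pt u'"
      "dist u u' \<le> l"
      using broken_path_torus[OF l(1)] covering_flow_line[OF Z0] covering_pt[OF unit] unfolding g_def by metis
    obtain m1 m2 where m: "\<xi> + \<alpha> * Z - fst u = of_int m1" "Z - snd u = of_int m2"
      using torus_pt_eqD[OF u(1)] by (auto elim!: Ints_cases)
    obtain m3 where m3: "frac X - fst u' = of_int m3"
      using torus_pt_eqD(1)[OF u(2)] by (auto elim!: Ints_cases)
    obtain m4 where m4: "0 - snd u' = of_int m4"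
      using torus_pt_eqD(2)[OF u(2)] unfolding snd_conv by (rule Ints_cases)
    have d: "\<bar>fst u - fst u'\<bar> \<le> r" "\<bar>snd u - snd u'\<bar> \<le> r"
      using dist_fst_le[of u u'] dist_snd_le[of u u'] u(3) l(2) by (auto simp: dist_real_def)
    \<comment> \<open>The integer by which the changes of representatives on the torus alter
      \<open>q x - p y\<close>.\<close>
    define M where "M = q * m1 - p * m2 - (q * (m3 + \<lfloor>X\<rfloor>) - p * m4)"
    have uu: "fst u = \<xi> + \<alpha> * Z - of_int m1" "snd u = Z - of_int m2"
      "fst u' = X - of_int \<lfloor>X\<rfloor> - of_int m3" "snd u' = - of_int m4"
      using m m3 m4 by (auto simp: frac_def)
    have qX: "q * X = q * \<xi> + (q * \<alpha> - p) * y0 + 1 / 2"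
      using q by (simp add: X_def field_simps)
    have "q * (fst u - fst u') - p * (snd u - snd u')
        = q * \<xi> + (q * \<alpha> - p) * Z - q * X - of_int M"
      unfolding uu M_def by (simp add: algebra_simps)
    also have "\<dots> = (q * \<alpha> - p) * (t * ?c) - 1 / 2 - of_int M"
      unfolding qX by (simp add: Z_def algebra_simps)
    finally have eq: "(q * \<alpha> - p) * (t * ?c) - 1 / 2 - of_int M
        = q * (fst u - fst u') - p * (snd u - snd u')" ..
    \<comment> \<open>The Lipschitz constant of \<open>q x - p y\<close> is at most q + |p| \<le>
      (|\<alpha>| + 2) q, and \<open>r\<close> is chosen so that the variation over distance
      \<open>r\<close> is at most 1/8.\<close>
    have "\<bar>q * (fst u - fst u')\<bar> \<le> q * r" using d(1) q by (simp add: abs_mult mult_left_mono)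
    moreover have "\<bar>p * (snd u - snd u')\<bar> \<le> q * (\<bar>\<alpha>\<bar> + 1) * r"
      unfolding abs_mult using d(2) pb q r0 by (intro mult_mono) auto
    moreover have "q * r + q * (\<bar>\<alpha>\<bar> + 1) * r = 1 / 8"
    proof -
      have "q * r + q * (\<bar>\<alpha>\<bar> + 1) * r = ((\<bar>\<alpha>\<bar> + 2) * q) * r" by (simp add: algebra_simps)
      also have "\<dots> = 1 / 8" unfolding r using q by simp
      finally show ?thesis .
    qed
    ultimately have near: "\<bar>(q * \<alpha> - p) * (t * ?c) - 1 / 2 - of_int M\<bar> \<le> 1 / 8" unfolding eq by linarith
    \<comment> \<open>Starting from 0, the variation along the flow has to come within 1/8 of a
      half-integer.\<close>
    have "1 / 4 \<le> \<bar>(q * \<alpha> - p) * (t * ?c)\<bar>"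
    proof (rule ccontr)
      assume "\<not> ?thesis"
      then have "- 1 < real_of_int M" "real_of_int M < 0" using near by linarith+
      then have "- 1 < M" "M < 0" by simp_all
      then show False by simp
    qed
    also have "\<dots> = \<bar>q * \<alpha> - p\<bar> * (t * ?c)" using t0 cos_arctan_bounds(1)[of \<alpha>] by (simp add: abs_mult)
    also have "\<dots> \<le> q powr (- w) * (t * 1)"
      using small t0 cos_arctan_bounds[of \<alpha>] by (intro mult_mono) auto
    finally have "q powr w * (1 / 4) \<le> q powr w * (q powr (- w) * t)" by (intro mult_left_mono) auto
    also have "\<dots> = t" using q by (simp add: powr_add[symmetric] mult.assoc[symmetric])
    finally show ?thesis by simp
  qed
  then have "ereal (q powr w / 4) \<le> Inf (ereal ` {t. t > r \<and> Dist h v (flow h v \<alpha> t z) g < r})"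
    by (intro Inf_greatest) auto
  also have "\<dots> \<le> hitting_time h v \<alpha> z r" unfolding hitting_time_def using g by (rule SUP_upper)
  finally show ?thesis .
qed

lemma diophantine_type_le_hitting_exponent:
  assumes z: "z \<in> surface h v" "z \<notin> singular_leaves h v \<alpha>"
  shows "diophantine_type \<alpha> \<le> hitting_exponent h v \<alpha> z"
  unfolding diophantine_type_eq
proof (rule Sup_least, clarify)
  fix w assume w: "0 < w" and inf: "infinite (approximations \<alpha> w)"
  let ?f = "\<lambda>r. ereal_log (hitting_time h v \<alpha> z r) / ereal (- ln r)"
  show "ereal w \<le> hitting_exponent h v \<alpha> z"
  proof (rule ccontr)
    assume "\<not> ?thesis"
    then have "hitting_exponent h v \<alpha> z < ereal w" by (simp only: not_le)
    then obtain w' where w': "hitting_exponent h v \<alpha> z < ereal w'" "w' < w"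
      using ereal_dense2 by force
    have "eventually (\<lambda>r. ?f r < ereal w') (at_right 0)"
      using w'(1) unfolding hitting_exponent_def by (rule Limsup_lessD)
    then obtain r0 where r0: "0 < r0" "\<And>r. 0 < r \<Longrightarrow> r < r0 \<Longrightarrow> ?f r < ereal w'"
      unfolding eventually_at_right_field by blast
    define A where "A = 8 * (\<bar>\<alpha>\<bar> + 2)"
    have A: "1 < A" by (simp add: A_def)
    \<comment> \<open>The first bound gives \<open>r < r0\<close>, the second makes the logarithms
      positive, and the third contradicts \<open>ln (q powr w / 4) < w' * (- ln r)\<close>.\<close>
    define B where "B = max (1 / (A * r0)) (max 1 (exp ((ln 4 + w' * ln A) / (w - w'))))"
    obtain p q where pq: "(p, q) \<in> approximations \<alpha> w" "B < real_of_int q"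
      using approximations_large[OF inf w] .
    define r where "r = 1 / (8 * ((\<bar>\<alpha>\<bar> + 2) * q))"
    have q: "1 < real_of_int q" "1 / (A * r0) < q" "exp ((ln 4 + w' * ln A) / (w - w')) < q"
      using pq(2) by (auto simp: B_def)
    have rA: "r = 1 / (A * q)" by (simp add: r_def A_def)
    have "1 < (A * r0) * q" using q(2) A r0(1) by (simp add: pos_divide_less_eq mult.commute)
    then have "r < r0" unfolding rA using A q(1) by (simp add: pos_divide_less_eq mult_ac)
    moreover have "0 < r" unfolding rA using A q(1) by simp
    ultimately have less: "?f r < ereal w'" by (intro r0)
    have lnr: "- ln r = ln A + ln q" unfolding rA using A q(1) by (simp add: ln_div ln_mult)
    have pos: "0 < - ln r" unfolding lnr using A q(1) by (simp add: add_pos_pos)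
    have "ereal (ln (q powr w / 4)) \<le> ereal_log (hitting_time h v \<alpha> z r)"
      using hitting_time_ge[OF z w pq(1) r_def] q(1) by (intro ereal_log_ge) auto
    then have "ereal (ln (q powr w / 4)) / ereal (- ln r) \<le> ?f r"
      using pos by (intro ereal_divide_right_mono) auto
    then have "ereal (ln (q powr w / 4)) / ereal (- ln r) < ereal w'" using less by (rule le_less_trans)
    then have "ln (q powr w / 4) / (- ln r) < w'" using pos by simp
    then have "ln (q powr w / 4) < w' * (- ln r)" using pos by (simp only: pos_divide_less_eq)
    then have "w * ln q - ln 4 < w' * (ln A + ln q)"
      using q(1) unfolding lnr by (simp add: ln_div ln_powr)
    then have "ln q * (w - w') < ln 4 + w' * ln A" by (simp add: algebra_simps)
    then have "ln q < (ln 4 + w' * ln A) / (w - w')" using w'(2) by (simp add: pos_less_divide_eq)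
    then have "exp (ln q) < exp ((ln 4 + w' * ln A) / (w - w'))" by simp
    then show False using q by simp
  qed
qed

end

section \<open>Upper bound for the hitting exponent\<close>

context stage_sequence
begin

text \<open>At the stage found for \<open>r\<close>, the bound \<open>r / L \<le> a k\<close> gives
  \<open>q2 k \<le> L / r\<close>. The lower bound on \<open>b k\<close> then turns 4 / b steps into
  a multiple of q2^w, hence of r^(-w).\<close>

lemma hitting_time_le:
  assumes z: "z \<in> surface h v" "z \<notin> singular_leaves h v \<alpha>"
    and w: "0 \<le> w" and c: "0 < c" and b: "\<And>k. c * q2 k powr (- w) \<le> b k"
  obtains C where "0 < C" "\<And>r. 0 < r \<Longrightarrow> r < min 1 (8 * b 0) \<Longrightarrow>
    hitting_time h v \<alpha> z r \<le> ereal (C * r powr (- w))"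
proof -
  let ?c = "cos (arctan \<alpha>)"
  have cos: "0 < ?c" "?c \<le> 1" by (rule cos_arctan_bounds)+
  define L :: real where "L = 8 ^ (short_turns + 2)"
  have L: "0 < L" by (simp add: L_def)
  \<comment> \<open>The summand 4 covers the three initial steps and the heights inside the squares;
    division by the cosine turns height into flow time.\<close>
  define C where "C = (4 + 4 * (L powr w / c)) / ?c"
  have "0 < L powr w / c" using L c by simp
  then have C: "0 < C" unfolding C_def using cos(1) by (intro divide_pos_pos) auto
  have "hitting_time h v \<alpha> z r \<le> ereal (C * r powr (- w))" if r: "0 < r" "r < min 1 (8 * b 0)" for r
    unfolding hitting_time_def
  proof (rule SUP_least)
    fix g assume g: "g \<in> surface h v"
    obtain \<xi> j y0 where y0: "y0 \<in> {0..1}" and line: "z = flow_line \<alpha> \<xi> j y0"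
      using surface_flow_line[OF z(1)] .
    obtain i x where x: "x \<in> {0..1} \<times> {0..1}" "g = pt i x" using g by (rule surfaceE)
    have r': "r < 8 * b 0" using r(2) by simp
    obtain k where k: "r \<le> 8 ^ (short_turns + 2) * a k"
      "\<And>N X j Y i. \<exists>n\<ge>N. (real n - N) * b k \<le> 4 \<and>
        close r ((first_return \<alpha> ^^ n) (normal X j)) (normal Y i)"
      using hitting_steps[OF r(1) r'] by metis
    \<comment> \<open>Counting from 3 makes the flow time at least 2 although \<open>y0\<close> may
      be 1, so that \<open>t > r\<close> holds for \<open>r < 1\<close>.\<close>
    obtain n where n: "3 \<le> n" "(real n - real 3) * b k \<le> 4"
      "close r ((first_return \<alpha> ^^ n) (normal (\<xi> + \<alpha>) j)) (normal (fst x + \<alpha> * (1 - snd x)) i)"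
      using k(2)[of 3 "\<xi> + \<alpha>" j "fst x + \<alpha> * (1 - snd x)" i] by metis
    obtain X X' l where XX: "(first_return \<alpha> ^^ n) (normal (\<xi> + \<alpha>) j) = normal X l"
      "normal (fst x + \<alpha> * (1 - snd x)) i = normal X' l" "\<bar>X - X'\<bar> < r"
      using n(3) unfolding close_def by metis
    define t where "t = (n + snd x - y0) / ?c"
    have xx: "fst x \<in> {0..1}" "snd x \<in> {0..1}" using x(1) by auto
    have hits: "Dist h v (flow h v \<alpha> t z) g < r"
      using Dist_flow_less[OF y0 line z(2) xx _ XX] n(1) r(2) x(2) unfolding t_def by simp
    have "2 \<le> n + snd x - y0" using n(1) xx y0 by simp
    also have "\<dots> \<le> t" unfolding t_def using cos n(1) xx y0 by (simp add: pos_le_divide_eq mult_left_le)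
    finally have t2: "2 \<le> t" .
    have "Inf (ereal ` {t. r < t \<and> Dist h v (flow h v \<alpha> t z) g < r}) \<le> ereal t"
      using hits t2 r(2) by (intro Inf_lower imageI) auto
    also have "t \<le> C * r powr (- w)"
    proof -
      have "r / L \<le> a k" using k(1) L unfolding L_def by (simp add: pos_divide_le_eq mult.commute)
      then have "r / L * q2 k \<le> a k * q2 k" by (intro mult_right_mono) auto
      then have "r / L * q2 k \<le> 1" using aq2[of k] by linarith
      then have q: "q2 k \<le> L / r" using r L by (simp add: field_simps)
      have "q2 k powr w \<le> (L / r) powr w" using q w by (intro powr_mono2) auto
      also have "\<dots> = L powr w * r powr (- w)"
        using L r(1) by (simp add: powr_divide powr_minus_divide)
      finally have q': "q2 k powr w \<le> L powr w * r powr (- w)" .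
      have q0: "0 < real (q2 k)" using pos(3)[of k] by simp
      have one: "q2 k powr (- w) * q2 k powr w = 1" using q0 by (simp add: powr_add[symmetric])
      have n3: "0 \<le> real n - 3" using n(1) by simp
      have "(real n - 3) * (c * q2 k powr (- w)) \<le> (real n - 3) * b k" using b n3 by (intro mult_left_mono) auto
      also have "\<dots> \<le> 4" using n(2) by simp
      finally have "(real n - 3) * (c * q2 k powr (- w)) * q2 k powr w \<le> 4 * q2 k powr w"
        by (intro mult_right_mono) auto
      then have "(real n - 3) * c * (q2 k powr (- w) * q2 k powr w) \<le> 4 * q2 k powr w" by (simp only: mult_ac)
      then have "(real n - 3) * c \<le> 4 * (L powr w * r powr (- w))" using q' unfolding one by simp
      then have "real n - 3 \<le> 4 * (L powr w * r powr (- w)) / c" using c by (simp add: pos_le_divide_eq)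
      also have "\<dots> = 4 * (L powr w / c) * r powr (- w)" by simp
      finally have n4: "real n \<le> 3 + 4 * (L powr w / c) * r powr (- w)" by simp
      have r1: "1 \<le> r powr (- w)"
      proof -
        have "r powr w \<le> 1" using r w by (intro powr_le1) auto
        moreover have "0 < r powr w" using r(1) by simp
        ultimately show ?thesis by (simp add: powr_minus one_le_inverse)
      qed
      have "n + snd x - y0 \<le> real n + 1" using xx y0 by simp
      also have "\<dots> \<le> 4 * r powr (- w) + 4 * (L powr w / c) * r powr (- w)" using n4 r1 by linarith
      also have "\<dots> = (4 + 4 * (L powr w / c)) * r powr (- w)" by (simp only: distrib_right)
      finally have "t \<le> (4 + 4 * (L powr w / c)) * r powr (- w) / ?c"
        unfolding t_def using cos(1) by (intro divide_right_mono) auto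
      then show ?thesis by (simp add: C_def)
    qed
    finally show "Inf (ereal ` {t. r < t \<and> Dist h v (flow h v \<alpha> t z) g < r}) \<le> ereal (C * r powr (- w))"
      by simp
  qed
  with C show thesis by (rule that)
qed

lemma q2_approximation:
  obtains p where "coprime p (int (q2 k))" "\<bar>q2 k * \<alpha> - of_int p\<bar> = b k"
proof -
  obtain p1 p2 where p: "- orient (s k) * b k = q2 k * \<alpha> - of_int p2"
    "p2 * int (q1 k) - p1 * int (q2 k) = (if s k then 1 else - 1)"
    using stage_drift[OF st[of k]] by metis
  show thesis
  proof (rule that[of p2])
    show "coprime p2 (int (q2 k))"
    proof (rule coprimeI)
      fix d assume "d dvd p2" "d dvd int (q2 k)"
      then have "d dvd p2 * int (q1 k) - p1 * int (q2 k)" by simp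
      then show "is_unit d" unfolding p(2) by (simp split: if_splits)
    qed
    show "\<bar>q2 k * \<alpha> - of_int p2\<bar> = b k"
      unfolding p(1)[symmetric] using pos(2)[of k] by (simp add: orient_def abs_mult)
  qed
qed

text \<open>Dirichlet's theorem, read off from \<open>b k * q2 k < 1\<close>. It ensures that an
  exponent above the type is positive, as the set defining the type requires.\<close>

lemma diophantine_type_ge_1: "1 \<le> diophantine_type \<alpha>"
proof -
  have "\<exists>p. coprime p (int (q2 k)) \<and> \<bar>q2 k * \<alpha> - of_int p\<bar> = b k" for k
    using q2_approximation[of k] by metis
  then obtain p where p: "\<And>k. coprime (p k) (int (q2 k))" "\<And>k. \<bar>q2 k * \<alpha> - of_int (p k)\<bar> = b k"
    by metis
  have "(p k, int (q2 k)) \<in> approximations \<alpha> 1" for k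
  proof -
    have q: "0 < real (q2 k)" using pos(3)[of k] by simp
    have "b k * q2 k < a k * q2 k" using ba[of k] q by simp
    then have "b k * q2 k < 1" using aq2[of k] by linarith
    then have b: "b k < 1 / q2 k" using q by (simp only: pos_less_divide_eq)
    have "\<alpha> - p k / q2 k = (q2 k * \<alpha> - p k) / q2 k" using q by (simp add: field_simps)
    then have "\<bar>\<alpha> - p k / q2 k\<bar> = b k / q2 k" using p(2)[of k] q by simp
    also have "\<dots> < 1 / q2 k / q2 k" using b q by (intro divide_strict_right_mono)
    also have "\<dots> = real (q2 k) powr (- (1 + 1))"
      using q by (simp add: powr_minus powr_add inverse_eq_divide power2_eq_square)
    finally show ?thesis using p(1)[of k] pos(3)[of k] by (simp add: approximations_def)
  qed
  then have "range (\<lambda>k. (p k, int (q2 k))) \<subseteq> approximations \<alpha> 1" by blast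
  moreover have "infinite (range (\<lambda>k. (p k, int (q2 k))))"
  proof (rule range_inj_infinite, rule injI)
    fix k l assume "(p k, int (q2 k)) = (p l, int (q2 l))"
    then have "q2 k = q2 l" by simp
    moreover have "strict_mono q2" using q2_less by (simp add: strict_mono_Suc_iff)
    ultimately show "k = l" by (metis strict_mono_eq)
  qed
  ultimately have "infinite (approximations \<alpha> 1)" using infinite_super by blast
  then show ?thesis unfolding diophantine_type_eq by (intro Sup_upper) (auto simp: one_ereal_def)
qed

lemma hitting_exponent_le_diophantine_type:
  assumes irr: "\<alpha> \<notin> \<rat>" and z: "z \<in> surface h v" "z \<notin> singular_leaves h v \<alpha>"
  shows "hitting_exponent h v \<alpha> z \<le> diophantine_type \<alpha>"
proof (rule ccontr)
  assume "\<not> ?thesis"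
  then obtain w' where w': "diophantine_type \<alpha> < ereal w'" "ereal w' < hitting_exponent h v \<alpha> z"
    using ereal_dense2[of "diophantine_type \<alpha>" "hitting_exponent h v \<alpha> z"] by (auto simp: not_le)
  obtain w where w: "diophantine_type \<alpha> < ereal w" "w < w'"
    using ereal_dense2[OF w'(1)] by auto
  have "ereal 1 < ereal w" using diophantine_type_ge_1 w(1) unfolding one_ereal_def by (rule le_less_trans)
  then have w1: "1 < w" by simp
  have "finite (approximations \<alpha> w)"
  proof (rule ccontr)
    assume "infinite (approximations \<alpha> w)"
    then have "ereal w \<le> diophantine_type \<alpha>"
      unfolding diophantine_type_eq using w1 by (intro Sup_upper) auto
    then show False using w(1) by simp
  qed
  then obtain c where c: "0 < c"
    "\<And>p q. 0 < q \<Longrightarrow> coprime p q \<Longrightarrow> c * q powr (- w) \<le> \<bar>q * \<alpha> - of_int p\<bar>"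
    using approximations_finite_bound[OF irr] by metis
  have "c * q2 k powr (- w) \<le> b k" for k
  proof -
    obtain p where "coprime p (int (q2 k))" "\<bar>q2 k * \<alpha> - of_int p\<bar> = b k" by (rule q2_approximation)
    then show ?thesis using c(2)[of "int (q2 k)" p] pos(3)[of k] by simp
  qed
  then obtain C where C: "0 < C" "\<And>r. 0 < r \<Longrightarrow> r < min 1 (8 * b 0) \<Longrightarrow>
      hitting_time h v \<alpha> z r \<le> ereal (C * r powr (- w))"
    using hitting_time_le[OF z _ c(1), of w] w1 by auto
  let ?f = "\<lambda>r. ereal_log (hitting_time h v \<alpha> z r) / ereal (- ln r)"
  \<comment> \<open>Below \<open>r0\<close> the gap between \<open>w\<close> and \<open>w'\<close>
    absorbs the constant \<open>C\<close>.\<close>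
  define r0 where "r0 = min (min 1 (8 * b 0)) (exp (- (ln C / (w' - w))))"
  have "0 < r0" using pos(2)[of 0] by (simp add: r0_def)
  moreover have "?f r \<le> ereal w'" if r: "0 < r" "r < r0" for r
  proof -
    have r1: "r < 1" using r by (simp add: r0_def)
    have "hitting_time h v \<alpha> z r \<le> ereal (C * r powr (- w))" using r by (intro C(2)) (auto simp: r0_def)
    then have "ereal_log (hitting_time h v \<alpha> z r) \<le> ereal (ln (C * r powr (- w)))"
      using C(1) r(1) by (intro ereal_log_le) auto
    moreover have pos: "0 < - ln r" using r(1) r1 by simp
    ultimately have "?f r \<le> ereal (ln (C * r powr (- w))) / ereal (- ln r)"
      by (intro ereal_divide_right_mono) auto
    also have "\<dots> = ereal (ln (C * r powr (- w)) / (- ln r))" using pos by simp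
    also have "ln (C * r powr (- w)) / (- ln r) \<le> w'"
    proof -
      have "ln r < ln (exp (- (ln C / (w' - w))))" using r by (subst ln_less_cancel_iff) (auto simp: r0_def)
      then have "ln C / (w' - w) < - ln r" by simp
      then have "ln C < (- ln r) * (w' - w)" using w(2) by (simp add: pos_divide_less_eq)
      then have "ln C + (- w) * ln r \<le> w' * (- ln r)" by (simp add: algebra_simps)
      moreover have "ln (C * r powr (- w)) = ln C + (- w) * ln r"
        using C(1) r(1) by (simp add: ln_mult ln_powr)
      ultimately show ?thesis using pos by (simp only: pos_divide_le_eq)
    qed
    finally show ?thesis by simp
  qed
  ultimately have "eventually (\<lambda>r. ?f r \<le> ereal w') (at_right 0)"
    unfolding eventually_at_right_field by blast
  then have "hitting_exponent h v \<alpha> z \<le> ereal w'" unfolding hitting_exponent_def by (rule Limsup_bounded)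
  then show False using w'(2) by simp
qed

end

section \<open>The stages of the Ornithorynque\<close>

interpretation ornith: square_tiled ornith_h ornith_v
  by unfold_locales (rule origami_ornith)

text \<open>One turn changes \<open>(s1, s2)\<close> by twists and a swap, so
  \<open>ornith_pair\<close> is preserved along the dependent choice of stages.\<close>

lemma ornith_stage_sequence:
  assumes irr: "\<alpha> \<notin> \<rat>"
  shows "\<exists>s a b q1 q2 m s1 s2. stage_sequence ornith_h ornith_v \<alpha> s a b q1 q2 m s1 s2"
proof -
  define P where "P = (\<lambda>(n::nat) (s, a, b, q1, q2, s1, s2).
    ornith.stage \<alpha> s a b q1 q2 s1 s2 \<and> b < a \<and> q1 \<le> q2 \<and> ornith_pair s1 s2)"
  define Q where "Q = (\<lambda>(n::nat) (s, a :: real, b :: real, q1, q2, s1 :: ornith_index \<Rightarrow> ornith_index,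
      s2 :: ornith_index \<Rightarrow> ornith_index) (s', a', b' :: real, q1', q2', s1', s2').
    \<exists>m. 1 \<le> m \<and> m * b < a \<and> q2 < q2' \<and> s' = (\<not> s) \<and> a' = b \<and> q1' = q2 \<and> q2' = q1 + m * q2 \<and>
      s1' = s2 \<and> s2' = s2 ^^ m \<circ> s1)"
  have "\<exists>f. \<forall>n. P n (f n) \<and> Q n (f n) (f (Suc n))"
  proof (rule dependent_nat_choice)
    have "\<alpha> \<notin> \<int>" using irr Ints_subset_Rats by blast
    note st = ornith.stage_init[OF this]
    let ?s1 = "ipow ornith_h (\<lfloor>\<alpha>\<rfloor> + 1) \<circ> ornith_v \<circ> ipow ornith_h (- 1)"
    let ?s2 = "ipow ornith_h (\<lfloor>\<alpha>\<rfloor> + 1) \<circ> ornith_v"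
    \<comment> \<open>Equal lengths would leave neither side wide at the start.\<close>
    have "frac \<alpha> \<noteq> 1 / 2"
    proof
      assume "frac \<alpha> = 1 / 2"
      then have "\<alpha> = of_int \<lfloor>\<alpha>\<rfloor> + 1 / 2" by (simp add: frac_def)
      moreover have "of_int \<lfloor>\<alpha>\<rfloor> + 1 / 2 \<in> (\<rat> :: real set)" by simp
      ultimately show False using irr by metis
    qed
    then consider "1 - frac \<alpha> < frac \<alpha>" | "frac \<alpha> < 1 - frac \<alpha>" by linarith
    then show "\<exists>x. P 0 x"
    proof cases
      case 1
      then have "P 0 (True, frac \<alpha>, 1 - frac \<alpha>, 1, 1, ?s1, ?s2)"
        using st ornith_pair_initial by (simp add: P_def)
      then show ?thesis by blast
    next
      case 2
      then have "P 0 (False, 1 - frac \<alpha>, frac \<alpha>, 1, 1, ?s2, ?s1)"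
        using ornith.stage_swap[OF st] ornith_pair_swap[OF ornith_pair_initial] by (simp add: P_def)
      then show ?thesis by blast
    qed
    fix x n assume "P n x"
    moreover obtain s a b q1 q2 s1 s2 where x: "x = (s, a, b, q1, q2, s1, s2)" by (cases x)
    ultimately have st: "ornith.stage \<alpha> s a b q1 q2 s1 s2" "b < a" "q1 \<le> q2" and op: "ornith_pair s1 s2"
      by (auto simp: P_def)
    note turn = ornith.stage_turn[OF irr st]
    let ?m = "nat \<lfloor>a / b\<rfloor>"
    let ?y = "(\<not> s, b, a - ?m * b, q2, q1 + ?m * q2, s2, s2 ^^ ?m \<circ> s1)"
    have "P (Suc n) ?y"
      unfolding P_def prod.case
      using turn(2-4) ornith_pair_swap[OF ornith_pair_twists[OF op]] by (intro conjI) simp_all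
    moreover have "Q n x ?y" unfolding Q_def x prod.case using turn by (intro exI[of _ ?m] conjI) simp_all
    ultimately show "\<exists>y. P (Suc n) y \<and> Q n x y" by blast
  qed
  then obtain f where f: "\<And>n. P n (f n)" "\<And>n. Q n (f n) (f (Suc n))" by blast
  define s where "s n = fst (f n)" for n
  define a where "a n = fst (snd (f n))" for n
  define b where "b n = fst (snd (snd (f n)))" for n
  define q1 where "q1 n = fst (snd (snd (snd (f n))))" for n
  define q2 where "q2 n = fst (snd (snd (snd (snd (f n)))))" for n
  define s1 where "s1 n = fst (snd (snd (snd (snd (snd (f n))))))" for n
  define s2 where "s2 n = snd (snd (snd (snd (snd (snd (f n))))))" for n
  have fn: "f n = (s n, a n, b n, q1 n, q2 n, s1 n, s2 n)" for n
    by (simp add: s_def a_def b_def q1_def q2_def s1_def s2_def)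
  have Pn: "ornith.stage \<alpha> (s n) (a n) (b n) (q1 n) (q2 n) (s1 n) (s2 n)" "b n < a n" "q1 n \<le> q2 n"
    "ornith_pair (s1 n) (s2 n)" for n
    using f(1)[of n] unfolding fn P_def by auto
  have "\<exists>m. 1 \<le> m \<and> m * b n < a n \<and> q2 n < q2 (Suc n) \<and> s (Suc n) = (\<not> s n) \<and> a (Suc n) = b n \<and>
    q1 (Suc n) = q2 n \<and> q2 (Suc n) = q1 n + m * q2 n \<and> s1 (Suc n) = s2 n \<and> s2 (Suc n) = s2 n ^^ m \<circ> s1 n" for n
    using f(2)[of n] unfolding fn Q_def prod.case .
  then obtain m where m: "\<And>n. 1 \<le> m n \<and> m n * b n < a n \<and> q2 n < q2 (Suc n) \<and> s (Suc n) = (\<not> s n) \<and>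
    a (Suc n) = b n \<and> q1 (Suc n) = q2 n \<and> q2 (Suc n) = q1 n + m n * q2 n \<and> s1 (Suc n) = s2 n \<and>
    s2 (Suc n) = s2 n ^^ m n \<circ> s1 n" by metis
  have "stage_sequence ornith_h ornith_v \<alpha> s a b q1 q2 m s1 s2"
  proof (unfold_locales)
    fix k j j'
    show "(s2 k ^^ 6) j = j" by (rule ornith_pair_cycles(1)[OF Pn(4)])
    show "(\<exists>i<6. j' = (s2 k ^^ i) j) \<or> (\<exists>i<6. j' = (s2 k ^^ i) (s1 k j))"
      by (rule ornith_pair_cycles(2)[OF Pn(4)])
    show "u i = u j" if "\<And>j. u (s1 k j) = u j" "\<And>j. u (s2 k j) = u j"
      for u :: "ornith_index \<Rightarrow> (bool \<times> ornith_index) set" and i j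
      using that by (rule ornith_pair_cycles(3)[OF Pn(4)])
  qed (use Pn m in blast)+
  then show ?thesis by blast
qed

theorem theorem1p1:
  fixes \<alpha> :: real and p :: "(ornith_index \<times> real \<times> real) set"
  assumes "\<alpha> \<notin> \<rat>"
    and "p \<in> surface ornith_h ornith_v"
    and "p \<notin> singular_leaves ornith_h ornith_v \<alpha>"
  shows "hitting_exponent ornith_h ornith_v \<alpha> p = diophantine_type \<alpha>"
proof (rule antisym)
  obtain s a b q1 q2 m s1 s2 where "stage_sequence ornith_h ornith_v \<alpha> s a b q1 q2 m s1 s2"
    using ornith_stage_sequence[OF assms(1)] by blast
  then show "hitting_exponent ornith_h ornith_v \<alpha> p \<le> diophantine_type \<alpha>"
    by (rule stage_sequence.hitting_exponent_le_diophantine_type[OF _ assms])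
  show "diophantine_type \<alpha> \<le> hitting_exponent ornith_h ornith_v \<alpha> p"
    by (rule ornith.diophantine_type_le_hitting_exponent[OF assms(2,3)])
qed

end
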